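(* For every integer $n\ge1$, \[ \Delta_{e_n}\, \omega(p_n)\Big|_{t=1/q}=\Delta_{e_{n-1}}e_n\Big|_{t=1/q}. \]
   Context: Symmetric functions over $\mathbb{Q}(q,t)$; $e_n,p_n,s_\lambda$ elementary, power sum and Schur functions; $\omega$ the involution with $\omega(e_k)=h_k$. Plethysm $f[A]$: write $f$ in power sums, replace $p_k$ by $A$ with all variables (including $q,t$) raised to the $k$-th power. $B_\mu=\sum_{c\in\mu}q^{a'(c)}t^{l'(c)}$ ($a'(c),l'(c)$ = numbers of cells strictly left of, below $c$). $\widetilde H_\mu$ is the modified Macdonald polynomial (for $\mu\vdash n$ the unique degree-$n$ symmetric function with $\widetilde H_\mu[X(1-q)]\in\mathrm{span}\{s_\lambda:\lambda\ge\mu\}$, $\widetilde H_\mu[X(1-t)]\in\mathrm{span}\{s_\lambda:\lambda\ge\mu'\}$, $\langle\widetilde H_\mu,s_{(n)}\rangle=1$). $\Delta_f\widetilde H_\mu=f[B_\mu]\widetilde H_\mu$. $|_{t=1/q}$ denotes specialization $t=1/q$. *)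

theory Defs
  imports
    "HOL-Library.Multiset"
    "HOL-Computational_Algebra.Computational_Algebra"
    "Jordan_Normal_Form.Determinant"
begin

text \<open>
  A monomial in the variables \<open>x\<^sub>0, x\<^sub>1, \<dots>\<close> is a finite multiset of variable indices; a symmetric
  function is a formal power series of bounded degree (given by its coefficient function) that is
  invariant under all permutations of the variables.
\<close>

typedef (overloaded) 'k symfun =
  "{f :: nat multiset \<Rightarrow> 'k::zero.
      (\<forall>\<pi> m. bij \<pi> \<longrightarrow> f (image_mset \<pi> m) = f m) \<and> (\<exists>d. \<forall>m. f m \<noteq> 0 \<longrightarrow> size m \<le> d)}"
  morphisms coeff_sf Abs_symfun
  by (rule exI[of _ "\<lambda>_. 0"]) simp

setup_lifting type_definition_symfun

lemma finite_splits: "finite {(a, b). a + b = (m :: 'a multiset)}"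
proof (induction m)
  case empty
  have "{(a, b). a + b = ({#} :: 'a multiset)} = {({#}, {#})}" by auto
  then show ?case by simp
next
  case (add x m)
  let ?S = "{(a, b). a + b = m}"
  have "{(a, b). a + b = add_mset x m} \<subseteq>
      (\<lambda>(a, b). (add_mset x a, b)) ` ?S \<union> (\<lambda>(a, b). (a, add_mset x b)) ` ?S"
  proof clarify
    fix a b assume ab: "a + b = add_mset x m"
      and no: "(a, b) \<notin> (\<lambda>(a, b). (a, add_mset x b)) ` ?S"
    then have "x \<in># a \<or> x \<in># b" by (metis union_iff union_single_eq_member)
    then consider a' where "a = add_mset x a'" | b' where "b = add_mset x b'"
      by (meson multi_member_split)
    then show "(a, b) \<in> (\<lambda>(a, b). (add_mset x a, b)) ` ?S"
    proof cases
      case 1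
      then show ?thesis using ab by force
    next
      case 2
      then have "(a, b') \<in> ?S" using ab by simp
      then show ?thesis using no 2 by force
    qed
  qed
  then show ?case using add by (meson finite_UnI finite_imageI finite_subset)
qed

lemma image_mset_inv:
  assumes "bij \<pi>"
  shows "image_mset (inv_into UNIV \<pi>) (image_mset \<pi> m) = m" "image_mset \<pi> (image_mset (inv_into UNIV \<pi>) m) = m"
proof -
  have "inv_into UNIV \<pi> \<circ> \<pi> = id" "\<pi> \<circ> inv_into UNIV \<pi> = id"
    using assms by (simp_all add: bij_is_inj surj_iff[symmetric] bij_is_surj)
  then show "image_mset (inv_into UNIV \<pi>) (image_mset \<pi> m) = m" "image_mset \<pi> (image_mset (inv_into UNIV \<pi>) m) = m"
    by (simp_all only: multiset.map_comp multiset.map_id)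
qed

lemma distinct_image_mset_bij:
  assumes "bij \<pi>"
  shows "(\<forall>i. count (image_mset \<pi> m) i \<le> 1) \<longleftrightarrow> (\<forall>i. count m i \<le> 1)"
proof -
  have c: "count (image_mset \<pi> m) (\<pi> i) = count m i" for i
    using assms by (induction m) (auto simp: bij_is_inj inj_eq)
  show ?thesis using c assms by (metis bij_pointE)
qed

subsection \<open>The algebra of symmetric functions\<close>

instantiation symfun :: (comm_ring_1) comm_ring_1
begin

lift_definition zero_symfun :: "'a symfun" is "\<lambda>_. 0" by simp

lift_definition one_symfun :: "'a symfun" is "\<lambda>m. if m = {#} then 1 else 0"
  by (auto intro!: exI[of _ 0])

lift_definition plus_symfun :: "'a symfun \<Rightarrow> 'a symfun \<Rightarrow> 'a symfun" is "\<lambda>f g m. f m + g m"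
proof safe
  fix f g :: "nat multiset \<Rightarrow> 'a" and d e
  assume *: "\<forall>m. f m \<noteq> 0 \<longrightarrow> size m \<le> d" "\<forall>m. g m \<noteq> 0 \<longrightarrow> size m \<le> e"
  have "size m \<le> max d e" if "f m + g m \<noteq> 0" for m
  proof -
    have "f m \<noteq> 0 \<or> g m \<noteq> 0" using that by auto
    then show ?thesis using * by (meson max.coboundedI1 max.coboundedI2)
  qed
  then show "\<exists>d. \<forall>m. f m + g m \<noteq> 0 \<longrightarrow> size m \<le> d" by blast
qed simp

lift_definition uminus_symfun :: "'a symfun \<Rightarrow> 'a symfun" is "\<lambda>f m. - f m" by simp

definition minus_symfun :: "'a symfun \<Rightarrow> 'a symfun \<Rightarrow> 'a symfun" where
  "minus_symfun F G = F + - G"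

lift_definition times_symfun :: "'a symfun \<Rightarrow> 'a symfun \<Rightarrow> 'a symfun" is
  "\<lambda>f g m. \<Sum>(a, b) | a + b = m. f a * g b"
proof (intro conjI allI impI)
  fix f g :: "nat multiset \<Rightarrow> 'a" and \<pi> :: "nat \<Rightarrow> nat" and m
  assume A: "(\<forall>\<pi> m. bij \<pi> \<longrightarrow> f (image_mset \<pi> m) = f m) \<and> (\<exists>d. \<forall>m. f m \<noteq> 0 \<longrightarrow> size m \<le> d)"
    "(\<forall>\<pi> m. bij \<pi> \<longrightarrow> g (image_mset \<pi> m) = g m) \<and> (\<exists>d. \<forall>m. g m \<noteq> 0 \<longrightarrow> size m \<le> d)"
    and b: "bij \<pi>"
  show "(\<Sum>(a, b) | a + b = image_mset \<pi> m. f a * g b) = (\<Sum>(a, b) | a + b = m. f a * g b)"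
    by (rule sum.reindex_bij_witness[
          where i = "\<lambda>(a, b). (image_mset \<pi> a, image_mset \<pi> b)"
            and j = "\<lambda>(a, b). (image_mset (inv_into UNIV \<pi>) a, image_mset (inv_into UNIV \<pi>) b)"])
      (use A b in \<open>auto simp: image_mset_inv bij_imp_bij_inv simp flip: image_mset_union\<close>)
next
  fix f g :: "nat multiset \<Rightarrow> 'a"
  assume A: "(\<forall>\<pi> m. bij \<pi> \<longrightarrow> f (image_mset \<pi> m) = f m) \<and> (\<exists>d. \<forall>m. f m \<noteq> 0 \<longrightarrow> size m \<le> d)"
    "(\<forall>\<pi> m. bij \<pi> \<longrightarrow> g (image_mset \<pi> m) = g m) \<and> (\<exists>d. \<forall>m. g m \<noteq> 0 \<longrightarrow> size m \<le> d)"
  then obtain d e where *: "\<forall>m. f m \<noteq> 0 \<longrightarrow> size m \<le> d" "\<forall>m. g m \<noteq> 0 \<longrightarrow> size m \<le> e" by blast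
  have "size m \<le> d + e" if nz: "(\<Sum>(a, b) | a + b = m. f a * g b) \<noteq> 0" for m
  proof -
    obtain a b where "a + b = m" "f a * g b \<noteq> 0"
      using nz by (smt (verit) case_prodE mem_Collect_eq sum.neutral old.prod.case)
    then have "f a \<noteq> 0" "g b \<noteq> 0" by auto
    then have "size a \<le> d" "size b \<le> e" using * by blast+
    then show ?thesis using \<open>a + b = m\<close> by auto
  qed
  then show "\<exists>d. \<forall>m. (\<Sum>(a, b) | a + b = m. f a * g b) \<noteq> 0 \<longrightarrow> size m \<le> d" by blast
qed

instance
proof
  fix F G K :: "'a symfun"
  show "F * G * K = F * (G * K)"
  proof transfer
    fix f g h :: "nat multiset \<Rightarrow> 'a"
    have L: "(\<Sum>(a, b) | a + b = m. (\<Sum>(c, d) | c + d = a. f c * g d) * h b)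
        = (\<Sum>(c, d, b) | c + d + b = m. f c * (g d * h b))" for m
    proof -
      have "(\<Sum>(a, b) | a + b = m. (\<Sum>(c, d) | c + d = a. f c * g d) * h b)
          = (\<Sum>p | fst p + snd p = m. \<Sum>r | fst r + snd r = fst p. f (fst r) * (g (snd r) * h (snd p)))"
        by (simp add: case_prod_unfold sum_distrib_right mult.assoc)
      also have "\<dots> = (\<Sum>(p, r) \<in> (SIGMA p : {p. fst p + snd p = m}. {r. fst r + snd r = fst p}).
          f (fst r) * (g (snd r) * h (snd p)))"
        using finite_splits by (subst sum.Sigma) (auto simp: case_prod_unfold)
      also have "\<dots> = (\<Sum>(c, d, b) | c + d + b = m. f c * (g d * h b))"
        by (rule sum.reindex_bij_witness[where i = "\<lambda>(c, d, b). ((c + d, b), (c, d))"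
              and j = "\<lambda>(p, r). (fst r, snd r, snd p)"]) auto
      finally show ?thesis .
    qed
    have R: "(\<Sum>(c, e) | c + e = m. f c * (\<Sum>(d, b) | d + b = e. g d * h b))
        = (\<Sum>(c, d, b) | c + d + b = m. f c * (g d * h b))" for m
    proof -
      have "(\<Sum>(c, e) | c + e = m. f c * (\<Sum>(d, b) | d + b = e. g d * h b))
          = (\<Sum>p | fst p + snd p = m. \<Sum>r | fst r + snd r = snd p. f (fst p) * (g (fst r) * h (snd r)))"
        by (simp add: case_prod_unfold sum_distrib_left)
      also have "\<dots> = (\<Sum>(p, r) \<in> (SIGMA p : {p. fst p + snd p = m}. {r. fst r + snd r = snd p}).
          f (fst p) * (g (fst r) * h (snd r)))"
        using finite_splits by (subst sum.Sigma) (auto simp: case_prod_unfold)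
      also have "\<dots> = (\<Sum>(c, d, b) | c + d + b = m. f c * (g d * h b))"
        by (rule sum.reindex_bij_witness[where i = "\<lambda>(c, d, b). ((c, d + b), (d, b))"
              and j = "\<lambda>(p, r). (fst p, fst r, snd r)"]) (auto simp: add.assoc)
      finally show ?thesis .
    qed
    show "(\<lambda>m. \<Sum>(a, b) | a + b = m. (\<Sum>(c, d) | c + d = a. f c * g d) * h b)
        = (\<lambda>m. \<Sum>(c, e) | c + e = m. f c * (\<Sum>(d, b) | d + b = e. g d * h b))"
      unfolding L R ..
  qed
  show "F * G = G * F"
  proof (transfer, rule ext)
    fix f g :: "nat multiset \<Rightarrow> 'a" and m
    show "(\<Sum>(a, b) | a + b = m. f a * g b) = (\<Sum>(a, b) | a + b = m. g a * f b)"
      by (rule sum.reindex_bij_witness[where i = prod.swap and j = prod.swap])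
        (auto simp: add.commute mult.commute)
  qed
  show "1 * F = F"
  proof (transfer, rule ext)
    fix f :: "nat multiset \<Rightarrow> 'a" and m
    have "(\<Sum>(a, b) | a + b = m. (if a = {#} then 1 else 0) * f b)
        = (\<Sum>(a, b) \<in> {({#} :: nat multiset, m)}. (if a = {#} then 1 else 0) * f b)"
      by (rule sum.mono_neutral_right) (auto simp: finite_splits split: if_splits)
    then show "(\<Sum>(a, b) | a + b = m. (if a = {#} then 1 else 0) * f b) = f m" by simp
  qed
  show "(F + G) * K = F * K + G * K"
    by transfer (simp add: case_prod_unfold distrib_right sum.distrib)
  show "F + G + K = F + (G + K)" by transfer (simp add: add.assoc)
  show "F + G = G + F" by transfer (simp add: add.commute)
  show "0 + F = F" by transfer simp
  show "- F + F = 0" by transfer simp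
  show "F - G = F + - G" by (simp add: minus_symfun_def)
  show "(0 :: 'a symfun) \<noteq> 1"
    by transfer (metis zero_neq_one)
qed

end

lift_definition const_sf :: "'k::comm_ring_1 \<Rightarrow> 'k symfun" is "\<lambda>c m. if m = {#} then c else 0"
  by (auto intro!: exI[of _ 0])

definition scale_sf :: "'k::comm_ring_1 \<Rightarrow> 'k symfun \<Rightarrow> 'k symfun" where
  "scale_sf c F = const_sf c * F"

lemma vector_space_scale_sf: "vector_space (scale_sf :: 'k::field \<Rightarrow> _)"
proof
  have add: "const_sf (a + b) = const_sf a + const_sf b" for a b :: 'k
    by transfer auto
  have one: "const_sf (1 :: 'k) = 1"
    by transfer auto
  have mult: "const_sf (a * b) = const_sf a * const_sf b" for a b :: 'k
  proof (transfer, rule ext)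
    fix a b :: 'k and m :: "nat multiset"
    have "(\<Sum>(u, v) | u + v = m. (if u = {#} then a else 0) * (if v = {#} then b else 0))
        = (\<Sum>(u, v) \<in> (if m = {#} then {({#} :: nat multiset, {#} :: nat multiset)} else {}).
             (if u = {#} then a else 0) * (if v = {#} then b else 0))"
      by (rule sum.mono_neutral_right) (auto simp: finite_splits split: if_splits)
    then show "(if m = {#} then a * b else 0)
        = (\<Sum>(u, v) | u + v = m. (if u = {#} then a else 0) * (if v = {#} then b else 0))"
      by simp
  qed
  fix a b :: 'k and F G :: "'k symfun"
  show "scale_sf a (F + G) = scale_sf a F + scale_sf a G"
    by (simp add: scale_sf_def distrib_left)
  show "scale_sf (a + b) F = scale_sf a F + scale_sf b F"
    by (simp add: scale_sf_def add distrib_right)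
  show "scale_sf a (scale_sf b F) = scale_sf (a * b) F"
    by (simp add: scale_sf_def mult mult.assoc)
  show "scale_sf 1 F = F"
    by (simp add: scale_sf_def one)
qed

definition linear_sf :: "('k::field symfun \<Rightarrow> 'k symfun) \<Rightarrow> bool" where
  "linear_sf \<phi> \<longleftrightarrow> Vector_Spaces.linear scale_sf scale_sf \<phi>"

definition algebra_hom_sf :: "('k::field symfun \<Rightarrow> 'k symfun) \<Rightarrow> bool" where
  "algebra_hom_sf \<phi> \<longleftrightarrow> linear_sf \<phi> \<and> \<phi> 1 = 1 \<and> (\<forall>F G. \<phi> (F * G) = \<phi> F * \<phi> G)"

definition homogeneous_sf :: "nat \<Rightarrow> 'k::zero symfun \<Rightarrow> bool" where
  "homogeneous_sf n F \<longleftrightarrow> (\<forall>m. coeff_sf F m \<noteq> 0 \<longrightarrow> size m = n)"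

subsection \<open>The classical families\<close>

lift_definition elem_sf :: "nat \<Rightarrow> 'k::comm_ring_1 symfun" is
  "\<lambda>n m. if size m = n \<and> (\<forall>i. count m i \<le> 1) then 1 else 0"
  by (auto simp: distinct_image_mset_bij simp del: One_nat_def)

lift_definition complete_sf :: "nat \<Rightarrow> 'k::comm_ring_1 symfun" is
  "\<lambda>n m. if size m = n then 1 else 0"
  by auto

text \<open>Only \<open>n \<ge> 1\<close> is meaningful for the power sum \<open>p\<^sub>n\<close>.\<close>

lift_definition power_sf :: "nat \<Rightarrow> 'k::comm_ring_1 symfun" is
  "\<lambda>n m. if \<exists>i. m = replicate_mset n i then 1 else 0"
proof (intro conjI allI impI)
  fix n \<pi> and m :: "nat multiset" assume b: "bij (\<pi> :: nat \<Rightarrow> nat)"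
  have "(\<exists>i. image_mset \<pi> m = replicate_mset n i) \<longleftrightarrow> (\<exists>i. m = replicate_mset n i)"
    using b by (metis image_mset_inv(1) image_replicate_mset)
  then show "(if \<exists>i. image_mset \<pi> m = replicate_mset n i then 1 else 0)
      = (if \<exists>i. m = replicate_mset n i then 1 else 0 :: 'k)" by simp
qed (auto intro!: exI)

text \<open>Partitions are weakly decreasing lists of positive integers.\<close>

definition partitions_of :: "nat \<Rightarrow> nat list set" where
  "partitions_of n = {\<mu>. sorted_wrt (\<ge>) \<mu> \<and> 0 \<notin> set \<mu> \<and> sum_list \<mu> = n}"

definition partitions :: "nat list set" where
  "partitions = (\<Union>n. partitions_of n)"

definition conjugate :: "nat list \<Rightarrow> nat list" where
  "conjugate \<mu> = map (\<lambda>j. length (filter (\<lambda>r. j < r) \<mu>)) [0..<(case \<mu> of [] \<Rightarrow> 0 | r # _ \<Rightarrow> r)]"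

text \<open>Dominance order \<open>\<nu> \<ge> \<mu>\<close>, used for partitions of the same number.\<close>

definition dominates :: "nat list \<Rightarrow> nat list \<Rightarrow> bool" where
  "dominates \<nu> \<mu> \<longleftrightarrow> (\<forall>k. sum_list (take k \<mu>) \<le> sum_list (take k \<nu>))"

text \<open>
  Schur functions, by the Jacobi--Trudi formula
  \<open>s\<^sub>\<nu> = det (h\<^bsub>\<nu>\<^sub>i - i + j\<^esub>)\<close>, where \<open>h\<^sub>k = 0\<close> for \<open>k < 0\<close>.
\<close>

definition schur_sf :: "nat list \<Rightarrow> 'k::comm_ring_1 symfun" where
  "schur_sf \<nu> = det (mat (length \<nu>) (length \<nu>)
     (\<lambda>(i, j). if i \<le> \<nu> ! i + j then complete_sf (\<nu> ! i + j - i) else 0))"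

definition omega_sf :: "'k::field symfun \<Rightarrow> 'k symfun" where
  "omega_sf = (THE \<phi>. algebra_hom_sf \<phi> \<and> (\<forall>k. \<phi> (elem_sf k) = complete_sf k))"

text \<open>The Hall scalar product: the bilinear form for which the Schur functions are orthonormal.\<close>

definition hall_inner :: "'k::field symfun \<Rightarrow> 'k symfun \<Rightarrow> 'k" where
  "hall_inner = (THE B.
     (\<forall>G. Vector_Spaces.linear scale_sf (*) (\<lambda>F. B F G)) \<and>
     (\<forall>F. Vector_Spaces.linear scale_sf (*) (B F)) \<and>
     (\<forall>\<nu>\<in>partitions. \<forall>\<mu>\<in>partitions. B (schur_sf \<nu>) (schur_sf \<mu>) = (if \<nu> = \<mu> then 1 else 0)))"

subsection \<open>The coefficient field and substitutions for \<open>q\<close> and \<open>t\<close>\<close>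

text \<open>
  The field \<open>\<rat>(q,t)\<close> is the fraction field of \<open>\<rat>[q][t]\<close>: the outer polynomial variable is \<open>t\<close>,
  the inner one is \<open>q\<close>.
\<close>

type_synonym ratfun = "rat poly poly fract"

definition q_var :: ratfun where
  "q_var = to_fract [: [:0, 1:] :]"

definition t_var :: ratfun where
  "t_var = to_fract [:0, 1:]"

definition eval_qt :: "'a::field_char_0 \<Rightarrow> 'a \<Rightarrow> rat poly poly \<Rightarrow> 'a" where
  "eval_qt x y P = poly (map_poly (\<lambda>c. poly (map_poly of_rat c) x) P) y"

text \<open>
  \<open>f(x,y)\<close> is defined iff \<open>f\<close> can be written with a denominator not vanishing at \<open>(x,y)\<close>.
\<close>

definition ratfun_defined_at :: "'a::field_char_0 \<Rightarrow> 'a \<Rightarrow> ratfun \<Rightarrow> bool" where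
  "ratfun_defined_at x y f \<longleftrightarrow> (\<exists>a b. f = Fract a b \<and> eval_qt x y b \<noteq> 0)"

definition ratfun_eval :: "'a::field_char_0 \<Rightarrow> 'a \<Rightarrow> ratfun \<Rightarrow> 'a" where
  "ratfun_eval x y f = (if ratfun_defined_at x y f
     then THE v. \<exists>a b. f = Fract a b \<and> eval_qt x y b \<noteq> 0 \<and> v = eval_qt x y a / eval_qt x y b
     else 0)"

lemma ratfun_eval_0 [simp]: "ratfun_eval x y 0 = 0"
proof -
  have e0: "eval_qt x y 0 = 0" by (simp add: eval_qt_def)
  have e1: "eval_qt x y 1 = 1" by (simp add: eval_qt_def)
  have z: "a = 0" if "0 = Fract a b" "eval_qt x y b \<noteq> 0" for a b
  proof -
    have "b \<noteq> 0" using that(2) e0 by auto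
    then show ?thesis using that(1) by (simp add: Zero_fract_def eq_fract)
  qed
  have "(THE v. \<exists>a b. 0 = Fract a b \<and> eval_qt x y b \<noteq> 0 \<and> v = eval_qt x y a / eval_qt x y b) = 0"
  proof (intro the_equality)
    show "\<exists>a b. 0 = Fract a b \<and> eval_qt x y b \<noteq> 0 \<and> 0 = eval_qt x y a / eval_qt x y b"
      by (rule exI[of _ 0], rule exI[of _ 1]) (simp add: Zero_fract_def e0 e1)
  next
    fix v assume "\<exists>a b. 0 = Fract a b \<and> eval_qt x y b \<noteq> 0 \<and> v = eval_qt x y a / eval_qt x y b"
    then obtain a b where "0 = Fract a b" "eval_qt x y b \<noteq> 0" "v = eval_qt x y a / eval_qt x y b"
      by blast
    moreover from this have "a = 0" by (intro z)
    ultimately show "v = 0" using e0 by simp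
  qed
  then show ?thesis by (simp add: ratfun_eval_def)
qed

lift_definition subst_sf :: "'a::field_char_0 \<Rightarrow> 'a \<Rightarrow> ratfun symfun \<Rightarrow> 'a symfun" is
  "\<lambda>x y f m. ratfun_eval x y (f m)"
  by (metis ratfun_eval_0)

definition subst_sf_defined :: "'a::field_char_0 \<Rightarrow> 'a \<Rightarrow> ratfun symfun \<Rightarrow> bool" where
  "subst_sf_defined x y F \<longleftrightarrow> (\<forall>m. ratfun_defined_at x y (coeff_sf F m))"

text \<open>The specialization \<open>t = 1/q\<close>, with values in symmetric functions over \<open>\<rat>(q)\<close>.\<close>

definition q_gen :: "rat poly fract" where
  "q_gen = to_fract [:0, 1:]"

definition specialize :: "ratfun symfun \<Rightarrow> rat poly fract symfun" where
  "specialize = subst_sf q_gen (1 / q_gen)"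

definition specializable :: "ratfun symfun \<Rightarrow> bool" where
  "specializable = subst_sf_defined q_gen (1 / q_gen)"

subsection \<open>Plethysm\<close>

text \<open>
  Replaces each variable \<open>x\<^sub>i\<close> by \<open>x\<^sub>i\<^sup>k\<close> (for \<open>k \<ge> 1\<close>), leaving the coefficients alone: the sum has at
  most one term.
\<close>

lift_definition raise_vars :: "nat \<Rightarrow> 'k::comm_ring_1 symfun \<Rightarrow> 'k symfun" is
  "\<lambda>k f m. \<Sum>m' | repeat_mset k m' = m. f m'"
proof (intro conjI allI impI)
  fix k :: nat and f :: "nat multiset \<Rightarrow> 'k" and \<pi> :: "nat \<Rightarrow> nat" and m
  assume A: "(\<forall>\<pi> m. bij \<pi> \<longrightarrow> f (image_mset \<pi> m) = f m) \<and> (\<exists>d. \<forall>m. f m \<noteq> 0 \<longrightarrow> size m \<le> d)"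
    and b: "bij \<pi>"
  have r: "repeat_mset k (image_mset \<rho> u) = image_mset \<rho> (repeat_mset k u)" for \<rho> :: "nat \<Rightarrow> nat" and u
    by (induction k) auto
  show "(\<Sum>m' | repeat_mset k m' = image_mset \<pi> m. f m') = (\<Sum>m' | repeat_mset k m' = m. f m')"
    by (rule sum.reindex_bij_witness[where i = "image_mset \<pi>" and j = "image_mset (inv_into UNIV \<pi>)"])
      (use A b in \<open>auto simp: image_mset_inv bij_imp_bij_inv r\<close>)
next
  fix k :: nat and f :: "nat multiset \<Rightarrow> 'k"
  assume A: "(\<forall>\<pi> m. bij \<pi> \<longrightarrow> f (image_mset \<pi> m) = f m) \<and> (\<exists>d. \<forall>m. f m \<noteq> 0 \<longrightarrow> size m \<le> d)"
  then obtain d where d: "\<forall>m. f m \<noteq> 0 \<longrightarrow> size m \<le> d" by blast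
  have "size m \<le> k * d" if nz: "(\<Sum>m' | repeat_mset k m' = m. f m') \<noteq> 0" for m
  proof -
    obtain m' where "repeat_mset k m' = m" "f m' \<noteq> 0"
      using nz by (metis (mono_tags, lifting) mem_Collect_eq sum.neutral)
    then show ?thesis using d by auto
  qed
  then show "\<exists>d. \<forall>m. (\<Sum>m' | repeat_mset k m' = m. f m') \<noteq> 0 \<longrightarrow> size m \<le> d" by blast
qed

text \<open>\<open>A\<close> with all variables, including \<open>q\<close> and \<open>t\<close>, raised to the \<open>k\<close>-th power.\<close>

definition raise_all :: "nat \<Rightarrow> ratfun symfun \<Rightarrow> ratfun symfun" where
  "raise_all k A = raise_vars k (subst_sf (q_var ^ k) (t_var ^ k) A)"

text \<open>
  \<open>f[A]\<close>: writing \<open>f\<close> as a polynomial in the power sums with coefficients in \<open>\<rat>(q,t)\<close> and replacing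
  each \<open>p\<^sub>k\<close> amounts to applying the algebra homomorphism determined by the images of the \<open>p\<^sub>k\<close>;
  the coefficients of \<open>f\<close> itself are left unchanged.
\<close>

definition plethysm :: "ratfun symfun \<Rightarrow> ratfun symfun \<Rightarrow> ratfun symfun" where
  "plethysm f A = (THE \<phi>. algebra_hom_sf \<phi> \<and> (\<forall>k\<ge>1. \<phi> (power_sf k) = raise_all k A)) f"

text \<open>In plethystic notation \<open>X = x\<^sub>0 + x\<^sub>1 + \<dots>\<close>.\<close>

abbreviation X_sf :: "ratfun symfun" where
  "X_sf \<equiv> power_sf 1"

subsection \<open>Modified Macdonald polynomials and Delta operators\<close>

text \<open>
  In French notation, the cell \<open>(i, j)\<close> lies in row \<open>i\<close> from the bottom and column \<open>j\<close> from the left,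
  both counted from 0, so that \<open>a' = j\<close> and \<open>l' = i\<close>.
\<close>

definition cells :: "nat list \<Rightarrow> (nat \<times> nat) set" where
  "cells \<mu> = {(i, j). i < length \<mu> \<and> j < \<mu> ! i}"

definition B_poly :: "nat list \<Rightarrow> ratfun" where
  "B_poly \<mu> = (\<Sum>(i, j)\<in>cells \<mu>. q_var ^ j * t_var ^ i)"

definition macdonald_H :: "nat list \<Rightarrow> ratfun symfun" where
  "macdonald_H \<mu> = (let n = sum_list \<mu> in THE F.
     homogeneous_sf n F \<and>
     plethysm F (X_sf * (1 - const_sf q_var)) \<in>
       Modules.module.span scale_sf {schur_sf \<nu> | \<nu>. \<nu> \<in> partitions_of n \<and> dominates \<nu> \<mu>} \<and>
     plethysm F (X_sf * (1 - const_sf t_var)) \<in>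
       Modules.module.span scale_sf {schur_sf \<nu> | \<nu>. \<nu> \<in> partitions_of n \<and> dominates \<nu> (conjugate \<mu>)} \<and>
     hall_inner F (schur_sf (if n = 0 then [] else [n])) = 1)"

text \<open>\<open>\<Delta>\<^sub>f\<close> is the linear operator with \<open>\<Delta>\<^sub>f H\<^sub>\<mu> = f[B\<^sub>\<mu>] H\<^sub>\<mu>\<close> for all partitions \<open>\<mu>\<close>.\<close>

definition Delta_op :: "ratfun symfun \<Rightarrow> ratfun symfun \<Rightarrow> ratfun symfun" where
  "Delta_op f = (THE D. linear_sf D \<and>
     (\<forall>\<mu>\<in>partitions. D (macdonald_H \<mu>) = plethysm f (const_sf (B_poly \<mu>)) * macdonald_H \<mu>))"

end

theory Submission
  imports Defs "HOL-Combinatorics.Permutations"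
begin

text \<open>
  The constant term in \<open>z\<close> of \<open>F[X + (1 - q) (1 - t) / z] \<Sum>\<^sub>k (- z)\<^sup>k e\<^sub>k\<close> defines an operator \<open>D\<close> that is symmetric
  in \<open>q\<close> and \<open>t\<close> and triangular, for dominance, on the products of the \<open>h\<^sub>n[X / (1 - q)]\<close>, with diagonal
  entries \<open>1 - (1 - q) (1 - t) B\<^sub>\<mu>\<close>. Its eigenvectors are therefore the \<open>H\<^sub>\<mu>\<close> up to normalization, and \<open>\<Delta>\<^sub>f\<close> acts on
  each degree as a Lagrange interpolation polynomial in \<open>D\<close>. The eigenvalues of a given degree remain
  distinct at \<open>t = 1/q\<close>, so \<open>\<Delta>\<^sub>f\<close> can be specialized before it is applied. At \<open>t = 1/q\<close> the eigenvectors for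
  hooks are \<open>s\<^bsub>(r,1^m)\<^esub>[X / (1 - q)]\<close>; both \<open>p\<^sub>n\<close> and \<open>e\<^sub>n\<close> are combinations of these, and the two sides
  agree coefficientwise because \<open>e\<^sub>n[B\<^sub>\<mu>]\<close> and \<open>e\<^bsub>n-1\<^esub>[B\<^sub>\<mu>]\<close> differ by an explicit factor for a hook \<open>\<mu>\<close>.
\<close>

subsection \<open>Power sums as a basis\<close>

text \<open>Both triangularity conditions on H_mu come from the same operator: at a = q it gives the
  first one, and after exchanging a and b the second one with conjugate partitions. Since
  conjugation reverses dominance, the two conditions together leave a single line, and the remaining
  condition can be met only if the pairing of an eigenvector with s_(n) is nonzero. This is why
  coefficient rings are carried through the elimination. Off-diagonal entries of \<open>macD\<close>
  are divisible by (1 - b)^2, while differences of eigenvalues account for only one factor 1 - b. So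
  every eigenvector is a product of h_n[X/(1 - q)] plus terms that vanish at t = 1, and there the
  pairing is computable as evaluation in one variable. At t = 1/q, in contrast, the eigenvectors
  over Q(q,t) are never specialized, as their denominators are not controlled at that point; only
  the operator is. The hook eigenvectors at t = 1/q are constructed independently, directly over
  Q(q).\<close>

lemmas coeff_sf_simps = zero_symfun.rep_eq one_symfun.rep_eq plus_symfun.rep_eq uminus_symfun.rep_eq
  const_sf.rep_eq elem_sf.rep_eq complete_sf.rep_eq power_sf.rep_eq

lemma symfun_eqI: "(\<And>m. coeff_sf F m = coeff_sf G m) \<Longrightarrow> F = G"
  by (simp add: coeff_sf_inject[symmetric] fun_eq_iff)

lemma coeff_sf_minus: "coeff_sf (F - G) m = coeff_sf F m - coeff_sf G m"
  by (simp add: minus_symfun_def coeff_sf_simps del: add_uminus_conv_diff)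

lemma coeff_sf_sum: "coeff_sf (\<Sum>i\<in>I. f i) m = (\<Sum>i\<in>I. coeff_sf (f i) m)"
  by (induction I rule: infinite_finite_induct) (simp_all add: coeff_sf_simps)

lemma coeff_sf_image_mset: "bij \<pi> \<Longrightarrow> coeff_sf F (image_mset \<pi> m) = coeff_sf F m"
  using coeff_sf[of F] by simp

lemma coeff_sf_bounded: obtains d where "\<And>m. coeff_sf F m \<noteq> 0 \<Longrightarrow> size m \<le> d"
  using coeff_sf[of F] by auto

lemma coeff_sf_const_times: "coeff_sf (const_sf c * F) m = c * coeff_sf F m"
proof -
  have "coeff_sf (const_sf c * F) m
      = (\<Sum>(a, b) \<in> {({#} :: nat multiset, m)}. (if a = {#} then c else 0) * coeff_sf F b)"
    unfolding times_symfun.rep_eq const_sf.rep_eq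
    by (rule sum.mono_neutral_right) (auto simp: finite_splits split: if_splits)
  then show ?thesis by simp
qed

lemma const_sf_1 [simp]: "const_sf 1 = 1"
  and const_sf_0 [simp]: "const_sf 0 = 0"
  and const_sf_add: "const_sf (c + d) = const_sf c + const_sf d"
  and const_sf_uminus: "const_sf (- c) = - const_sf c"
  by (rule symfun_eqI, simp add: coeff_sf_simps)+

lemma const_sf_mult: "const_sf (c * d) = const_sf c * const_sf d"
  by (rule symfun_eqI) (simp add: coeff_sf_const_times coeff_sf_simps)

lemma const_sf_diff: "const_sf (c - d) = const_sf c - const_sf d"
  by (rule symfun_eqI) (simp add: coeff_sf_minus coeff_sf_simps)

lemma const_sf_power: "const_sf (c ^ n) = const_sf c ^ n"
  by (induction n) (simp_all add: const_sf_mult)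

lemma const_sf_of_nat: "const_sf (of_nat n) = of_nat n"
  by (induction n) (simp_all add: const_sf_add)

lemma const_sf_sum: "const_sf (\<Sum>i\<in>I. f i) = (\<Sum>i\<in>I. const_sf (f i))"
  by (induction I rule: infinite_finite_induct) (simp_all add: const_sf_add)

lemma const_sf_inverse_cancel [simp]:
  "(c :: 'k::field) \<noteq> 0 \<Longrightarrow> const_sf (inverse c) * (const_sf c * F) = F"
  "(c :: 'k::field) \<noteq> 0 \<Longrightarrow> const_sf c * (const_sf (inverse c) * F) = F"
  by (simp_all add: mult.assoc[symmetric] const_sf_mult[symmetric])

lemma of_nat_times_symfun_eq_0:
  fixes F :: "'k::field_char_0 symfun"
  assumes "of_nat n * F = 0" "n \<noteq> 0"
  shows "F = 0"
proof -
  have "const_sf (inverse (of_nat n)) * (const_sf (of_nat n) * F) = F"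
    using assms by (intro const_sf_inverse_cancel) simp
  then show ?thesis using assms by (simp add: const_sf_of_nat)
qed

interpretation sf: vector_space "scale_sf :: 'k::field \<Rightarrow> 'k symfun \<Rightarrow> 'k symfun"
  by (rule vector_space_scale_sf)

text \<open>A monomial of the product arises by choosing the variable whose k-th power comes from
  p_k; for k >= 1 different choices give different splittings of the monomial.\<close>

lemma coeff_power_sf_times:
  fixes F :: "'k::comm_ring_1 symfun"
  assumes "k \<ge> 1"
  shows "coeff_sf (power_sf k * F) m
    = (\<Sum>i | i \<in># m \<and> k \<le> count m i. coeff_sf F (m - replicate_mset k i))"
proof -
  let ?I = "{i. i \<in># m \<and> k \<le> count m i}"
  have inj: "inj_on (\<lambda>i. (replicate_mset k i, m - replicate_mset k i)) ?I"
    by (rule inj_onI) (use assms in \<open>auto simp: replicate_mset_eq_iff\<close>)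
  have "coeff_sf (power_sf k * F) m = (\<Sum>(a, b) | a + b = m. (if \<exists>i. a = replicate_mset k i then 1 else 0) * coeff_sf F b)"
    by (simp add: times_symfun.rep_eq power_sf.rep_eq)
  also have "\<dots> = (\<Sum>(a, b) \<in> (\<lambda>i. (replicate_mset k i, m - replicate_mset k i)) ` ?I. coeff_sf F b)"
  proof (rule sum.mono_neutral_cong_right[OF finite_splits])
    show "(\<lambda>i. (replicate_mset k i, m - replicate_mset k i)) ` ?I \<subseteq> {(a, b). a + b = m}"
      by (auto simp: count_le_replicate_mset_subset_eq)
    show "\<forall>p\<in>{(a, b). a + b = m} - (\<lambda>i. (replicate_mset k i, m - replicate_mset k i)) ` ?I.
        (case p of (a, b) \<Rightarrow> (if \<exists>i. a = replicate_mset k i then 1 else 0) * coeff_sf F b) = 0"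
    proof (rule ballI)
      fix p assume p: "p \<in> {(a, b). a + b = m} - (\<lambda>i. (replicate_mset k i, m - replicate_mset k i)) ` ?I"
      obtain a b where ab: "p = (a, b)" "a + b = m" using p by auto
      have "a \<noteq> replicate_mset k i" for i
      proof
        assume a: "a = replicate_mset k i"
        then have "b = m - replicate_mset k i" "i \<in> ?I" using ab(2) assms by auto
        then show False using p ab(1) a by blast
      qed
      then show "(case p of (a, b) \<Rightarrow> (if \<exists>i. a = replicate_mset k i then 1 else 0) * coeff_sf F b) = 0"
        using ab by simp
    qed
  qed auto
  also have "\<dots> = (\<Sum>i\<in>?I. coeff_sf F (m - replicate_mset k i))"
    by (subst sum.reindex[OF inj]) simp
  finally show ?thesis .
qed

section \<open>Exponent types of monomials and triangularity of power sum products\<close>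

abbreviation mprod :: "(nat \<Rightarrow> 'a::comm_monoid_mult) \<Rightarrow> nat multiset \<Rightarrow> 'a" where
  "mprod x K \<equiv> prod_mset (image_mset x K)"

text \<open>The partition formed by the exponents; it classifies monomials up to permutations of the
  variables.\<close>

definition mon_type :: "nat multiset \<Rightarrow> nat multiset" where
  "mon_type m = image_mset (count m) (mset_set (set_mset m))"

lemma mon_type_empty [simp]: "mon_type {#} = {#}"
  by (simp add: mon_type_def)

lemma size_mon_type: "size (mon_type m) = card (set_mset m)"
  by (simp add: mon_type_def)

lemma mon_type_pos: "0 \<notin># mon_type m"
  by (auto simp: mon_type_def count_eq_zero_iff)

lemma sum_mon_type: "sum_mset (mon_type m) = size m"
  unfolding mon_type_def size_multiset_overloaded_eq sum_unfold_sum_mset ..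

text \<open>Padded with zeros, both exponent multisets become images of the union of the two
  supports, and equal images of one finite set differ by a permutation of that set.\<close>

lemma coeff_sf_mon_type_cong:
  assumes "mon_type m = mon_type m'"
  shows "coeff_sf F m = coeff_sf F m'"
proof -
  let ?A = "set_mset m \<union> set_mset m'"
  have ext: "image_mset (count u) (mset_set ?A) = mon_type u + replicate_mset (card ?A - card (set_mset u)) 0"
    if "set_mset u \<subseteq> ?A" for u
  proof -
    have "mset_set ?A = mset_set (set_mset u) + mset_set (?A - set_mset u)"
      using that by (metis Diff_disjoint Diff_partition finite_Diff finite_UnI finite_set_mset mset_set_Union)
    moreover have "image_mset (count u) (mset_set (?A - set_mset u)) = image_mset (\<lambda>_. 0) (mset_set (?A - set_mset u))"
      by (rule image_mset_cong) (auto simp: not_in_iff)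
    ultimately show ?thesis
      using that by (simp add: mon_type_def image_mset_const_eq card_Diff_subset)
  qed
  have "card (set_mset m) = card (set_mset m')" using assms by (metis size_mon_type)
  then have "image_mset (count m) (mset_set ?A) = image_mset (count m') (mset_set ?A)"
    using ext[of m] ext[of m'] assms by simp
  then obtain \<pi> where \<pi>: "\<pi> permutes ?A" "\<forall>x\<in>?A. count m x = count m' (\<pi> x)"
    using image_mset_eq_implies_permutes[of ?A] by auto
  have c: "count m x = count m' (\<pi> x)" for x
  proof (cases "x \<in> ?A")
    case False
    then have "\<pi> x = x" using \<pi>(1) by (simp add: permutes_def)
    then show ?thesis using False by (simp add: not_in_iff)
  qed (use \<pi> in auto)
  have b: "bij \<pi>" using \<pi>(1) by (rule permutes_bij)
  have "image_mset \<pi> m = m'"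
  proof (rule multiset_eqI)
    fix y
    obtain x where x: "y = \<pi> x" using b by (meson bij_pointE)
    have "count (image_mset \<pi> m) (\<pi> x) = count m x"
      using b by (induction m) (auto simp: bij_is_inj inj_eq)
    then show "count (image_mset \<pi> m) y = count m' y" using x c by simp
  qed
  then show ?thesis using coeff_sf_image_mset[OF b, of F m] by simp
qed

lemma ex_mon_type:
  assumes "0 \<notin># K"
  obtains m where "mon_type m = K"
proof -
  \<comment> \<open>The bound on the indices keeps the variable \<open>size K\<close> free for the
    next part.\<close>
  have "\<exists>m. mon_type m = K \<and> (\<forall>i\<in>#m. i < size K)" using assms
  proof (induction K)
    case (add k K)
    then obtain m where m: "mon_type m = K" "\<forall>i\<in>#m. i < size K" by auto
    let ?i = "size K" let ?m = "m + replicate_mset k ?i"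
    have k: "k > 0" using add.prems by auto
    have ni: "?i \<notin># m" using m by auto
    have s: "set_mset ?m = insert ?i (set_mset m)" using k by auto
    have "mon_type ?m = add_mset k K"
      unfolding mon_type_def s using ni
      by (simp add: count_eq_zero_iff[THEN iffD2] m(1)[symmetric] mon_type_def)
         (intro image_mset_cong, auto)
    then show ?case using m(2) s by (intro exI[of _ ?m]) auto
  qed simp
  then show ?thesis using that by blast
qed

lemma mon_type_diff:
  assumes "i \<in># m" "i \<notin># m - replicate_mset (count m i) i"
  shows "mon_type m = add_mset (count m i) (mon_type (m - replicate_mset (count m i) i))"
proof -
  have s: "set_mset (m - replicate_mset (count m i) i) = set_mset m - {i}"
    by (auto simp: in_diff_count split: if_splits)
  have "mset_set (set_mset m) = add_mset i (mset_set (set_mset m - {i}))"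
    using assms by (simp add: mset_set.remove)
  then show ?thesis unfolding mon_type_def s
    by (simp, intro image_mset_cong) auto
qed

text \<open>In the expansion each factor puts its whole exponent on one variable. Hence at most
  \<open>size K\<close> variables occur, and exactly that many only if no two factors share a
  variable; then the exponents are the parts of \<open>K\<close>. This is triangularity by the
  number of parts, behind both independence and spanning.\<close>

lemma coeff_mprod_power_sf_nonzero:
  assumes "coeff_sf (mprod power_sf K :: 'k::comm_ring_1 symfun) m \<noteq> 0" "0 \<notin># K"
  shows "size m = sum_mset K \<and> card (set_mset m) \<le> size K
    \<and> (card (set_mset m) = size K \<longrightarrow> mon_type m = K)"
  using assms
proof (induction K arbitrary: m)
  case empty
  then show ?case by (auto simp: coeff_sf_simps split: if_splits)
next
  case (add k K)
  then have k: "k \<ge> 1" by auto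
  have "(\<Sum>i | i \<in># m \<and> k \<le> count m i. coeff_sf (mprod power_sf K) (m - replicate_mset k i)) \<noteq> (0 :: 'k)"
    using add.prems(1) by (simp add: coeff_power_sf_times[OF k])
  then obtain i where i: "i \<in># m" "k \<le> count m i"
    "coeff_sf (mprod power_sf K :: 'k symfun) (m - replicate_mset k i) \<noteq> 0"
    by (metis (mono_tags, lifting) mem_Collect_eq sum.neutral)
  let ?m = "m - replicate_mset k i"
  have IH: "size ?m = sum_mset K" "card (set_mset ?m) \<le> size K"
    "card (set_mset ?m) = size K \<Longrightarrow> mon_type ?m = K"
    using add.IH[OF i(3)] add.prems(2) by auto
  have m: "m = ?m + replicate_mset k i" using i(2) by (simp add: count_le_replicate_mset_subset_eq)
  have size: "size m = sum_mset (add_mset k K)" using IH(1) by (subst m) simp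
  have s: "set_mset m = insert i (set_mset ?m)"
    by (subst m) (use k in \<open>auto simp del: One_nat_def split: if_splits\<close>)
  show ?case
  proof (cases "i \<in># ?m")
    case True
    then have "card (set_mset m) \<le> size K" using IH s by (simp add: insert_absorb)
    then show ?thesis using size by simp
  next
    case False
    then have c: "count m i = k" using i(2) by (simp add: not_in_iff)
    have "card (set_mset m) = Suc (card (set_mset ?m))" using s False by simp
    moreover have "mon_type m = add_mset k (mon_type ?m)" using mon_type_diff[OF i(1)] False c by simp
    ultimately show ?thesis using IH size by auto
  qed
qed

text \<open>All coefficients of the product are natural numbers, so contributions cannot cancel and
  a single nonzero one suffices in characteristic 0.\<close>

lemma coeff_mprod_power_sf_type:
  assumes "mon_type m = K"
  shows "coeff_sf (mprod power_sf K :: 'k::field_char_0 symfun) m \<noteq> 0"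
proof -
  have nat: "\<exists>c. coeff_sf (mprod power_sf K :: 'k symfun) m = of_nat c" if "0 \<notin># K" for K m
    using that
  proof (induction K arbitrary: m)
    case empty
    show ?case by (cases "m = {#}") (auto simp: coeff_sf_simps intro: exI[of _ 1] exI[of _ 0])
  next
    case (add k K)
    then have k: "k \<ge> 1" by auto
    have "\<forall>m. \<exists>c. coeff_sf (mprod power_sf K :: 'k symfun) m = of_nat c"
      using add by auto
    then obtain c where "\<And>m. coeff_sf (mprod power_sf K :: 'k symfun) m = of_nat (c m)"
      by metis
    then have "coeff_sf (mprod power_sf (add_mset k K) :: 'k symfun) m
        = of_nat (\<Sum>i | i \<in># m \<and> k \<le> count m i. c (m - replicate_mset k i))"
      by (simp add: coeff_power_sf_times[OF k])
    then show ?case by blast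
  qed
  show ?thesis using assms
  proof (induction K arbitrary: m)
    case empty
    then have "size m = 0" by (metis sum_mon_type sum_mset.empty)
    then show ?case by (simp add: coeff_sf_simps)
  next
    case (add k K)
    then have p: "0 \<notin># add_mset k K" using mon_type_pos by metis
    then have k: "k \<ge> 1" by auto
    have "\<forall>m. \<exists>c. coeff_sf (mprod power_sf K :: 'k symfun) m = of_nat c"
      using nat[of K] p by auto
    then obtain c where c: "\<And>m. coeff_sf (mprod power_sf K :: 'k symfun) m = of_nat (c m)"
      by metis
    have "k \<in># mon_type m" using add.prems by simp
    then obtain i where i: "i \<in># m" "count m i = k" by (auto simp: mon_type_def)
    have "mon_type m = add_mset k (mon_type (m - replicate_mset k i))"
      using mon_type_diff[OF i(1)] i(2) by (simp add: not_in_iff)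
    then have "c (m - replicate_mset k i) \<noteq> 0"
      using add c[of "m - replicate_mset k i"] by (metis add_mset_add_mset_same_iff of_nat_0)
    moreover have "coeff_sf (mprod power_sf (add_mset k K) :: 'k symfun) m
        = of_nat (\<Sum>i | i \<in># m \<and> k \<le> count m i. c (m - replicate_mset k i))"
      by (simp add: coeff_power_sf_times[OF k] c)
    moreover have "c (m - replicate_mset k i)
        \<le> (\<Sum>i | i \<in># m \<and> k \<le> count m i. c (m - replicate_mset k i))"
      using i by (intro member_le_sum) auto
    ultimately show ?case by (metis le_0_eq of_nat_eq_0_iff)
  qed
qed

text \<open>Independence of a family rather than of a set: it includes injectivity and lets
  coefficients be indexed by multisets.\<close>

definition sf_indep :: "('i \<Rightarrow> 'k::field symfun) \<Rightarrow> 'i set \<Rightarrow> bool" where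
  "sf_indep x I \<longleftrightarrow> (\<forall>S c. finite S \<longrightarrow> S \<subseteq> I \<longrightarrow> (\<Sum>i\<in>S. const_sf (c i) * x i) = 0 \<longrightarrow> (\<forall>i\<in>S. c i = 0))"

lemma sf_indepD:
  "sf_indep x I \<Longrightarrow> finite S \<Longrightarrow> S \<subseteq> I \<Longrightarrow> (\<Sum>i\<in>S. const_sf (c i) * x i) = 0 \<Longrightarrow> i \<in> S \<Longrightarrow> c i = 0"
  unfolding sf_indep_def by blast

lemma sf_indep_inj:
  assumes "sf_indep x I"
  shows "inj_on x I"
proof (rule inj_onI, rule ccontr)
  fix i j assume *: "i \<in> I" "j \<in> I" "x i = x j" "i \<noteq> j"
  have "(\<Sum>l\<in>{i, j}. const_sf (if l = i then 1 else - 1) * x l) = 0"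
    using * by (simp add: const_sf_uminus)
  from sf_indepD[OF assms _ _ this, of i] * show False by simp
qed

lemma sf_indep_independent:
  assumes "sf_indep x I"
  shows "sf.independent (x ` I)"
  unfolding sf.independent_explicit_finite_subsets
proof (intro allI impI ballI)
  fix A u v assume A: "A \<subseteq> x ` I" "finite A" "(\<Sum>v\<in>A. scale_sf (u v) v) = 0" "v \<in> A"
  obtain S where S: "S \<subseteq> I" "A = x ` S" using A(1) by (meson subset_imageE)
  have inj: "inj_on x S" using sf_indep_inj[OF assms] S(1) inj_on_subset by blast
  have "finite S" using inj A(2) S(2) finite_imageD by blast
  moreover have "(\<Sum>i\<in>S. const_sf (u (x i)) * x i) = 0"
    using A(3) S(2) inj by (simp add: sum.reindex scale_sf_def)
  moreover obtain i where "i \<in> S" "v = x i" using A(4) S(2) by auto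
  ultimately show "u v = 0" using sf_indepD[OF assms, of S "\<lambda>i. u (x i)" i] S(1) by simp
qed

lemma sf_indepI:
  assumes "inj_on x I" "sf.independent (x ` I)"
  shows "sf_indep x I"
  unfolding sf_indep_def
proof (intro allI impI ballI)
  fix S c i assume S: "finite S" "S \<subseteq> I" "(\<Sum>i\<in>S. const_sf (c i) * x i) = 0" "i \<in> S"
  have inj: "inj_on x S" using assms(1) S(2) inj_on_subset by blast
  have "(\<Sum>v\<in>x ` S. scale_sf (c (the_inv_into S x v)) v) = 0"
    using S(3) inj by (simp add: sum.reindex scale_sf_def the_inv_into_f_f)
  moreover have "sf.independent (x ` S)" using assms(2) S(2) sf.independent_mono image_mono by metis
  ultimately have "c (the_inv_into S x (x i)) = 0"
    using S(1,4) by (intro sf.independentD[of "x ` S" "x ` S" "\<lambda>v. c (the_inv_into S x v)"]) auto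
  then show "c i = 0" using inj S(4) by (simp add: the_inv_into_f_f)
qed

abbreviation pos_msets :: "nat multiset set" where
  "pos_msets \<equiv> {K. 0 \<notin># K}"

lemma finite_pos_msets_le: "finite {K \<in> pos_msets. sum_mset K \<le> n}"
proof -
  have "{K \<in> pos_msets. sum_mset K \<le> n} \<subseteq> mset ` {xs. set xs \<subseteq> {..n} \<and> length xs \<le> n}"
  proof
    fix K assume K: "K \<in> {K \<in> pos_msets. sum_mset K \<le> n}"
    have "size K \<le> sum_mset K" if "0 \<notin># K" for K :: "nat multiset"
      using that by (induction K) auto
    then have "size K \<le> n" using K by fastforce
    moreover have "k \<le> n" if "k \<in># K" for k
      using K that by (metis (mono_tags, lifting) le_trans mem_Collect_eq sum_mset.remove le_add1)
    moreover obtain xs where "K = mset xs" by (metis ex_mset)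
    ultimately show "K \<in> mset ` {xs. set xs \<subseteq> {..n} \<and> length xs \<le> n}" by auto
  qed
  then show ?thesis using finite_lists_length_le[of "{..n}" n] finite_subset by blast
qed

lemma finite_pos_msets: "finite {K \<in> pos_msets. sum_mset K = n}"
  by (rule finite_subset[OF _ finite_pos_msets_le[of n]]) auto

lemma sf_indep_power_sf: "sf_indep (mprod power_sf :: _ \<Rightarrow> 'k::field_char_0 symfun) pos_msets"
  unfolding sf_indep_def
proof (intro allI impI, rule ccontr)
  fix S and c :: "nat multiset \<Rightarrow> 'k"
  assume S: "finite S" "S \<subseteq> pos_msets" "(\<Sum>K\<in>S. const_sf (c K) * mprod power_sf K) = 0"
    and "\<not> (\<forall>K\<in>S. c K = 0)"
  then have ne: "{K \<in> S. c K \<noteq> 0} \<noteq> {}" by auto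
  \<comment> \<open>\<open>L\<close> gets the most parts among the indices with nonzero coefficient;
    at a monomial of type \<open>L\<close> all other terms then vanish.\<close>
  have "Max (size ` {K \<in> S. c K \<noteq> 0}) \<in> size ` {K \<in> S. c K \<noteq> 0}" using S(1) ne by (intro Max_in) auto
  then obtain L where L: "L \<in> S" "c L \<noteq> 0" "size L = Max (size ` {K \<in> S. c K \<noteq> 0})" by auto
  have max: "size K \<le> size L" if "K \<in> S" "c K \<noteq> 0" for K
    unfolding L(3) using S(1) that by (intro Max_ge) auto
  obtain m where m: "mon_type m = L" using ex_mon_type[of L] L(1) S(2) by blast
  have "0 = coeff_sf (\<Sum>K\<in>S. const_sf (c K) * mprod power_sf K) m" using S(3) by (simp add: coeff_sf_simps)
  also have "\<dots> = (\<Sum>K\<in>S. c K * coeff_sf (mprod power_sf K) m)"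
    by (simp add: coeff_sf_sum coeff_sf_const_times)
  also have "\<dots> = (\<Sum>K\<in>{L}. c K * coeff_sf (mprod power_sf K) m)"
  proof (rule sum.mono_neutral_right)
    show "\<forall>K\<in>S - {L}. c K * coeff_sf (mprod power_sf K) m = 0"
    proof
      fix K assume K: "K \<in> S - {L}"
      show "c K * coeff_sf (mprod power_sf K) m = 0"
      proof (rule ccontr)
        assume nz: "c K * coeff_sf (mprod power_sf K) m \<noteq> 0"
        then have "size K \<le> size L" using max K by auto
        moreover have "card (set_mset m) = size L" using m size_mon_type by metis
        moreover have "card (set_mset m) \<le> size K \<and> (card (set_mset m) = size K \<longrightarrow> mon_type m = K)"
          using coeff_mprod_power_sf_nonzero[of K m] nz K S(2) by auto
        ultimately show False using m K by auto
      qed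
    qed
  qed (use S L in auto)
  also have "\<dots> \<noteq> 0" using L coeff_mprod_power_sf_type[OF m, where 'k = 'k] by simp
  finally show False by simp
qed

text \<open>Induction on a bound for the number of variables in a monomial: products with exactly
  \<open>l\<close> parts clear the coefficients at monomials with exactly \<open>l\<close> variables
  and create none with more. The set \<open>N\<close> of degrees serves homogeneous functions and
  functions of bounded degree alike.\<close>

lemma span_power_sf_aux:
  fixes F :: "'k::field_char_0 symfun"
  assumes "finite N" "\<And>m. coeff_sf F m \<noteq> 0 \<Longrightarrow> size m \<in> N \<and> card (set_mset m) < l"
  shows "F \<in> sf.span (mprod power_sf ` {K \<in> pos_msets. sum_mset K \<in> N})"
  using assms(2)
proof (induction l arbitrary: F)
  case 0
  then have "F = 0" by (intro symfun_eqI) (auto simp: coeff_sf_simps)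
  then show ?case by (simp add: sf.span_zero)
next
  case (Suc l)
  let ?P = "{K \<in> pos_msets. sum_mset K \<in> N}"
  define Q where "Q = {K \<in> ?P. size K = l}"
  have fin: "finite Q"
    by (rule finite_subset[OF _ finite_pos_msets_le[of "Max N"]]) (use assms(1) in \<open>auto simp: Q_def\<close>)
  define mm where "mm K = (SOME m. mon_type m = K)" for K
  have mm: "mon_type (mm K) = K" if "K \<in> pos_msets" for K
    unfolding mm_def by (rule someI_ex) (use ex_mon_type that in blast)
  \<comment> \<open>The coefficient is read off at one representative monomial; by symmetry it then
    fits all monomials of the same type.\<close>
  define c :: "nat multiset \<Rightarrow> 'k" where
    "c K = coeff_sf F (mm K) / coeff_sf (mprod power_sf K) (mm K)" for K
  define G where "G = (\<Sum>K\<in>Q. const_sf (c K) * mprod power_sf K)"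
  have G: "G \<in> sf.span (mprod power_sf ` ?P)" unfolding G_def scale_sf_def[symmetric]
    by (intro sf.span_sum sf.span_scale sf.span_base) (auto simp: Q_def)
  have cG: "coeff_sf G m = (\<Sum>K\<in>Q. c K * coeff_sf (mprod power_sf K) m)" for m
    by (simp add: G_def coeff_sf_sum coeff_sf_const_times)
  have Gm: "size m \<in> N \<and> card (set_mset m) \<le> l" if nz: "coeff_sf G m \<noteq> 0" for m
  proof -
    obtain K where "K \<in> Q" "coeff_sf (mprod power_sf K :: 'k symfun) m \<noteq> 0"
      using nz unfolding cG by (metis (no_types, lifting) mult_not_zero sum.neutral)
    then show ?thesis using coeff_mprod_power_sf_nonzero[of K m, where 'k = 'k] by (auto simp: Q_def)
  qed
  have top: "coeff_sf (F - G) m = 0" if m: "card (set_mset m) = l" for m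
  proof (cases "size m \<in> N")
    case False
    then have "coeff_sf F m = 0" "coeff_sf G m = 0" using Suc.prems[of m] Gm[of m] by blast+
    then show ?thesis by (simp add: coeff_sf_minus)
  next
    case True
    let ?K = "mon_type m"
    have K: "?K \<in> Q" using True m by (auto simp: Q_def mon_type_pos size_mon_type sum_mon_type)
    have "coeff_sf G m = (\<Sum>K\<in>{?K}. c K * coeff_sf (mprod power_sf K) m)"
      unfolding cG
    proof (rule sum.mono_neutral_right)
      show "\<forall>L\<in>Q - {?K}. c L * coeff_sf (mprod power_sf L) m = 0"
      proof
        fix L assume "L \<in> Q - {?K}"
        then show "c L * coeff_sf (mprod power_sf L) m = 0"
          using coeff_mprod_power_sf_nonzero[of L m, where 'k = 'k] m by (auto simp: Q_def)
      qed
    qed (use K fin in auto)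
    moreover have "mon_type (mm ?K) = mon_type m" using mm mon_type_pos by simp
    then have "coeff_sf H (mm ?K) = coeff_sf H m" for H :: "'k symfun"
      using coeff_sf_mon_type_cong by blast
    ultimately show ?thesis using coeff_mprod_power_sf_type[of m ?K, where 'k = 'k]
      by (simp add: coeff_sf_minus c_def)
  qed
  have "F - G \<in> sf.span (mprod power_sf ` ?P)"
  proof (rule Suc.IH)
    fix m assume nz: "coeff_sf (F - G) m \<noteq> 0"
    then have "coeff_sf F m \<noteq> 0 \<or> coeff_sf G m \<noteq> 0" by (auto simp: coeff_sf_minus)
    then have "size m \<in> N \<and> card (set_mset m) \<le> l" using Suc.prems[of m] Gm[of m] by auto
    then show "size m \<in> N \<and> card (set_mset m) < l" using top[of m] nz by (metis le_neq_implies_less)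
  qed
  then show ?case using sf.span_add[OF _ G] by fastforce
qed

lemma card_set_mset_le_size: "card (set_mset m) \<le> size m"
  by (metis size_mset_set mset_set_set_mset_msubset size_mset_mono)

lemma homogeneous_span_power_sf:
  fixes F :: "'k::field_char_0 symfun"
  assumes "homogeneous_sf n F"
  shows "F \<in> sf.span (mprod power_sf ` {K \<in> pos_msets. sum_mset K = n})"
proof -
  have "card (set_mset m) < Suc (size m)" for m :: "nat multiset"
    using card_set_mset_le_size[of m] by simp
  then show ?thesis
    using span_power_sf_aux[of "{n}" F "Suc n"] assms unfolding homogeneous_sf_def by force
qed

lemma span_power_sf: "F \<in> sf.span (mprod power_sf ` pos_msets)"
  for F :: "'k::field_char_0 symfun"
proof -
  obtain d where d: "\<And>m. coeff_sf F m \<noteq> 0 \<Longrightarrow> size m \<le> d" using coeff_sf_bounded by blast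
  have "size m \<in> {..d} \<and> card (set_mset m) < Suc d" if "coeff_sf F m \<noteq> 0" for m
    using d[OF that] card_set_mset_le_size[of m] by simp
  then have "F \<in> sf.span (mprod power_sf ` {K \<in> pos_msets. sum_mset K \<in> {..d}})"
    by (intro span_power_sf_aux) auto
  then show ?thesis using sf.span_mono by (metis (no_types, lifting) image_mono mem_Collect_eq subsetI subsetD)
qed

lemma symfun_induct [case_names const power add mult]:
  fixes F :: "'k::field_char_0 symfun"
  assumes const: "\<And>c. P (const_sf c)"
    and power: "\<And>k. k \<ge> 1 \<Longrightarrow> P (power_sf k)"
    and add: "\<And>F G. P F \<Longrightarrow> P G \<Longrightarrow> P (F + G)"
    and mult: "\<And>F G. P F \<Longrightarrow> P G \<Longrightarrow> P (F * G)"
  shows "P F"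
  using span_power_sf[of F]
proof (induction rule: sf.span_induct_alt)
  case base
  then show ?case using const[of 0] by simp
next
  case (step c x y)
  have "P (mprod power_sf K)" if "0 \<notin># K" for K
    using that
  proof (induction K)
    case empty
    show ?case using const[of 1] by simp
  next
    case (add k K)
    then have "k \<ge> 1" "0 \<notin># K" by auto
    then show ?case using mult[OF power[of k] add.IH] by simp
  qed
  then show ?case using step by (auto simp: scale_sf_def intro: add mult const)
qed

subsection \<open>Homomorphisms out of symmetric functions\<close>

text \<open>The target is any commutative ring with a coefficient map \<open>\<iota>\<close>, so one
  universal property yields endomorphisms, evaluations in the field and substitutions with values in
  Laurent series.\<close>

definition sf_hom :: "('k::comm_ring_1 \<Rightarrow> 'a::comm_ring_1) \<Rightarrow> ('k symfun \<Rightarrow> 'a) \<Rightarrow> bool" where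
  "sf_hom \<iota> \<phi> \<longleftrightarrow> comm_ring_hom \<phi> \<and> (\<forall>c. \<phi> (const_sf c) = \<iota> c)"

lemma sf_homD:
  assumes "sf_hom \<iota> \<phi>"
  shows "comm_ring_hom \<phi>" "\<phi> (const_sf c) = \<iota> c"
  using assms by (auto simp: sf_hom_def)

lemma sf_hom_unique:
  fixes \<phi> \<psi> :: "'k::field_char_0 symfun \<Rightarrow> 'a::comm_ring_1"
  assumes "sf_hom \<iota> \<phi>" "sf_hom \<iota> \<psi>" "\<And>k. k \<ge> 1 \<Longrightarrow> \<phi> (power_sf k) = \<psi> (power_sf k)"
  shows "\<phi> = \<psi>"
proof
  interpret \<phi>: comm_ring_hom \<phi> using assms(1) by (rule sf_homD)
  interpret \<psi>: comm_ring_hom \<psi> using assms(2) by (rule sf_homD)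
  fix F
  show "\<phi> F = \<psi> F"
    by (induction F rule: symfun_induct)
      (use assms in \<open>simp_all add: sf_homD \<phi>.hom_add \<phi>.hom_mult \<psi>.hom_add \<psi>.hom_mult\<close>)
qed

text \<open>Products of power sums form a linear basis that is closed under multiplication, so the
  linear map prescribed on them is multiplicative once it is so on pairs of basis elements.\<close>

lemma ex_sf_hom:
  fixes \<iota> :: "'k::field_char_0 \<Rightarrow> 'a::comm_ring_1"
  assumes "comm_ring_hom \<iota>"
  shows "\<exists>\<phi>. sf_hom \<iota> \<phi> \<and> (\<forall>k\<ge>1. \<phi> (power_sf k) = a k)"
proof -
  interpret \<iota>: comm_ring_hom \<iota> by fact
  \<comment> \<open>Through \<open>\<iota>\<close> the target ring becomes a vector space over the
    coefficient field, which makes linear extension available.\<close>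
  interpret vector_space_pair scale_sf "\<lambda>c x. \<iota> c * x"
    by unfold_locales (simp_all add: \<iota>.hom_add \<iota>.hom_mult distrib_left distrib_right mult.assoc)
  let ?B = "mprod power_sf ` pos_msets :: 'k symfun set"
  have inj: "inj_on (mprod power_sf :: _ \<Rightarrow> 'k symfun) pos_msets"
    by (rule sf_indep_inj[OF sf_indep_power_sf])
  from linear_independent_extend[OF sf_indep_independent[OF sf_indep_power_sf],
      where f = "\<lambda>x. mprod a (the_inv_into pos_msets (mprod power_sf) x)"]
  obtain g where g: "Vector_Spaces.linear scale_sf (\<lambda>c x. \<iota> c * x) g"
    "\<forall>x\<in>?B. g x = mprod a (the_inv_into pos_msets (mprod power_sf) x)"
    by blast
  have gp: "g (mprod power_sf K) = mprod a K" if "0 \<notin># K" for K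
    using g(2) the_inv_into_f_f[OF inj, of K] that by simp
  interpret g: Vector_Spaces.linear scale_sf "\<lambda>c x. \<iota> c * x" g by (rule g(1))
  have g_const: "g (const_sf c * F) = \<iota> c * g F" for c F
    using g.scale[of c F] by (simp add: scale_sf_def)
  have m1: "g (mprod power_sf K * G) = g (mprod power_sf K) * g G" if K: "0 \<notin># K" for K G
    using span_power_sf[of G]
  proof (induction rule: sf.span_induct_alt)
    case base
    show ?case by simp
  next
    case (step c x y)
    then obtain L where L: "x = mprod power_sf L" "0 \<notin># L" by auto
    have "g (mprod power_sf K * x) = g (mprod power_sf K) * g x"
      using gp[of "K + L"] gp[OF K] gp[OF L(2)] K L by simp
    then show ?case using step(2)
      by (simp add: scale_sf_def distrib_left g.add mult.left_commute[of _ "const_sf c"]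
          mult.left_commute[of _ "\<iota> c"] g_const)
  qed
  have m2: "g (F * G) = g F * g G" for F G
    using span_power_sf[of F]
  proof (induction rule: sf.span_induct_alt)
    case base
    show ?case by simp
  next
    case (step c x y)
    then obtain L where "x = mprod power_sf L" "0 \<notin># L" by auto
    then have "g (x * G) = g x * g G" by (simp add: m1)
    then show ?case using step(2)
      by (simp add: scale_sf_def distrib_right g.add mult.assoc g_const)
  qed
  have "g 1 = 1" using gp[of "{#}"] by simp
  then have "comm_ring_hom g"
    by unfold_locales (simp_all add: m2 g.add)
  moreover have "g (const_sf c) = \<iota> c" for c using g_const[of c 1] \<open>g 1 = 1\<close> by simp
  moreover have "g (power_sf k) = a k" if "k \<ge> 1" for k using gp[of "{#k#}"] that by simp
  ultimately show ?thesis unfolding sf_hom_def by blast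
qed

definition sf_lift :: "('k::field_char_0 \<Rightarrow> 'a::comm_ring_1) \<Rightarrow> (nat \<Rightarrow> 'a) \<Rightarrow> 'k symfun \<Rightarrow> 'a" where
  "sf_lift \<iota> a = (SOME \<phi>. sf_hom \<iota> \<phi> \<and> (\<forall>k\<ge>1. \<phi> (power_sf k) = a k))"

lemma sf_lift:
  fixes \<iota> :: "'k::field_char_0 \<Rightarrow> 'a::comm_ring_1"
  assumes "comm_ring_hom \<iota>"
  shows "sf_hom \<iota> (sf_lift \<iota> a)" "k \<ge> 1 \<Longrightarrow> sf_lift \<iota> a (power_sf k) = a k"
  using someI_ex[OF ex_sf_hom[OF assms, where a = a]] unfolding sf_lift_def[symmetric] by auto

lemma sf_lift_eqI:
  fixes \<iota> :: "'k::field_char_0 \<Rightarrow> 'a::comm_ring_1"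
  assumes "sf_hom \<iota> \<phi>" "\<And>k. k \<ge> 1 \<Longrightarrow> \<phi> (power_sf k) = a k" "comm_ring_hom \<iota>"
  shows "\<phi> = sf_lift \<iota> a"
  using assms sf_lift[OF assms(3), where a = a] by (intro sf_hom_unique[of \<iota>]) auto

lemma comm_ring_hom_const_sf: "comm_ring_hom const_sf"
  by unfold_locales (simp_all add: const_sf_add const_sf_mult)

lemma algebra_hom_sf_iff: "algebra_hom_sf \<phi> \<longleftrightarrow> sf_hom const_sf \<phi>"
proof
  assume \<phi>: "algebra_hom_sf \<phi>"
  then interpret l: Vector_Spaces.linear scale_sf scale_sf \<phi> by (simp add: algebra_hom_sf_def linear_sf_def)
  have "\<phi> (const_sf c) = const_sf c" for c
    using l.scale[of c 1] \<phi> by (simp add: algebra_hom_sf_def scale_sf_def)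
  moreover have "comm_ring_hom \<phi>"
    using \<phi> by unfold_locales (simp_all add: algebra_hom_sf_def l.add)
  ultimately show "sf_hom const_sf \<phi>" by (simp add: sf_hom_def)
next
  assume "sf_hom const_sf \<phi>"
  then interpret comm_ring_hom \<phi> by (rule sf_homD)
  have "Vector_Spaces.linear scale_sf scale_sf \<phi>"
    using \<open>sf_hom const_sf \<phi>\<close> by unfold_locales (simp_all add: hom_add scale_sf_def hom_mult sf_homD)
  then show "algebra_hom_sf \<phi>" by (simp add: algebra_hom_sf_def linear_sf_def hom_mult)
qed

subsection \<open>Specialization of rational functions\<close>

lemma comm_ring_hom_poly_map_poly:
  assumes "comm_ring_hom f"
  shows "comm_ring_hom (\<lambda>P. poly (map_poly f P) y)"
proof -
  interpret comm_ring_hom f by fact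
  let ?g = "\<lambda>P. poly (map_poly f P) y"
  have pC: "?g (pCons a p) = f a + y * ?g p" for a p
    by (simp add: map_poly_pCons)
  have add: "?g (P + Q) = ?g P + ?g Q" for P Q
    by (induction P Q rule: poly_induct2) (simp_all only: add_pCons pC hom_add, simp_all add: algebra_simps)
  have smult: "?g (Polynomial.smult a Q) = f a * ?g Q" for a Q
    by (induction Q) (simp_all only: smult_pCons pC hom_mult smult_0_right, simp_all add: algebra_simps)
  have mult: "?g (P * Q) = ?g P * ?g Q" for P Q
    by (induction P) (simp_all add: mult_pCons_left add smult pC algebra_simps)
  show ?thesis by unfold_locales (simp_all add: add mult)
qed

lemma comm_ring_hom_eval_qt: "comm_ring_hom (eval_qt x y)"
  unfolding eval_qt_def[abs_def]
  by (intro comm_ring_hom_poly_map_poly) (unfold_locales, simp_all add: of_rat_add of_rat_mult)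

interpretation eval_qt: comm_ring_hom "eval_qt x y"
  by (rule comm_ring_hom_eval_qt)

lemma ratfun_eval_Fract:
  assumes "eval_qt x y b \<noteq> 0"
  shows "ratfun_defined_at x y (Fract a b)" "ratfun_eval x y (Fract a b) = eval_qt x y a / eval_qt x y b"
proof -
  show d: "ratfun_defined_at x y (Fract a b)" using assms by (auto simp: ratfun_defined_at_def)
  have "(THE v. \<exists>c d. Fract a b = Fract c d \<and> eval_qt x y d \<noteq> 0 \<and> v = eval_qt x y c / eval_qt x y d)
      = eval_qt x y a / eval_qt x y b"
  proof (rule the_equality)
    fix v assume "\<exists>c d. Fract a b = Fract c d \<and> eval_qt x y d \<noteq> 0 \<and> v = eval_qt x y c / eval_qt x y d"
    then obtain c d where cd: "Fract a b = Fract c d" "eval_qt x y d \<noteq> 0" "v = eval_qt x y c / eval_qt x y d"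
      by blast
    have "b \<noteq> 0" "d \<noteq> 0" using assms cd(2) by auto
    then have "a * d = c * b" using cd(1) by (simp add: eq_fract)
    then have "eval_qt x y a * eval_qt x y d = eval_qt x y c * eval_qt x y b"
      by (metis eval_qt.hom_mult)
    then show "v = eval_qt x y a / eval_qt x y b" using assms cd by (simp add: frac_eq_eq)
  qed (use assms in blast)
  then show "ratfun_eval x y (Fract a b) = eval_qt x y a / eval_qt x y b"
    using d by (simp add: ratfun_eval_def)
qed

lemma ratfun_defined_atE:
  assumes "ratfun_defined_at x y f"
  obtains a b where "f = Fract a b" "eval_qt x y b \<noteq> 0" "b \<noteq> 0"
    "ratfun_eval x y f = eval_qt x y a / eval_qt x y b"
  using assms ratfun_eval_Fract(2) unfolding ratfun_defined_at_def by (metis eval_qt.hom_zero)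

text \<open>Definedness and value in one relation: it is closed under the field operations by
  introduction rules, so specializations are computed along the structure of a term.\<close>

definition rval :: "'a::field_char_0 \<Rightarrow> 'a \<Rightarrow> ratfun \<Rightarrow> 'a \<Rightarrow> bool" where
  "rval x y f v \<longleftrightarrow> ratfun_defined_at x y f \<and> ratfun_eval x y f = v"

lemma rvalD: "rval x y f v \<Longrightarrow> ratfun_defined_at x y f" "rval x y f v \<Longrightarrow> ratfun_eval x y f = v"
  by (simp_all add: rval_def)

lemma rval_self: "ratfun_defined_at x y f \<Longrightarrow> rval x y f (ratfun_eval x y f)"
  by (simp add: rval_def)

lemma rval_Fract: "eval_qt x y b \<noteq> 0 \<Longrightarrow> rval x y (Fract a b) (eval_qt x y a / eval_qt x y b)"
  by (simp add: rval_def ratfun_eval_Fract)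

lemma rvalE:
  assumes "rval x y f v"
  obtains a b where "f = Fract a b" "eval_qt x y b \<noteq> 0" "b \<noteq> 0" "v = eval_qt x y a / eval_qt x y b"
  using assms unfolding rval_def by (metis ratfun_defined_atE)

lemma rval_add:
  assumes "rval x y f v" "rval x y g w"
  shows "rval x y (f + g) (v + w)"
proof -
  from assms(1) obtain a b where 1: "f = Fract a b" "eval_qt x y b \<noteq> 0" "b \<noteq> 0"
    "v = eval_qt x y a / eval_qt x y b" by (rule rvalE)
  from assms(2) obtain c d where 2: "g = Fract c d" "eval_qt x y d \<noteq> 0" "d \<noteq> 0"
    "w = eval_qt x y c / eval_qt x y d" by (rule rvalE)
  have "f + g = Fract (a * d + c * b) (b * d)" using 1 2 by simp
  then show ?thesis using rval_Fract[of x y "b * d" "a * d + c * b"] 1(2) 2(2)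
    unfolding 1(4) 2(4) by (simp add: eval_qt.hom_mult eval_qt.hom_add add_frac_eq)
qed

lemma rval_mult:
  assumes "rval x y f v" "rval x y g w"
  shows "rval x y (f * g) (v * w)"
proof -
  from assms(1) obtain a b where 1: "f = Fract a b" "eval_qt x y b \<noteq> 0" "b \<noteq> 0"
    "v = eval_qt x y a / eval_qt x y b" by (rule rvalE)
  from assms(2) obtain c d where 2: "g = Fract c d" "eval_qt x y d \<noteq> 0" "d \<noteq> 0"
    "w = eval_qt x y c / eval_qt x y d" by (rule rvalE)
  have "f * g = Fract (a * c) (b * d)" using 1 2 by simp
  then show ?thesis using rval_Fract[of x y "b * d" "a * c"] 1 2
    by (simp add: eval_qt.hom_mult)
qed

lemma rval_inverse:
  assumes "rval x y f v" "v \<noteq> 0"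
  shows "rval x y (inverse f) (inverse v)"
proof -
  from assms(1) obtain a b where 1: "f = Fract a b" "eval_qt x y b \<noteq> 0" "b \<noteq> 0"
    "v = eval_qt x y a / eval_qt x y b" by (rule rvalE)
  have "eval_qt x y a \<noteq> 0" using assms(2) 1 by auto
  then show ?thesis using rval_Fract[of x y a b] 1 by simp
qed

lemma rval_to_fract: "rval x y (to_fract P) (eval_qt x y P)"
  using rval_Fract[of x y 1 P] by (simp add: to_fract_def)

lemma rval_q_var: "rval x y q_var x"
  using rval_to_fract[of x y "[: [:0, 1:] :]"] by (simp add: q_var_def eval_qt_def map_poly_pCons)

lemma rval_t_var: "rval x y t_var y"
  using rval_to_fract[of x y "[:0, 1:]"] by (simp add: t_var_def eval_qt_def map_poly_pCons)

lemma rval_0: "rval x y 0 0"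
  and rval_1: "rval x y 1 1"
  using rval_to_fract[of x y 0] rval_to_fract[of x y 1] by simp_all

lemma rval_uminus:
  assumes "rval x y f v"
  shows "rval x y (- f) (- v)"
proof -
  have "rval x y (- 1) (- 1)" using rval_to_fract[of x y "- 1"] by (simp add: eval_qt.hom_uminus)
  from rval_mult[OF this assms] show ?thesis by simp
qed

lemma rval_diff: "rval x y f v \<Longrightarrow> rval x y g w \<Longrightarrow> rval x y (f - g) (v - w)"
  using rval_add[OF _ rval_uminus, of x y f v g w] by simp

lemma rval_power: "rval x y f v \<Longrightarrow> rval x y (f ^ n) (v ^ n)"
  by (induction n) (auto intro: rval_1 rval_mult)

lemma rval_sum: "(\<And>i. i \<in> I \<Longrightarrow> rval x y (f i) (v i)) \<Longrightarrow> rval x y (\<Sum>i\<in>I. f i) (\<Sum>i\<in>I. v i)"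
  by (induction I rule: infinite_finite_induct) (auto intro: rval_0 rval_add)

lemma rval_of_nat: "rval x y (of_nat n) (of_nat n)"
  by (induction n) (auto intro: rval_0 rval_1 rval_add)

lemma rval_unique: "rval x y f v \<Longrightarrow> rval x y f w \<Longrightarrow> v = w"
  by (simp add: rval_def)

subsection \<open>Newton's identities\<close>

text \<open>\<open>newton P F\<close> says that \<open>F = exp (\<Sum>\<^sub>k P\<^sub>k z\<^sup>k / k)\<close>, without division.\<close>

definition newton :: "(nat \<Rightarrow> 'a::comm_ring_1) \<Rightarrow> 'a fps \<Rightarrow> bool" where
  "newton P F \<longleftrightarrow> fps_nth F 0 = 1 \<and> (\<forall>n. of_nat n * fps_nth F n = (\<Sum>k=1..n. P k * fps_nth F (n - k)))"

lemma newton_0: "newton P F \<Longrightarrow> fps_nth F 0 = 1"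
  by (simp add: newton_def)

lemma newton_rec: "newton P F \<Longrightarrow> of_nat n * fps_nth F n = (\<Sum>k=1..n. P k * fps_nth F (n - k))"
  by (simp add: newton_def)

lemma newton_cong:
  assumes "newton P F" "\<And>k. k \<ge> 1 \<Longrightarrow> P k = Q k"
  shows "newton Q F"
proof -
  have "(\<Sum>k=1..n. P k * fps_nth F (n - k)) = (\<Sum>k=1..n. Q k * fps_nth F (n - k))" for n
    by (intro sum.cong) (simp_all add: assms(2))
  then show ?thesis using assms(1) by (simp add: newton_def)
qed

text \<open>At index n the recursion determines n times the coefficient. Absence of additive torsion
  is assumed in place of a field because the series below have coefficients in symmetric functions
  and in Laurent series over them.\<close>

lemma newton_unique:
  fixes F G :: "'a::comm_ring_1 fps"
  assumes tf: "\<And>n (x :: 'a). of_nat n * x = 0 \<Longrightarrow> n \<noteq> 0 \<Longrightarrow> x = 0"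
    and F: "newton P F" and G: "newton P G"
  shows "F = G"
proof (rule fps_ext)
  fix n show "fps_nth F n = fps_nth G n"
  proof (induction n rule: less_induct)
    case (less n)
    show ?case
    proof (cases "n = 0")
      case True
      then show ?thesis using F G by (simp add: newton_0)
    next
      case False
      have "of_nat n * fps_nth F n = of_nat n * fps_nth G n"
        unfolding newton_rec[OF F] newton_rec[OF G] by (intro sum.cong) (auto simp: less)
      then show ?thesis using tf[of n "fps_nth F n - fps_nth G n"] False by (simp add: right_diff_distrib)
    qed
  qed
qed

text \<open>The constant term of \<open>F\<close> is 1, so the recursion at n isolates
  \<open>P n\<close>.\<close>

lemma newton_unique_left:
  assumes F: "newton P F" "newton Q F" and "k \<ge> 1"
  shows "P k = Q k"
  using assms(3)
proof (induction k rule: less_induct)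
  case (less n)
  have split: "{1..n} = insert n {1..<n}" using less.prems by auto
  have "(\<Sum>k=1..n. P k * fps_nth F (n - k)) = (\<Sum>k=1..n. Q k * fps_nth F (n - k))"
    using F by (metis newton_rec)
  moreover have "(\<Sum>k\<in>{1..<n}. P k * fps_nth F (n - k)) = (\<Sum>k\<in>{1..<n}. Q k * fps_nth F (n - k))"
    by (intro sum.cong) (auto simp: less.IH)
  ultimately show ?case unfolding split using newton_0[OF F(1)] by simp
qed

text \<open>The logarithmic derivative; in this form a product of series visibly adds the power
  sums.\<close>

lemma newton_iff_deriv:
  "newton P F \<longleftrightarrow> fps_nth F 0 = 1 \<and> fps_X * fps_deriv F = Abs_fps (\<lambda>k. if k = 0 then 0 else P k) * F"
proof -
  have 1: "fps_nth (fps_X * fps_deriv F) n = of_nat n * fps_nth F n" for n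
    by (cases n) auto
  have 2: "fps_nth (Abs_fps (\<lambda>k. if k = 0 then 0 else P k) * F) n = (\<Sum>k=1..n. P k * fps_nth F (n - k))" for n
    unfolding fps_mult_nth by (intro sum.mono_neutral_cong_right) auto
  show ?thesis unfolding newton_def fps_eq_iff 1 2 by simp
qed

lemma newton_mult:
  assumes "newton P F" "newton Q G"
  shows "newton (\<lambda>k. P k + Q k) (F * G)"
proof -
  have "Abs_fps (\<lambda>k. if k = 0 then 0 else P k + Q k)
      = Abs_fps (\<lambda>k. if k = 0 then 0 else P k) + Abs_fps (\<lambda>k. if k = 0 then 0 else Q k)"
    by (simp add: fps_eq_iff)
  moreover have "fps_X * fps_deriv (F * G) = F * (fps_X * fps_deriv G) + (fps_X * fps_deriv F) * G"
    by (simp add: algebra_simps)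
  ultimately show ?thesis using assms unfolding newton_iff_deriv
    by (simp add: algebra_simps)
qed

lemma newton_1: "newton (\<lambda>_. 0) 1"
  by (simp add: newton_def)

lemma newton_scale:
  assumes "newton P F"
  shows "newton (\<lambda>k. c ^ k * P k) (Abs_fps (\<lambda>n. c ^ n * fps_nth F n))"
proof -
  have "of_nat n * (c ^ n * fps_nth F n) = (\<Sum>k=1..n. c ^ k * P k * (c ^ (n - k) * fps_nth F (n - k)))" for n
  proof -
    have "of_nat n * (c ^ n * fps_nth F n) = (\<Sum>k=1..n. c ^ n * (P k * fps_nth F (n - k)))"
      by (simp add: mult.left_commute[of "of_nat n"] newton_rec[OF assms] sum_distrib_left)
    also have "\<dots> = (\<Sum>k=1..n. c ^ k * P k * (c ^ (n - k) * fps_nth F (n - k)))"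
      by (intro sum.cong refl) (simp add: mult_ac flip: power_add mult.assoc[of "c ^ _" "c ^ _"])
    finally show ?thesis .
  qed
  then show ?thesis using newton_0[OF assms] by (simp add: newton_def)
qed

lemma newton_hom:
  assumes "comm_ring_hom \<phi>" "newton P F"
  shows "newton (\<lambda>k. \<phi> (P k)) (Abs_fps (\<lambda>n. \<phi> (fps_nth F n)))"
proof -
  interpret comm_ring_hom \<phi> by fact
  have "\<phi> (of_nat n) = of_nat n" for n by (induction n) (simp_all add: hom_add)
  then have "of_nat n * \<phi> (fps_nth F n) = (\<Sum>k=1..n. \<phi> (P k) * \<phi> (fps_nth F (n - k)))" for n
    using arg_cong[OF newton_rec[OF assms(2), of n], of \<phi>] by (simp add: hom_mult hom_sum)
  then show ?thesis using newton_0[OF assms(2)] by (simp add: newton_def)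
qed

lemma newton_linear: "newton (\<lambda>k. (- 1) ^ (k - 1) * x ^ k) (1 + fps_const x * fps_X)"
proof -
  have "of_nat n * fps_nth (1 + fps_const x * fps_X) n
      = (\<Sum>k=1..n. (- 1) ^ (k - 1) * x ^ k * fps_nth (1 + fps_const x * fps_X) (n - k))" for n
  proof (cases "n \<le> 1")
    case True
    then have "n = 0 \<or> n = 1" by auto
    then show ?thesis by auto
  next
    case False
    then obtain m where n: "n = Suc (Suc m)" by (metis One_nat_def not_less_eq_eq old.nat.exhaust zero_le)
    \<comment> \<open>Only the indices n - 1 and n meet the support of the linear polynomial, and
      their terms cancel.\<close>
    have "(\<Sum>k=1..n. (- 1) ^ (k - 1) * x ^ k * fps_nth (1 + fps_const x * fps_X) (n - k))
        = (\<Sum>k\<in>{Suc m, n}. (- 1) ^ (k - 1) * x ^ k * fps_nth (1 + fps_const x * fps_X) (n - k))"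
      by (rule sum.mono_neutral_right) (auto simp: n)
    also have "\<dots> = 0" by (simp add: n)
    finally show ?thesis by (simp add: n)
  qed
  then show ?thesis by (simp add: newton_def)
qed

lemma newton_prod:
  assumes "finite C"
  shows "newton (\<lambda>k. (- 1) ^ (k - 1) * (\<Sum>c\<in>C. x c ^ k)) (\<Prod>c\<in>C. 1 + fps_const (x c) * fps_X)"
  using assms
proof (induction C)
  case (insert c C)
  then show ?case using newton_mult[OF newton_linear[of "x c"] insert.IH]
    by (simp add: distrib_left)
qed (simp add: newton_1)

section \<open>Newton's identities for complete and elementary functions\<close>

lemma count_repeated:
  assumes "finite A" shows "(\<Sum>k=1..n. card {i \<in> A. k \<le> f i}) = (\<Sum>i\<in>A. min n (f i))"
proof -
  have "(\<Sum>k=1..n. card {i \<in> A. k \<le> f i}) = (\<Sum>k=1..n. \<Sum>i\<in>A. if k \<le> f i then 1 else 0)"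
    using assms by (simp add: sum.If_cases Int_def)
  also have "\<dots> = (\<Sum>i\<in>A. \<Sum>k=1..n. if k \<le> f i then 1 else 0)" by (rule sum.swap)
  also have "\<dots> = (\<Sum>i\<in>A. min n (f i))"
  proof (rule sum.cong)
    fix i
    have "{k. Suc 0 \<le> k \<and> k \<le> n \<and> k \<le> f i} = {1..min n (f i)}" by auto
    then show "(\<Sum>k=1..n. if k \<le> f i then 1 else 0) = min n (f i)"
      by (simp add: sum.If_cases Int_def)
  qed simp
  finally show ?thesis .
qed

text \<open>At a monomial of degree n the k-th term counts the variables with exponent at least k;
  over all k these counts add up to the sum of the exponents, which is n.\<close>

lemma newton_complete_sf: "newton power_sf (Abs_fps complete_sf :: 'k::comm_ring_1 symfun fps)"
proof -
  have "of_nat n * complete_sf n = (\<Sum>k=1..n. power_sf k * complete_sf (n - k) :: 'k symfun)" for n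
  proof (rule symfun_eqI)
    fix m
    have k: "coeff_sf (power_sf k * complete_sf (n - k) :: 'k symfun) m
        = (if size m = n then of_nat (card {i \<in> set_mset m. k \<le> count m i}) else 0)" if "k \<in> {1..n}" for k
    proof -
      have "size (m - replicate_mset k i) = size m - k" if "k \<le> count m i" for i
        using that by (simp add: size_Diff_submset count_le_replicate_mset_subset_eq)
      moreover have "k \<le> size m" if "k \<le> count m i" for i
        using that by (meson count_le_size le_trans)
      ultimately have "(\<Sum>i | i \<in># m \<and> k \<le> count m i. coeff_sf (complete_sf (n - k) :: 'k symfun) (m - replicate_mset k i))
          = (\<Sum>i | i \<in># m \<and> k \<le> count m i. if size m = n then 1 else 0)"
        using \<open>k \<in> {1..n}\<close> by (intro sum.cong) (auto simp: coeff_sf_simps le_diff_conv2 eq_diff_iff)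
      then show ?thesis using that by (simp add: coeff_power_sf_times)
    qed
    have "coeff_sf (\<Sum>k=1..n. power_sf k * complete_sf (n - k) :: 'k symfun) m
        = (if size m = n then of_nat (\<Sum>k=1..n. card {i \<in> set_mset m. k \<le> count m i}) else 0)"
      unfolding coeff_sf_sum by (subst sum.cong[OF refl k]) auto
    also have "\<dots> = (if size m = n then of_nat n else 0)"
    proof -
      have "(\<Sum>i\<in>set_mset m. min (size m) (count m i)) = (\<Sum>i\<in>set_mset m. count m i)"
        by (intro sum.cong) (simp_all add: min_absorb2 count_le_size)
      also have "\<dots> = size m" by (rule size_multiset_overloaded_eq[symmetric])
      finally have "(\<Sum>i\<in>set_mset m. min (size m) (count m i)) = size m" .
      then show ?thesis by (auto simp: count_repeated[OF finite_set_mset] simp flip: of_nat_sum simp del: One_nat_def)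
    qed
    also have "\<dots> = coeff_sf (of_nat n * complete_sf n :: 'k symfun) m"
      by (simp add: coeff_sf_const_times const_sf_of_nat[symmetric] coeff_sf_simps)
    finally show "coeff_sf (of_nat n * complete_sf n) m = coeff_sf (\<Sum>k=1..n. power_sf k * complete_sf (n - k) :: 'k symfun) m" ..
  qed
  moreover have "complete_sf 0 = (1 :: 'k symfun)" by (rule symfun_eqI) (simp add: coeff_sf_simps)
  ultimately show ?thesis by (simp add: newton_def)
qed

text \<open>Fix the variable whose k-th power is split off, with exponent c. The rest is squarefree
  only for k = c or k = c - 1, and for c > 1 these two terms have opposite signs. What survives is
  one contribution from each variable of a squarefree monomial.\<close>

lemma newton_elem_sf:
  "newton (\<lambda>k. (- 1) ^ (k - 1) * power_sf k) (Abs_fps elem_sf :: 'k::comm_ring_1 symfun fps)"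
proof -
  have neg1: "(- 1) ^ j * F = const_sf ((- 1) ^ j) * F" for j and F :: "'k symfun"
    by (simp add: const_sf_power const_sf_uminus)
  have "of_nat n * elem_sf n = (\<Sum>k=1..n. (- 1) ^ (k - 1) * power_sf k * elem_sf (n - k) :: 'k symfun)" for n
  proof (rule symfun_eqI)
    fix m
    let ?sqf = "\<lambda>u :: nat multiset. \<forall>j. count u j \<le> 1"
    have k: "coeff_sf ((- 1) ^ (k - 1) * power_sf k * elem_sf (n - k) :: 'k symfun) m
        = (\<Sum>i\<in>set_mset m. if size m = n \<and> k \<le> count m i \<and> ?sqf (m - replicate_mset k i) then (- 1) ^ (k - 1) else 0)"
      if "k \<in> {1..n}" for k
    proof -
      have "coeff_sf ((- 1) ^ (k - 1) * power_sf k * elem_sf (n - k) :: 'k symfun) m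
          = (\<Sum>i | i \<in># m \<and> k \<le> count m i. (- 1) ^ (k - 1) * coeff_sf (elem_sf (n - k)) (m - replicate_mset k i))"
        using that by (simp only: mult.assoc neg1 coeff_sf_const_times coeff_power_sf_times sum_distrib_left atLeastAtMost_iff)
      also have "\<dots> = (\<Sum>i\<in>set_mset m. if size m = n \<and> k \<le> count m i \<and> ?sqf (m - replicate_mset k i) then (- 1) ^ (k - 1) else 0)"
      proof (rule sum.mono_neutral_cong_left)
        fix i assume "i \<in> {i. i \<in># m \<and> k \<le> count m i}"
        then have c: "k \<le> count m i" by simp
        then have "k \<le> size m" by (meson count_le_size le_trans)
        moreover have "size (m - replicate_mset k i) = size m - k"
          using c by (simp add: size_Diff_submset count_le_replicate_mset_subset_eq)
        ultimately have "size (m - replicate_mset k i) = n - k \<longleftrightarrow> size m = n"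
          using that by auto
        then show "(- 1) ^ (k - 1) * coeff_sf (elem_sf (n - k) :: 'k symfun) (m - replicate_mset k i)
            = (if size m = n \<and> k \<le> count m i \<and> ?sqf (m - replicate_mset k i) then (- 1) ^ (k - 1) else 0)"
          using c by (simp only: elem_sf.rep_eq) simp
      qed auto
      finally show ?thesis .
    qed
    have inner: "(\<Sum>k=1..n. if size m = n \<and> k \<le> count m i \<and> ?sqf (m - replicate_mset k i) then (- 1) ^ (k - 1) else (0 :: 'k))
        = (if size m = n \<and> ?sqf m then 1 else 0)" if i: "i \<in># m" for i
    proof (cases "size m = n \<and> (\<forall>j. j \<noteq> i \<longrightarrow> count m j \<le> 1)")
      case False
      then have "\<not> ?sqf (m - replicate_mset k i)" if "size m = n" for k
        using that by (metis count_diff count_replicate_mset diff_zero)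
      then show ?thesis using False by (auto intro!: sum.neutral)
    next
      case True
      define c where "c = count m i"
      have c: "1 \<le> c" "c \<le> n" using i True by (auto simp: c_def Suc_le_eq count_le_size)
      have sqf: "?sqf (m - replicate_mset k i) \<longleftrightarrow> c - k \<le> 1" for k
      proof
        assume "?sqf (m - replicate_mset k i)"
        then show "c - k \<le> 1" by (auto simp: c_def dest: spec[of _ i])
      next
        assume "c - k \<le> 1"
        then show "?sqf (m - replicate_mset k i)" using True by (auto simp: c_def)
      qed
      have "(\<Sum>k=1..n. if size m = n \<and> k \<le> count m i \<and> ?sqf (m - replicate_mset k i) then (- 1) ^ (k - 1) else (0 :: 'k))
          = (\<Sum>k\<in>{max 1 (c - 1)..c}. (- 1) ^ (k - 1))"
        unfolding sqf by (rule sum.mono_neutral_cong_right) (use c True in \<open>auto simp: c_def[symmetric]\<close>)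
      also have "\<dots> = (if c = 1 then 1 else 0)"
      proof (cases "c = 1")
        case False
        then obtain d where d: "c = Suc (Suc d)" using c by (metis One_nat_def not_less_eq_eq old.nat.exhaust zero_le)
        then have "{max 1 (c - 1)..c} = {Suc d, Suc (Suc d)}" by auto
        then show ?thesis using d by simp
      qed simp
      also have "\<dots> = (if size m = n \<and> ?sqf m then 1 else 0)"
        using True c unfolding c_def by (metis le_antisym order_refl)
      finally show ?thesis .
    qed
    have "coeff_sf (\<Sum>k=1..n. (- 1) ^ (k - 1) * power_sf k * elem_sf (n - k) :: 'k symfun) m
        = (\<Sum>k=1..n. \<Sum>i\<in>set_mset m. if size m = n \<and> k \<le> count m i \<and> ?sqf (m - replicate_mset k i) then (- 1) ^ (k - 1) else 0)"
      unfolding coeff_sf_sum by (intro sum.cong[OF refl k])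
    also have "\<dots> = (\<Sum>i\<in>set_mset m. if size m = n \<and> ?sqf m then 1 else 0)"
      by (subst sum.swap) (intro sum.cong refl inner)
    also have "\<dots> = (if size m = n \<and> ?sqf m then of_nat n else 0)"
    proof (cases "size m = n \<and> ?sqf m")
      case True
      have "size m = (\<Sum>i\<in>set_mset m. count m i)" by (rule size_multiset_overloaded_eq)
      also have "\<dots> = (\<Sum>i\<in>set_mset m. 1)"
        using True by (intro sum.cong) (auto simp: Suc_le_eq[symmetric] intro!: le_antisym)
      finally show ?thesis using True by simp
    next
      case False
      show ?thesis unfolding if_not_P[OF False] by simp
    qed
    also have "\<dots> = coeff_sf (of_nat n * elem_sf n :: 'k symfun) m"
      by (simp add: coeff_sf_const_times const_sf_of_nat[symmetric] coeff_sf_simps)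
    finally show "coeff_sf (of_nat n * elem_sf n) m
      = coeff_sf (\<Sum>k=1..n. (- 1) ^ (k - 1) * power_sf k * elem_sf (n - k) :: 'k symfun) m" ..
  qed
  moreover have "elem_sf 0 = (1 :: 'k symfun)" by (rule symfun_eqI) (auto simp: coeff_sf_simps)
  ultimately show ?thesis by (simp add: newton_def)
qed

section \<open>The involution omega and plethysm as homomorphisms\<close>

lemma newton_unique_symfun:
  "newton P F \<Longrightarrow> newton P G \<Longrightarrow> F = (G :: 'k::field_char_0 symfun fps)"
  by (rule newton_unique[of P]) (auto dest: of_nat_times_symfun_eq_0)

text \<open>Newton's identities for e and h differ only in the signs of the power sums, so the
  homomorphism with these signs maps e_k to h_k. Conversely a series determines its power sums,
  which gives the uniqueness behind \<open>omega_sf\<close>.\<close>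

lemma omega_sf_power_sf:
  assumes "n \<ge> 1"
  shows "omega_sf (power_sf n :: 'k::field_char_0 symfun) = (- 1) ^ (n - 1) * power_sf n"
proof -
  obtain \<phi> :: "'k symfun \<Rightarrow> 'k symfun" where
    \<phi>: "sf_hom const_sf \<phi>" "\<And>k. k \<ge> 1 \<Longrightarrow> \<phi> (power_sf k) = (- 1) ^ (k - 1) * power_sf k"
    using ex_sf_hom[OF comm_ring_hom_const_sf, where a = "\<lambda>k. (- 1) ^ (k - 1) * power_sf k"] by blast
  interpret \<phi>: comm_ring_hom \<phi> by (rule sf_homD(1)[OF \<phi>(1)])
  have sq: "(- 1) ^ j * ((- 1) ^ j * F) = (F :: 'k symfun)" for j F
    by (simp add: mult.assoc[symmetric] power_mult_distrib[symmetric])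
  have "newton (\<lambda>k. \<phi> ((- 1) ^ (k - 1) * power_sf k)) (Abs_fps (\<lambda>n. \<phi> (elem_sf n)))"
    using newton_hom[OF sf_homD(1)[OF \<phi>(1)] newton_elem_sf] by simp
  then have "newton power_sf (Abs_fps (\<lambda>n. \<phi> (elem_sf n)))"
    by (rule newton_cong) (simp add: \<phi>.hom_mult \<phi>.hom_power \<phi>.hom_uminus \<phi>(2) sq del: One_nat_def)
  then have "Abs_fps (\<lambda>n. \<phi> (elem_sf n)) = Abs_fps complete_sf"
    by (rule newton_unique_symfun[OF _ newton_complete_sf])
  then have e: "\<phi> (elem_sf k) = complete_sf k" for k by (simp add: fps_eq_iff)
  have "omega_sf = \<phi>"
    unfolding omega_sf_def
  proof (rule the_equality)
    show "algebra_hom_sf \<phi> \<and> (\<forall>k. \<phi> (elem_sf k) = complete_sf k)"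
      using \<phi>(1) e by (simp add: algebra_hom_sf_iff)
  next
    fix \<psi> :: "'k symfun \<Rightarrow> 'k symfun"
    assume \<psi>: "algebra_hom_sf \<psi> \<and> (\<forall>k. \<psi> (elem_sf k) = complete_sf k)"
    then have hom: "sf_hom const_sf \<psi>" by (simp add: algebra_hom_sf_iff)
    interpret \<psi>: comm_ring_hom \<psi> by (rule sf_homD(1)[OF hom])
    have "newton (\<lambda>k. \<psi> ((- 1) ^ (k - 1) * power_sf k)) (Abs_fps complete_sf)"
      using newton_hom[OF sf_homD(1)[OF hom] newton_elem_sf] \<psi> by simp
    then have "\<psi> ((- 1) ^ (k - 1) * power_sf k) = power_sf k" if "k \<ge> 1" for k
      using newton_unique_left[OF _ newton_complete_sf that] by blast
    then have "(- 1) ^ (k - 1) * \<psi> (power_sf k) = power_sf k" if "k \<ge> 1" for k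
      using that by (simp add: \<psi>.hom_mult \<psi>.hom_power \<psi>.hom_uminus del: One_nat_def)
    then have "\<psi> (power_sf k) = (- 1) ^ (k - 1) * power_sf k" if "k \<ge> 1" for k
      using that sq[of "k - 1" "\<psi> (power_sf k)"] by simp
    then show "\<psi> = \<phi>" using \<phi>(2) by (intro sf_hom_unique[OF hom \<phi>(1)]) simp
  qed
  then show ?thesis using \<phi>(2)[OF assms] by simp
qed

lemma plethysm_eq: "plethysm f A = sf_lift const_sf (\<lambda>k. raise_all k A) f"
proof -
  note \<phi> = sf_lift[OF comm_ring_hom_const_sf, where a = "\<lambda>k. raise_all k A"]
  have "(THE \<phi>. algebra_hom_sf \<phi> \<and> (\<forall>k\<ge>1. \<phi> (power_sf k) = raise_all k A)) = sf_lift const_sf (\<lambda>k. raise_all k A)"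
  proof (rule the_equality)
    fix \<psi> assume "algebra_hom_sf \<psi> \<and> (\<forall>k\<ge>1. \<psi> (power_sf k) = raise_all k A)"
    then show "\<psi> = sf_lift const_sf (\<lambda>k. raise_all k A)"
      by (intro sf_lift_eqI[OF _ _ comm_ring_hom_const_sf]) (simp_all add: algebra_hom_sf_iff)
  qed (use \<phi> in \<open>simp add: algebra_hom_sf_iff\<close>)
  then show ?thesis by (simp add: plethysm_def)
qed

lemma repeat_mset_inject: "k \<ge> 1 \<Longrightarrow> repeat_mset k m = repeat_mset k m' \<longleftrightarrow> m = m'"
  by (auto simp: multiset_eq_iff)

lemma raise_vars_eqI:
  assumes "k \<ge> 1" "\<And>m. coeff_sf G (repeat_mset k m) = coeff_sf F m"
    "\<And>m. m \<notin> range (repeat_mset k) \<Longrightarrow> coeff_sf G m = 0"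
  shows "raise_vars k F = G"
proof (rule symfun_eqI)
  fix m
  show "coeff_sf (raise_vars k F) m = coeff_sf G m"
  proof (cases "m \<in> range (repeat_mset k)")
    case True
    then obtain u where u: "m = repeat_mset k u" by auto
    then have "{m'. repeat_mset k m' = m} = {u}" using assms(1) by (auto simp: repeat_mset_inject)
    then show ?thesis using assms(2)[of u] u by (simp add: raise_vars.rep_eq)
  next
    case False
    then have "{m'. repeat_mset k m' = m} = {}" by auto
    then show ?thesis using assms(3)[OF False] by (simp add: raise_vars.rep_eq)
  qed
qed

lemma raise_all_const:
  assumes "k \<ge> 1"
  shows "raise_all k (const_sf c) = const_sf (ratfun_eval (q_var ^ k) (t_var ^ k) c)"
  unfolding raise_all_def
proof (rule raise_vars_eqI[OF assms])
  fix m :: "nat multiset"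
  have "repeat_mset k m = {#} \<longleftrightarrow> m = {#}" using assms repeat_mset_inject[of k m "{#}"] by simp
  then show "coeff_sf (const_sf (ratfun_eval (q_var ^ k) (t_var ^ k) c)) (repeat_mset k m)
    = coeff_sf (subst_sf (q_var ^ k) (t_var ^ k) (const_sf c)) m"
    by (simp add: subst_sf.rep_eq const_sf.rep_eq)
next
  fix m :: "nat multiset" assume m: "m \<notin> range (repeat_mset k)"
  have "m \<noteq> {#}" using m by (metis rangeI repeat_mset_empty)
  then show "coeff_sf (const_sf (ratfun_eval (q_var ^ k) (t_var ^ k) c)) m = 0"
    by (simp add: const_sf.rep_eq)
qed

lemma raise_all_X_const:
  assumes "k \<ge> 1"
  shows "raise_all k (X_sf * const_sf c) = power_sf k * const_sf (ratfun_eval (q_var ^ k) (t_var ^ k) c)"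
proof -
  have rep: "repeat_mset k (replicate_mset 1 i) = replicate_mset k i" for i :: nat
    by (simp add: multiset_eq_iff)
  have 1: "coeff_sf (X_sf * const_sf c) m = (if \<exists>i. m = replicate_mset 1 i then c else 0)" for m
    by (subst mult.commute, unfold coeff_sf_const_times) (simp add: power_sf.rep_eq)
  have 2: "coeff_sf (power_sf k * const_sf d :: ratfun symfun) m = (if \<exists>i. m = replicate_mset k i then d else 0)" for m d
    by (subst mult.commute, unfold coeff_sf_const_times) (simp add: power_sf.rep_eq)
  show ?thesis unfolding raise_all_def
  proof (rule raise_vars_eqI[OF assms])
    fix m :: "nat multiset"
    have "(\<exists>i. repeat_mset k m = replicate_mset k i) \<longleftrightarrow> (\<exists>i. m = replicate_mset 1 i)"
      using rep repeat_mset_inject[OF assms] by metis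
    then show "coeff_sf (power_sf k * const_sf (ratfun_eval (q_var ^ k) (t_var ^ k) c)) (repeat_mset k m)
      = coeff_sf (subst_sf (q_var ^ k) (t_var ^ k) (X_sf * const_sf c)) m"
      unfolding subst_sf.rep_eq 1 2 by simp
  next
    fix m :: "nat multiset" assume "m \<notin> range (repeat_mset k)"
    then have "\<not> (\<exists>i. m = replicate_mset k i)" using rep by (metis rangeI)
    then show "coeff_sf (power_sf k * const_sf (ratfun_eval (q_var ^ k) (t_var ^ k) c)) m = 0"
      unfolding 2 by simp
  qed
qed

section \<open>Passing from power sums to other multiplicative bases\<close>

lemma span_mult_closed:
  assumes AB: "\<And>a b. a \<in> A \<Longrightarrow> b \<in> B \<Longrightarrow> a * b \<in> C" and F: "F \<in> sf.span A" and G: "G \<in> sf.span B"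
  shows "F * G \<in> sf.span C"
  using F
proof (induction rule: sf.span_induct_alt)
  case base
  show ?case by (simp add: sf.span_zero)
next
  case (step c a F)
  have "a * G \<in> sf.span C" using G
  proof (induction rule: sf.span_induct_alt)
    case base
    show ?case by (simp add: sf.span_zero)
  next
    case (step d b G)
    have "a * (scale_sf d b + G) = scale_sf d (a * b) + a * G"
      by (simp add: scale_sf_def algebra_simps)
    then show ?case using step AB[OF \<open>a \<in> A\<close>] by (simp add: sf.span_add sf.span_base sf.span_scale)
  qed
  moreover have "(scale_sf c a + F) * G = scale_sf c (a * G) + F * G"
    by (simp add: scale_sf_def algebra_simps)
  ultimately show ?case using step by (simp add: sf.span_add sf.span_scale)
qed

lemma span_mprod_mult:
  assumes "F \<in> sf.span (mprod x ` {K \<in> pos_msets. sum_mset K = m})"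
    "G \<in> sf.span (mprod x ` {K \<in> pos_msets. sum_mset K = n})"
  shows "F * G \<in> sf.span (mprod x ` {K \<in> pos_msets. sum_mset K = m + n})"
proof (rule span_mult_closed[OF _ assms])
  fix a b assume "a \<in> mprod x ` {K \<in> pos_msets. sum_mset K = m}" "b \<in> mprod x ` {K \<in> pos_msets. sum_mset K = n}"
  then obtain K L where "a = mprod x K" "b = mprod x L" "0 \<notin># K + L" "sum_mset (K + L) = m + n" by auto
  then show "a * b \<in> mprod x ` {K \<in> pos_msets. sum_mset K = m + n}"
    by (intro image_eqI[of _ _ "K + L"]) auto
qed

text \<open>Newton's identity solved for p_n: its coefficient \<open>c n\<close> is invertible, and
  the other terms are products of lower power sums with coefficients of \<open>F\<close> of
  complementary degree.\<close>

lemma power_sf_in_span_newton: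
  fixes F :: "'k::field_char_0 symfun fps"
  assumes F: "newton (\<lambda>k. const_sf (c k) * power_sf k) F" and c: "\<And>k. k \<ge> 1 \<Longrightarrow> c k \<noteq> 0"
    and "0 \<notin># K"
  shows "mprod power_sf K \<in> sf.span (mprod (fps_nth F) ` {L \<in> pos_msets. sum_mset L = sum_mset K})"
proof -
  define S where "S n = sf.span (mprod (fps_nth F) ` {L \<in> pos_msets. sum_mset L = n})" for n
  have S0: "1 \<in> S 0" unfolding S_def by (intro sf.span_base image_eqI[of _ _ "{#}"]) auto
  have Sn: "fps_nth F n \<in> S n" for n
  proof (cases "n = 0")
    case True
    then show ?thesis using S0 newton_0[OF F] by simp
  next
    case False
    then show ?thesis unfolding S_def by (intro sf.span_base image_eqI[of _ _ "{#n#}"]) auto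
  qed
  have scale: "const_sf d * G \<in> S n" if "G \<in> S n" for d G n
    using that sf.span_scale[of G _ d] unfolding S_def scale_sf_def by blast
  have p: "power_sf n \<in> S n" if "n \<ge> 1" for n
    using that
  proof (induction n rule: less_induct)
    case (less n)
    have split: "{1..n} = insert n {1..<n}" using less.prems by auto
    have "const_sf (c n) * power_sf n = const_sf (of_nat n) * fps_nth F n
        - (\<Sum>k\<in>{1..<n}. const_sf (c k) * power_sf k * fps_nth F (n - k))"
      unfolding const_sf_of_nat newton_rec[OF F] split using newton_0[OF F] by simp
    moreover have "const_sf (c k) * power_sf k * fps_nth F (n - k) \<in> S n" if "k \<in> {1..<n}" for k
      using span_mprod_mult[of "power_sf k" "fps_nth F" k "fps_nth F (n - k)" "n - k"] less.IH[of k] Sn[of "n - k"] that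
      unfolding mult.assoc by (intro scale) (simp add: S_def)
    ultimately have "const_sf (c n) * power_sf n \<in> S n"
      using scale[OF Sn] unfolding S_def by (metis (no_types, lifting) sf.span_diff sf.span_sum)
    from scale[OF this, of "inverse (c n)"] show ?case using c[OF less.prems] by simp
  qed
  have "mprod power_sf K \<in> S (sum_mset K)"
    using assms(3)
  proof (induction K)
    case empty
    show ?case using S0 by simp
  next
    case (add k K)
    then have "power_sf k \<in> S k" "mprod power_sf K \<in> S (sum_mset K)" using p[of k] by auto
    then show ?case using span_mprod_mult unfolding S_def by fastforce
  qed
  then show ?thesis by (simp add: S_def)
qed

text \<open>By counting dimensions in each degree.\<close>

lemma sf_indep_of_spanning:
  fixes y :: "nat multiset \<Rightarrow> 'k::field_char_0 symfun"
  assumes span: "\<And>K. 0 \<notin># K \<Longrightarrow> mprod power_sf K \<in> sf.span (y ` {L \<in> pos_msets. sum_mset L = sum_mset K})"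
  shows "sf_indep y pos_msets"
proof -
  have "sf_indep y {K \<in> pos_msets. sum_mset K \<le> N}" (is "sf_indep y ?P") for N
  proof -
    let ?p = "mprod power_sf :: _ \<Rightarrow> 'k symfun"
    have fin: "finite ?P" by (rule finite_pos_msets_le)
    have inj: "inj_on ?p ?P" using sf_indep_inj[OF sf_indep_power_sf] by (rule inj_on_subset) auto
    have ind: "sf.independent (?p ` ?P)"
      using sf_indep_independent[OF sf_indep_power_sf] by (rule sf.independent_mono) auto
    have sub: "?p ` ?P \<subseteq> sf.span (y ` ?P)"
    proof
      fix F assume "F \<in> ?p ` ?P"
      then obtain K where K: "F = ?p K" "0 \<notin># K" "sum_mset K \<le> N" by auto
      have "y ` {L \<in> pos_msets. sum_mset L = sum_mset K} \<subseteq> y ` ?P" using K by auto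
      then show "F \<in> sf.span (y ` ?P)" using span[OF K(2)] K(1) sf.span_mono by blast
    qed
    have bound: "card ?P \<le> card T" if "finite T" "?p ` ?P \<subseteq> sf.span T" for T
      using sf.independent_span_bound[OF that(1) ind that(2)] card_image[OF inj] by simp
    have card: "card (y ` ?P) = card ?P"
      using bound[OF finite_imageI[OF fin] sub] card_image_le[OF fin, of y] by simp
    then have "inj_on y ?P" using fin eq_card_imp_inj_on by blast
    moreover have "sf.independent (y ` ?P)"
    proof (rule ccontr)
      assume "\<not> sf.independent (y ` ?P)"
      then obtain v where v: "v \<in> y ` ?P" "v \<in> sf.span (y ` ?P - {v})"
        unfolding sf.dependent_def by blast
      moreover have "insert v (y ` ?P - {v}) = y ` ?P" using v(1) by auto
      ultimately have "sf.span (y ` ?P) \<subseteq> sf.span (y ` ?P - {v})"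
        using sf.span_redundant[OF v(2)] by simp
      then have "card ?P \<le> card (y ` ?P - {v})" using bound fin sub by blast
      then show False using card_Diff1_less[OF finite_imageI[OF fin] v(1)] card by simp
    qed
    ultimately show ?thesis by (rule sf_indepI)
  qed
  note P = this
  show ?thesis unfolding sf_indep_def
  proof (intro allI impI)
    fix S and c :: "nat multiset \<Rightarrow> 'k"
    assume S: "finite S" "S \<subseteq> pos_msets" "(\<Sum>i\<in>S. const_sf (c i) * y i) = 0"
    have "S \<subseteq> {K \<in> pos_msets. sum_mset K \<le> Max (sum_mset ` S)}" using S(1,2) by auto
    then show "\<forall>i\<in>S. c i = 0" using sf_indepD[OF P S(1) _ S(3)] by blast
  qed
qed

lemma span_UNIV_of_spanning:
  fixes y :: "nat multiset \<Rightarrow> 'k::field_char_0 symfun"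
  assumes span: "\<And>K. 0 \<notin># K \<Longrightarrow> mprod power_sf K \<in> sf.span (y ` {L \<in> pos_msets. sum_mset L = sum_mset K})"
  shows "sf.span (y ` pos_msets) = UNIV"
proof -
  have "mprod power_sf ` pos_msets \<subseteq> sf.span (y ` pos_msets)"
  proof
    fix F :: "'k symfun" assume "F \<in> mprod power_sf ` pos_msets"
    then obtain K where "0 \<notin># K" "F = mprod power_sf K" by auto
    then show "F \<in> sf.span (y ` pos_msets)"
      using span[of K] sf.span_mono[of "y ` {L \<in> pos_msets. sum_mset L = sum_mset K}" "y ` pos_msets"] by auto
  qed
  then have "sf.span (mprod power_sf ` pos_msets) \<subseteq> sf.span (y ` pos_msets)"
    by (metis sf.span_mono sf.span_span)
  then show ?thesis using span_power_sf by blast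
qed

subsection \<open>The operator \<open>macD\<close>\<close>

text \<open>A span with coefficients confined to \<open>S\<close>, which serves to track
  divisibility by powers of 1 - b. Summands are collected one at a time, so \<open>S\<close> may be
  any set.\<close>

inductive_set cspan :: "'k::comm_ring_1 set \<Rightarrow> 'k symfun set \<Rightarrow> 'k symfun set" for S G where
  cspan_zero: "0 \<in> cspan S G"
| cspan_step: "s \<in> S \<Longrightarrow> g \<in> G \<Longrightarrow> F \<in> cspan S G \<Longrightarrow> const_sf s * g + F \<in> cspan S G"

lemma cspan_add: "F \<in> cspan S G \<Longrightarrow> F' \<in> cspan S G \<Longrightarrow> F + F' \<in> cspan S G"
  by (induction rule: cspan.induct) (auto simp: add.assoc intro: cspan.intros)

lemma cspan_sum: "(\<And>i. i \<in> I \<Longrightarrow> f i \<in> cspan S G) \<Longrightarrow> (\<Sum>i\<in>I. f i) \<in> cspan S G"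
  by (induction I rule: infinite_finite_induct) (auto intro: cspan_add cspan_zero)

lemma cspan_scaled_base: "s \<in> S \<Longrightarrow> g \<in> G \<Longrightarrow> const_sf s * g \<in> cspan S G"
  using cspan_step[OF _ _ cspan_zero] by force

lemma cspan_base: "1 \<in> S \<Longrightarrow> g \<in> G \<Longrightarrow> g \<in> cspan S G"
  using cspan_scaled_base[of 1] by force

lemma cspan_scale:
  assumes "F \<in> cspan S G" "\<And>s. s \<in> S \<Longrightarrow> c * s \<in> S'"
  shows "const_sf c * F \<in> cspan S' G"
  using assms(1)
proof (induction rule: cspan.induct)
  case (cspan_step s g F)
  have "const_sf c * (const_sf s * g + F) = const_sf (c * s) * g + const_sf c * F"
    by (simp add: const_sf_mult algebra_simps)
  then show ?case using cspan_step assms(2) by (auto intro: cspan.intros)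
qed (auto intro: cspan.intros)

lemma cspan_mult_left:
  assumes "F \<in> cspan S G" "\<And>g. g \<in> G \<Longrightarrow> x * g \<in> G'"
  shows "x * F \<in> cspan S G'"
  using assms(1)
proof (induction rule: cspan.induct)
  case (cspan_step s g F)
  have "x * (const_sf s * g + F) = const_sf s * (x * g) + x * F"
    by (simp add: algebra_simps)
  then show ?case using cspan_step assms(2) by (auto intro: cspan.intros)
qed (auto intro: cspan.intros)

lemma cspan_mono:
  assumes "F \<in> cspan S G" "S \<subseteq> S'" "G \<subseteq> G'"
  shows "F \<in> cspan S' G'"
  using assms(1) by (induction rule: cspan.induct) (use assms in \<open>auto intro: cspan.intros\<close>)

lemma cspan_uminus:
  assumes "F \<in> cspan S G" "\<And>s. s \<in> S \<Longrightarrow> - s \<in> S"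
  shows "- F \<in> cspan S G"
  using cspan_scale[OF assms(1), of "- 1" S] assms(2) by (simp add: const_sf_uminus)

lemma cspan_diff:
  assumes "F \<in> cspan S G" "F' \<in> cspan S G" "\<And>s. s \<in> S \<Longrightarrow> - s \<in> S"
  shows "F - F' \<in> cspan S G"
  using cspan_add[OF assms(1) cspan_uminus[OF assms(2,3)]] by simp

lemma cspan_subset_span: "cspan S G \<subseteq> sf.span G"
proof
  fix F assume "F \<in> cspan S G"
  then show "F \<in> sf.span G"
    by (induction rule: cspan.induct)
      (auto simp: scale_sf_def[symmetric] intro: sf.span_zero sf.span_add sf.span_scale sf.span_base)
qed

lemma newton_geometric: "newton (\<lambda>k. x ^ k) (Abs_fps (\<lambda>n. x ^ n))"
  by (simp add: newton_def power_add[symmetric])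

lemma torsion_free_fls_symfun:
  fixes x :: "'k::field_char_0 symfun fls"
  assumes "of_nat n * x = 0" "n \<noteq> 0"
  shows "x = 0"
proof (rule fls_eqI)
  fix i
  have "of_nat n * fls_nth x i = 0" using arg_cong[OF assms(1), of "\<lambda>f. fls_nth f i"] by (simp add: fls_of_nat)
  then show "fls_nth x i = fls_nth 0 i" using of_nat_times_symfun_eq_0 assms(2) by auto
qed

text \<open>
  \<open>sf_shift a b\<close> is the plethystic substitution \<open>X \<mapsto> X + (1 - a) (1 - b) / z\<close>, with values in Laurent
  series in \<open>z\<close>, and \<open>exp_neg\<close> is the plethystic exponential of \<open>- z X\<close>.
\<close>

definition sf_shift :: "'k::field_char_0 \<Rightarrow> 'k \<Rightarrow> 'k symfun \<Rightarrow> 'k symfun fls" where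
  "sf_shift a b = sf_lift (\<lambda>c. fls_const (const_sf c))
     (\<lambda>k. fls_const (power_sf k) + fls_const (const_sf ((1 - a ^ k) * (1 - b ^ k))) * fls_X_inv ^ k)"

definition exp_neg :: "'k::field_char_0 symfun fps" where
  "exp_neg = Abs_fps (\<lambda>n. (- 1) ^ n * elem_sf n)"

definition Dz :: "'k::field_char_0 \<Rightarrow> 'k \<Rightarrow> 'k symfun \<Rightarrow> 'k symfun fls" where
  "Dz a b F = sf_shift a b F * fps_to_fls exp_neg"

definition macD :: "'k::field_char_0 \<Rightarrow> 'k \<Rightarrow> 'k symfun \<Rightarrow> 'k symfun" where
  "macD a b F = fls_nth (Dz a b F) 0"

lemma comm_ring_hom_fls_const_sf: "comm_ring_hom (\<lambda>c. fls_const (const_sf c))"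
  by unfold_locales (simp_all add: const_sf_add const_sf_mult fls_plus_const)

lemma sf_hom_sf_shift: "sf_hom (\<lambda>c. fls_const (const_sf c)) (sf_shift a b)"
  unfolding sf_shift_def by (rule sf_lift[OF comm_ring_hom_fls_const_sf])

interpretation sf_shift: comm_ring_hom "sf_shift a b"
  by (rule sf_homD(1)[OF sf_hom_sf_shift])

lemma sf_shift_const: "sf_shift a b (const_sf c) = fls_const (const_sf c)"
  by (rule sf_homD(2)[OF sf_hom_sf_shift])

lemma sf_shift_power_sf: "k \<ge> 1 \<Longrightarrow> sf_shift a b (power_sf k)
  = fls_const (power_sf k) + fls_const (const_sf ((1 - a ^ k) * (1 - b ^ k))) * fls_X_inv ^ k"
  unfolding sf_shift_def by (rule sf_lift[OF comm_ring_hom_fls_const_sf])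

lemma sf_shift_commute: "sf_shift a b = sf_shift b a"
  unfolding sf_shift_def by (simp add: mult.commute)

text \<open>This symmetry is the source of the second triangularity of H_mu: one operator is
  triangular for the products of h_n[X/(1 - q)] and for those of h_n[X/(1 - t)].\<close>

lemma macD_commute: "macD a b = macD b a"
  unfolding macD_def Dz_def by (subst sf_shift_commute) simp

lemma macD_add: "macD a b (F + G) = macD a b F + macD a b G"
  by (simp add: macD_def Dz_def sf_shift.hom_add distrib_right)

lemma macD_scale: "macD a b (const_sf c * F) = const_sf c * macD a b F"
  by (simp add: macD_def Dz_def sf_shift.hom_mult sf_shift_const mult.assoc)

text \<open>\<open>eta a\<close> is the series \<open>\<Sum>\<^sub>n h\<^sub>n[X / (1 - a)] z\<^sup>n\<close>; it needs \<open>a\<close> not to be a root of unity.\<close>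

definition unscale :: "'k::field_char_0 \<Rightarrow> 'k symfun \<Rightarrow> 'k symfun" where
  "unscale a = sf_lift const_sf (\<lambda>k. const_sf (1 / (1 - a ^ k)) * power_sf k)"

definition eta :: "'k::field_char_0 \<Rightarrow> 'k symfun fps" where
  "eta a = Abs_fps (\<lambda>n. unscale a (complete_sf n))"

lemma sf_hom_unscale: "sf_hom const_sf (unscale a)"
  unfolding unscale_def by (rule sf_lift[OF comm_ring_hom_const_sf])

interpretation unscale: comm_ring_hom "unscale a"
  by (rule sf_homD(1)[OF sf_hom_unscale])

lemma unscale_const: "unscale a (const_sf c) = const_sf c"
  by (rule sf_homD(2)[OF sf_hom_unscale])

lemma unscale_power_sf: "k \<ge> 1 \<Longrightarrow> unscale a (power_sf k) = const_sf (1 / (1 - a ^ k)) * power_sf k"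
  unfolding unscale_def by (rule sf_lift[OF comm_ring_hom_const_sf])

lemma newton_eta: "newton (\<lambda>k. const_sf (1 / (1 - a ^ k)) * power_sf k) (eta a)"
proof -
  have "newton (\<lambda>k. unscale a (power_sf k)) (eta a)"
    using newton_hom[OF sf_homD(1)[OF sf_hom_unscale] newton_complete_sf] by (simp add: eta_def)
  then show ?thesis by (rule newton_cong) (rule unscale_power_sf)
qed

lemma newton_exp_neg: "newton (\<lambda>k. - power_sf k) (exp_neg :: 'k::field_char_0 symfun fps)"
proof -
  have "newton (\<lambda>k. (- 1) ^ k * ((- 1) ^ (k - 1) * power_sf k)) exp_neg"
    using newton_scale[OF newton_elem_sf, of "- 1"] by (simp add: exp_neg_def)
  moreover have "(- 1) ^ k * ((- 1) ^ (k - 1) * F) = - F" if "k \<ge> 1" for k and F :: "'k symfun"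
    using that by (cases k) (simp_all add: mult.assoc[symmetric] power_mult_distrib[symmetric])
  ultimately show ?thesis by (rule newton_cong)
qed

text \<open>Plethystically 1/(1 - a) - 1 = a/(1 - a), so multiplication by the exponential of -zX
  replaces z by az.\<close>

lemma eta_exp_neg:
  assumes "\<forall>k\<ge>1. a ^ k \<noteq> 1"
  shows "eta a * exp_neg = Abs_fps (\<lambda>n. const_sf (a ^ n) * fps_nth (eta a) n)"
proof (rule newton_unique_symfun)
  show "newton (\<lambda>k. const_sf (1 / (1 - a ^ k)) * power_sf k + - power_sf k) (eta a * exp_neg)"
    by (rule newton_mult[OF newton_eta newton_exp_neg])
  have "newton (\<lambda>k. const_sf (a ^ k) * (const_sf (1 / (1 - a ^ k)) * power_sf k))
      (Abs_fps (\<lambda>n. const_sf (a ^ n) * fps_nth (eta a) n))"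
    using newton_scale[OF newton_eta, of "const_sf a"] by (simp add: const_sf_power)
  then show "newton (\<lambda>k. const_sf (1 / (1 - a ^ k)) * power_sf k + - power_sf k)
      (Abs_fps (\<lambda>n. const_sf (a ^ n) * fps_nth (eta a) n))"
  proof (rule newton_cong)
    fix k :: nat assume k: "k \<ge> 1"
    have "a ^ k * (1 / (1 - a ^ k)) = 1 / (1 - a ^ k) - 1" using assms[rule_format, OF k] by (simp add: field_simps)
    then show "const_sf (a ^ k) * (const_sf (1 / (1 - a ^ k)) * power_sf k)
        = const_sf (1 / (1 - a ^ k)) * power_sf k + - power_sf k"
      by (simp add: mult.assoc[symmetric] const_sf_mult[symmetric] const_sf_diff left_diff_distrib)
  qed
qed

section \<open>The shift applied to h_n[X/(1 - a)]\<close>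

lemma neg_one_power_times_neg_power:
  fixes w :: "'a::comm_ring_1"
  assumes "k \<ge> 1"
  shows "(- 1) ^ (k - 1) * (- w) ^ k = - (w ^ k)"
proof -
  obtain j where k: "k = Suc j" using assms by (cases k) auto
  have "(- 1) ^ j * (- w) ^ j = w ^ j" unfolding power_mult_distrib[symmetric] by simp
  then show ?thesis using arg_cong[of _ _ "\<lambda>x. - w * x"] k by (simp add: mult.left_commute)
qed

text \<open>The factor 1 - a^k cancels, so the shift adds (1 - b^k)/z^k to p_k/(1 - a^k). With u the
  power series variable, the exponential of these additions is (1 - b u/z)/(1 - u/z).\<close>

lemma sf_shift_eta_fps:
  assumes "\<forall>k\<ge>1. a ^ k \<noteq> 1"
  shows "Abs_fps (\<lambda>n. sf_shift a b (fps_nth (eta a) n)) = Abs_fps (\<lambda>n. fls_const (fps_nth (eta a) n))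
    * ((1 + fps_const (- (fls_const (const_sf b) * fls_X_inv)) * fps_X) * Abs_fps (\<lambda>n. fls_X_inv ^ n))"
proof (rule newton_unique[OF torsion_free_fls_symfun])
  let ?w = "fls_const (const_sf b) * fls_X_inv"
  let ?P = "\<lambda>k. fls_const (const_sf (1 / (1 - a ^ k)) * power_sf k)
    + ((- 1) ^ (k - 1) * (- ?w) ^ k + fls_X_inv ^ k)"
  have hom: "comm_ring_hom (fls_const :: 'a symfun \<Rightarrow> _)"
    by unfold_locales (simp_all add: fls_plus_const)
  show "newton ?P (Abs_fps (\<lambda>n. fls_const (fps_nth (eta a) n))
    * ((1 + fps_const (- ?w) * fps_X) * Abs_fps (\<lambda>n. fls_X_inv ^ n)))"
    by (intro newton_mult newton_linear newton_geometric newton_hom[OF hom newton_eta])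
  have "newton (\<lambda>k. sf_shift a b (const_sf (1 / (1 - a ^ k)) * power_sf k))
      (Abs_fps (\<lambda>n. sf_shift a b (fps_nth (eta a) n)))"
    by (rule newton_hom[OF sf_homD(1)[OF sf_hom_sf_shift] newton_eta])
  then show "newton ?P (Abs_fps (\<lambda>n. sf_shift a b (fps_nth (eta a) n)))"
  proof (rule newton_cong)
    fix k :: nat assume k: "k \<ge> 1"
    have "sf_shift a b (const_sf (1 / (1 - a ^ k)) * power_sf k)
        = fls_const (const_sf (1 / (1 - a ^ k)) * power_sf k) + fls_const (const_sf (1 - b ^ k)) * fls_X_inv ^ k"
      by (simp add: sf_shift.hom_mult sf_shift_const sf_shift_power_sf[OF k] distrib_left
          mult.assoc[symmetric] const_sf_mult[symmetric] assms[rule_format, OF k])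
    moreover have "(- 1) ^ (k - 1) * (- ?w) ^ k = - (?w ^ k)"
      using k by (rule neg_one_power_times_neg_power)
    moreover have "?w ^ k = fls_const (const_sf (b ^ k)) * fls_X_inv ^ k"
      by (simp add: power_mult_distrib fls_const_power const_sf_power)
    moreover have "fls_const (const_sf (1 - b ^ k)) * fls_X_inv ^ k
        = fls_X_inv ^ k - fls_const (const_sf (b ^ k)) * fls_X_inv ^ k"
      by (simp add: const_sf_diff fls_minus_const[symmetric] left_diff_distrib)
    ultimately show "sf_shift a b (const_sf (1 / (1 - a ^ k)) * power_sf k) = ?P k" by simp
  qed
qed

text \<open>With w = u/z the factor (1 - b w)/(1 - w) equals 1 + (1 - b)(w + w^2 + ...): every
  lowering of the index costs the same factor 1 - b.\<close>

lemma sf_shift_eta_nth: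
  assumes "\<forall>k\<ge>1. a ^ k \<noteq> 1"
  shows "fls_nth (sf_shift a b (fps_nth (eta a) r)) i
    = (if i = 0 then fps_nth (eta a) r
       else if i < 0 \<and> nat (- i) \<le> r then const_sf (1 - b) * fps_nth (eta a) (r - nat (- i)) else 0)"
proof -
  let ?w = "fls_const (const_sf b) * fls_X_inv"
  have G: "fps_nth ((1 + fps_const (- ?w) * fps_X) * Abs_fps (\<lambda>n. fls_X_inv ^ n)) n
      = (if n = 0 then 1 else fls_const (const_sf (1 - b)) * fls_X_inv ^ n)" for n
    by (cases n) (simp_all add: distrib_right mult.assoc const_sf_diff fls_minus_const[symmetric] left_diff_distrib)
  have "sf_shift a b (fps_nth (eta a) r) = (\<Sum>j=0..r. fls_const (fps_nth (eta a) j)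
      * (if r - j = 0 then 1 else fls_const (const_sf (1 - b)) * fls_X_inv ^ (r - j)))"
    using arg_cong[OF sf_shift_eta_fps[OF assms, of b], of "\<lambda>f. fps_nth f r"]
    unfolding fps_mult_nth[of "Abs_fps (\<lambda>n. fls_const (fps_nth (eta a) n))"] G by simp
  then have "fls_nth (sf_shift a b (fps_nth (eta a) r)) i = (\<Sum>j=0..r. fps_nth (eta a) j
      * (if i = - int (r - j) then if r = j then 1 else const_sf (1 - b) else 0))"
    by (simp add: fls_nth_sum) (intro sum.cong refl, auto)
  also have "\<dots> = (\<Sum>j\<in>(if i \<le> 0 \<and> nat (- i) \<le> r then {r - nat (- i)} else {}). fps_nth (eta a) j
      * (if i = - int (r - j) then if r = j then 1 else const_sf (1 - b) else 0))"
    by (rule sum.mono_neutral_right) (auto split: if_splits)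
  also have "\<dots> = (if i = 0 then fps_nth (eta a) r
       else if i < 0 \<and> nat (- i) \<le> r then const_sf (1 - b) * fps_nth (eta a) (r - nat (- i)) else 0)"
    by (auto simp: mult.commute)
  finally show ?thesis .
qed

lemma int_sign_cases:
  obtains (pos) "l > (0 :: int)" | (zero) "l = 0" | (neg) j where "l = - int j" "j \<ge> 1"
proof (cases "l < 0")
  case True
  then show thesis by (intro neg[of "nat (- l)"]) auto
qed (use pos zero in force)

definition eta_tail :: "'k::field_char_0 \<Rightarrow> nat \<Rightarrow> 'k symfun fps" where
  "eta_tail a r = Abs_fps (\<lambda>k. if k = 0 then 0 else fps_nth (eta a) (r + k))"

definition eta_scaled :: "'k::field_char_0 \<Rightarrow> 'k symfun fps" where
  "eta_scaled a = Abs_fps (\<lambda>n. const_sf (a ^ n) * fps_nth (eta a) n)"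

text \<open>The finitely many nonpositive powers are completed to the whole series eta(z)/z^r, and
  the surplus positive powers are subtracted as \<open>eta_tail\<close>. The whole series can then
  be merged with \<open>exp_neg\<close> by \<open>eta_exp_neg\<close>. The summand with b restores
  the constant term, as b + (1 - b) = 1.\<close>

lemma sf_shift_eta:
  assumes "\<forall>k\<ge>1. a ^ k \<noteq> 1"
  shows "sf_shift a b (fps_nth (eta a) r) = fls_const (const_sf b * fps_nth (eta a) r)
    + fls_const (const_sf (1 - b)) * (fls_X_inv ^ r * fps_to_fls (eta a) - fps_to_fls (eta_tail a r))"
proof (rule fls_eqI)
  fix i :: int
  have e: "const_sf b * F + const_sf (1 - b) * F = F" for F
    by (simp add: const_sf_diff algebra_simps)
  have n: "nat (int r + i) = r - nat (- i)" if "i < 0" "nat (- i) \<le> r" using that by simp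
  have n': "nat (int r + i) = r + nat i" if "i > 0" using that by simp
  show "fls_nth (sf_shift a b (fps_nth (eta a) r)) i = fls_nth (fls_const (const_sf b * fps_nth (eta a) r)
    + fls_const (const_sf (1 - b)) * (fls_X_inv ^ r * fps_to_fls (eta a) - fps_to_fls (eta_tail a r))) i"
    unfolding sf_shift_eta_nth[OF assms] fls_plus_nth fls_mult_const_nth fls_minus_nth
      fls_X_inv_power_times_conv_shift fls_shift_nth fps_to_fls_nth fls_const_nth
    using e n n' by (auto simp: eta_tail_def add.commute not_less)
qed

section \<open>Triangularity of \<open>macD\<close> for dominance\<close>

lemma Dz_eta_times:
  assumes "\<forall>k\<ge>1. a ^ k \<noteq> 1"
  shows "Dz a b (fps_nth (eta a) r * F) = fls_const (const_sf b * fps_nth (eta a) r) * Dz a b F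
    + fls_const (const_sf (1 - b)) * (fls_X_inv ^ r * (sf_shift a b F * fps_to_fls (eta_scaled a))
        - fps_to_fls (eta_tail a r) * Dz a b F)"
proof -
  have "fps_to_fls (eta a) * fps_to_fls exp_neg = fps_to_fls (eta_scaled a)"
    unfolding fls_times_fps_to_fls[symmetric] eta_scaled_def by (simp add: eta_exp_neg[OF assms])
  then have "fps_to_fls (eta_scaled a) = fps_to_fls (eta a) * fps_to_fls exp_neg" ..
  then show ?thesis unfolding Dz_def sf_shift.hom_mult sf_shift_eta[OF assms]
    by (simp add: algebra_simps)
qed

text \<open>The induction over the factors of a product involves every coefficient of nonpositive
  degree, because the positive powers in \<open>eta_tail\<close> are paired with negative ones of
  \<open>Dz\<close>.\<close>

definition D_low :: "'k::field_char_0 \<Rightarrow> 'k \<Rightarrow> nat \<Rightarrow> 'k symfun \<Rightarrow> 'k symfun" where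
  "D_low a b s F = fls_nth (Dz a b F) (- int s)"

lemma D_low_0: "D_low a b 0 = macD a b"
  by (simp add: D_low_def macD_def fun_eq_iff)

lemma D_low_eta_times:
  assumes "\<forall>k\<ge>1. a ^ k \<noteq> 1"
  shows "D_low a b s (fps_nth (eta a) r * F) = const_sf b * (fps_nth (eta a) r * D_low a b s F)
    + const_sf (1 - b) * (fls_nth (sf_shift a b F * fps_to_fls (eta_scaled a)) (int r - int s)
        - fls_nth (fps_to_fls (eta_tail a r) * Dz a b F) (- int s))"
  unfolding D_low_def Dz_eta_times[OF assms] fls_X_inv_power_times_conv_shift
  by (simp add: mult.assoc)

text \<open>
  \<open>dom_cond s \<nu> K\<close>: for each \<open>k\<close>, the \<open>k\<close> largest parts of \<open>K\<close> together with \<open>s\<close> sum to at least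
  \<open>\<nu>\<^sub>1 + \<dots> + \<nu>\<^sub>k\<close>. Here \<open>K\<close> may have parts equal to zero.
\<close>

definition dom_cond :: "nat \<Rightarrow> nat list \<Rightarrow> nat multiset \<Rightarrow> bool" where
  "dom_cond s \<nu> K \<longleftrightarrow> sum_mset K + s = sum_list \<nu>
    \<and> (\<forall>k. \<exists>A. A \<subseteq># K \<and> size A \<le> k \<and> sum_list (take k \<nu>) \<le> s + sum_mset A)"

definition strict_cond :: "nat list \<Rightarrow> nat multiset \<Rightarrow> bool" where
  "strict_cond \<nu> K \<longleftrightarrow> dom_cond 0 \<nu> K \<and> (\<exists>k. \<exists>A. A \<subseteq># K \<and> size A \<le> k \<and> sum_list (take k \<nu>) < sum_mset A)"

text \<open>Adding a row \<open>r\<close> while the excess changes from \<open>s\<close> to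
  \<open>s'\<close> forces the new part \<open>r + s - s'\<close>; joined to a witness for k - 1 it
  gives one for k.\<close>

lemma dom_cond_add:
  assumes "dom_cond s \<nu> K" "s' \<le> r + s"
  shows "dom_cond s' (r # \<nu>) (add_mset (r + s - s') K)"
  unfolding dom_cond_def
proof (intro conjI allI)
  show "sum_mset (add_mset (r + s - s') K) + s' = sum_list (r # \<nu>)"
    using assms by (simp add: dom_cond_def)
  fix k
  show "\<exists>A. A \<subseteq># add_mset (r + s - s') K \<and> size A \<le> k \<and> sum_list (take k (r # \<nu>)) \<le> s' + sum_mset A"
  proof (cases k)
    case (Suc k')
    obtain A where "A \<subseteq># K" "size A \<le> k'" "sum_list (take k' \<nu>) \<le> s + sum_mset A"
      using assms(1) unfolding dom_cond_def by blast
    then show ?thesis using Suc assms(2) by (intro exI[of _ "add_mset (r + s - s') A"]) auto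
  qed (auto intro: exI[of _ "{#}"])
qed

lemma strict_cond_add:
  assumes "dom_cond s \<nu> K" "s \<ge> 1"
  shows "strict_cond (r # \<nu>) (add_mset (r + s) K)"
  unfolding strict_cond_def
proof
  show "dom_cond 0 (r # \<nu>) (add_mset (r + s) K)" using dom_cond_add[OF assms(1), of 0 r] by simp
  show "\<exists>k. \<exists>A. A \<subseteq># add_mset (r + s) K \<and> size A \<le> k \<and> sum_list (take k (r # \<nu>)) < sum_mset A"
    using assms(2) by (intro exI[of _ 1] exI[of _ "{#r + s#}"]) auto
qed

lemma strict_cond_Cons:
  assumes "strict_cond \<nu> K"
  shows "strict_cond (r # \<nu>) (add_mset r K)"
proof -
  have d: "dom_cond 0 \<nu> K" using assms by (simp add: strict_cond_def)
  obtain k A where "A \<subseteq># K" "size A \<le> k" "sum_list (take k \<nu>) < sum_mset A"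
    using assms unfolding strict_cond_def by blast
  then have "add_mset r A \<subseteq># add_mset r K \<and> size (add_mset r A) \<le> Suc k
    \<and> sum_list (take (Suc k) (r # \<nu>)) < sum_mset (add_mset r A)" by simp
  then show ?thesis using dom_cond_add[OF d, of 0 r] unfolding strict_cond_def by (metis add_0_right diff_zero zero_le)
qed

lemma dom_cond_refl: "dom_cond 0 \<nu> (mset \<nu>)"
proof (induction \<nu>)
  case Nil
  show ?case by (auto simp: dom_cond_def)
next
  case (Cons r \<nu>)
  then show ?case using dom_cond_add[OF Cons, of 0 r] by simp
qed

text \<open>The diagonal entry of \<open>macD\<close>, read off the recursion that peels the first
  factor: b comes from the term that leaves this factor alone, (1 - b) a^r from the series with z
  replaced by az. The closed form is \<open>beta_eq_cell_sum\<close>.\<close>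

fun beta :: "'a::comm_ring_1 \<Rightarrow> 'a \<Rightarrow> nat list \<Rightarrow> 'a" where
  "beta a b [] = 1"
| "beta a b (r # \<nu>) = b * beta a b \<nu> + (1 - b) * a ^ r"

text \<open>\<open>R\<close> is a subring in which divisibility by 1 - b is tracked. For b = t and
  the rational functions defined at a point with t = 1, this measures orders of vanishing at t =
  1.\<close>

locale coeff_ring =
  fixes a b :: "'k::field_char_0" and R :: "'k set"
  assumes a_pow: "\<forall>k\<ge>1. a ^ k \<noteq> 1"
    and R_1: "1 \<in> R" and R_a: "a \<in> R" and R_b: "b \<in> R"
    and R_add: "\<And>x y. x \<in> R \<Longrightarrow> y \<in> R \<Longrightarrow> x + y \<in> R"
    and R_mult: "\<And>x y. x \<in> R \<Longrightarrow> y \<in> R \<Longrightarrow> x * y \<in> R"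
    and R_uminus: "\<And>x. x \<in> R \<Longrightarrow> - x \<in> R"
begin

lemma R_diff: "x \<in> R \<Longrightarrow> y \<in> R \<Longrightarrow> x - y \<in> R" using R_add[of x "- y"] R_uminus by simp

lemma R_power: "x \<in> R \<Longrightarrow> x ^ n \<in> R" by (induction n) (auto simp: R_1 R_mult)

definition I :: "nat \<Rightarrow> 'k set" where
  "I m = {(1 - b) ^ m * r | r. r \<in> R}"

lemma I_0: "I 0 = R" by (auto simp: I_def)

lemma I_mult: "x \<in> R \<Longrightarrow> y \<in> I m \<Longrightarrow> x * y \<in> I m"
  unfolding I_def using R_mult mult.left_commute by fast

lemma I_uminus: "y \<in> I m \<Longrightarrow> - y \<in> I m"
  using I_mult[OF R_uminus[OF R_1]] by simp

lemma I_Suc: "y \<in> I m \<Longrightarrow> (1 - b) * y \<in> I (Suc m)"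
  unfolding I_def by (auto simp: mult.assoc)

lemma I_mono: "m \<le> n \<Longrightarrow> I n \<subseteq> I m"
proof
  fix x assume "m \<le> n" "x \<in> I n"
  then obtain r where r: "x = (1 - b) ^ n * r" "r \<in> R" by (auto simp: I_def)
  have "x = (1 - b) ^ m * ((1 - b) ^ (n - m) * r)"
    using r(1) \<open>m \<le> n\<close> by (simp add: mult.assoc[symmetric] power_add[symmetric])
  then show "x \<in> I m" using r(2) R_mult R_power R_diff[OF R_1 R_b] unfolding I_def by blast
qed

abbreviation e :: "nat \<Rightarrow> 'k symfun" where "e \<equiv> fps_nth (eta a)"

definition dom_set :: "nat \<Rightarrow> nat list \<Rightarrow> 'k symfun set" where
  "dom_set s \<nu> = mprod e ` {K. dom_cond s \<nu> K}"

definition strict_set :: "nat list \<Rightarrow> 'k symfun set" where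
  "strict_set \<nu> = mprod e ` {K. strict_cond \<nu> K}"

lemma cspan_dom_set_add:
  assumes "F \<in> cspan S (dom_set s \<nu>)" "s' \<le> r + s"
  shows "e (r + s - s') * F \<in> cspan S (dom_set s' (r # \<nu>))"
  using assms(1)
proof (rule cspan_mult_left)
  fix g assume "g \<in> dom_set s \<nu>"
  then obtain K where "dom_cond s \<nu> K" "g = mprod e K" by (auto simp: dom_set_def)
  then show "e (r + s - s') * g \<in> dom_set s' (r # \<nu>)"
    unfolding dom_set_def using dom_cond_add[OF _ assms(2)]
    by (intro image_eqI[of _ _ "add_mset (r + s - s') K"]) auto
qed

lemma cspan_strict_set_add:
  assumes "F \<in> cspan S (dom_set s \<nu>)" "s \<ge> 1"
  shows "e (r + s) * F \<in> cspan S (strict_set (r # \<nu>))"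
  using assms(1)
proof (rule cspan_mult_left)
  fix g assume "g \<in> dom_set s \<nu>"
  then obtain K where "dom_cond s \<nu> K" "g = mprod e K" by (auto simp: dom_set_def)
  then show "e (r + s) * g \<in> strict_set (r # \<nu>)"
    unfolding strict_set_def using strict_cond_add[OF _ assms(2)]
    by (intro image_eqI[of _ _ "add_mset (r + s) K"]) auto
qed

lemma cspan_strict_set_Cons:
  assumes "F \<in> cspan S (strict_set \<nu>)"
  shows "e r * F \<in> cspan S (strict_set (r # \<nu>))"
  using assms
proof (rule cspan_mult_left)
  fix g assume "g \<in> strict_set \<nu>"
  then obtain K where "strict_cond \<nu> K" "g = mprod e K" by (auto simp: strict_set_def)
  then show "e r * g \<in> strict_set (r # \<nu>)"
    unfolding strict_set_def using strict_cond_Cons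
    by (intro image_eqI[of _ _ "add_mset r K"]) auto
qed

lemma cspan_I_scale: "F \<in> cspan (I m) G \<Longrightarrow> x \<in> R \<Longrightarrow> const_sf x * F \<in> cspan (I m) G"
  by (rule cspan_scale) (auto intro: I_mult)

lemma cspan_I_Suc: "F \<in> cspan (I m) G \<Longrightarrow> const_sf (1 - b) * F \<in> cspan (I (Suc m)) G"
  by (rule cspan_scale) (auto intro: I_Suc)

lemma cspan_I_mono: "F \<in> cspan (I m) G \<Longrightarrow> n \<le> m \<Longrightarrow> F \<in> cspan (I n) G"
  by (rule cspan_mono) (use I_mono in auto)

text \<open>By multiplicativity from a single factor: all powers of z are nonpositive, the constant
  terms multiply, and a negative power takes a factor 1 - b from at least one of the
  factors.\<close>

lemma sf_shift_eta_prod: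
  "(i > 0 \<longrightarrow> fls_nth (sf_shift a b (mprod e (mset \<nu>))) i = 0)
   \<and> fls_nth (sf_shift a b (mprod e (mset \<nu>))) 0 = mprod e (mset \<nu>)
   \<and> (j \<ge> 1 \<longrightarrow> fls_nth (sf_shift a b (mprod e (mset \<nu>))) (- int j) \<in> cspan (I 1) (dom_set j \<nu>))"
proof (induction \<nu> arbitrary: i j)
  case Nil
  show ?case by (auto simp: cspan_zero)
next
  case (Cons r \<nu>)
  let ?f = "sf_shift a b (e r)" and ?F = "mprod e (mset \<nu>)"
  let ?g = "sf_shift a b ?F"
  have fnth: "fls_nth ?f i = (if i = 0 then e r
       else if i < 0 \<and> nat (- i) \<le> r then const_sf (1 - b) * e (r - nat (- i)) else 0)" for i
    by (rule sf_shift_eta_nth[OF a_pow])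
  have hm: "sf_shift a b (mprod e (mset (r # \<nu>))) = ?f * ?g" by (simp add: sf_shift.hom_mult)
  have g0: "fls_nth ?g i = 0" if "i > 0" for i using Cons.IH[of i] that by blast
  have g1: "fls_nth ?g 0 = ?F" using Cons.IH by blast
  have g2: "fls_nth ?g (- int j) \<in> cspan (I 1) (dom_set j \<nu>)" if "j \<ge> 1" for j using Cons.IH[of _ j] that by blast
  have g3: "fls_nth ?g (- int j) \<in> cspan (I 0) (dom_set j \<nu>)" for j
  proof (cases "j = 0")
    case True
    then show ?thesis using g1 dom_cond_refl[of \<nu>]
      by (auto simp: I_0 dom_set_def intro!: cspan_base[OF R_1])
  next
    case False
    then show ?thesis using g2[of j] by (auto intro: cspan_I_mono)
  qed
  have "fls_nth (?f * ?g) i = 0" if "i > 0" for i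
    unfolding fls_times_nth(2)
  proof (rule sum.neutral, rule ballI)
    fix l show "fls_nth ?f l * fls_nth ?g (i - l) = 0"
      using that g0[of "i - l"] fnth[of l] by (cases "l > 0") auto
  qed
  moreover have "fls_nth (?f * ?g) 0 = e r * ?F"
  proof -
    have "fls_nth (?f * ?g) 0 = (\<Sum>l=fls_subdegree ?f..0 - fls_subdegree ?g. if l = 0 then e r * ?F else 0)"
      unfolding fls_times_nth(2)
    proof (rule sum.cong[OF refl])
      fix l show "fls_nth ?f l * fls_nth ?g (0 - l) = (if l = 0 then e r * ?F else 0)"
        using g0[of "- l"] g1 fnth[of l] by (cases "l < 0"; cases "l = 0") auto
    qed
    also have "\<dots> = e r * ?F"
    proof (cases "fls_subdegree ?f \<le> 0 \<and> fls_subdegree ?g \<le> 0")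
      case True
      then show ?thesis by simp
    next
      case False
      \<comment> \<open>If the range of summation misses 0, then one of the constant terms is 0 and
        so is their product.\<close>
      then have "fls_nth ?f 0 = 0 \<or> fls_nth ?g 0 = 0" using fls_eq0_below_subdegree not_le by metis
      then show ?thesis using g1 fnth[of 0] by auto
    qed
    finally show ?thesis .
  qed
  moreover have "fls_nth (?f * ?g) (- int j) \<in> cspan (I 1) (dom_set j (r # \<nu>))" if j: "j \<ge> 1" for j
    unfolding fls_times_nth(2)
  proof (rule cspan_sum)
    fix l
    show "fls_nth ?f l * fls_nth ?g (- int j - l) \<in> cspan (I 1) (dom_set j (r # \<nu>))"
    proof (cases l rule: int_sign_cases)
      case pos
      then show ?thesis by (simp add: fnth cspan_zero)
    next
      case zero
      then show ?thesis using cspan_dom_set_add[OF g2[OF j], of j r] by (simp add: fnth)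
    next
      case (neg i)
      show ?thesis
      proof (cases "i \<le> j \<and> i \<le> r")
        case True
        have "e (r + (j - i) - j) * fls_nth ?g (- int (j - i)) \<in> cspan (I 0) (dom_set j (r # \<nu>))"
          by (rule cspan_dom_set_add[OF g3]) (use True in linarith)
        moreover have "r + (j - i) - j = r - i" "- int j - l = - int (j - i)" using True neg by auto
        ultimately have "e (r - i) * fls_nth ?g (- int j - l) \<in> cspan (I 0) (dom_set j (r # \<nu>))" by simp
        from cspan_I_Suc[OF this] show ?thesis using neg True by (simp add: fnth mult.assoc)
      next
        case False
        then show ?thesis using neg g0[of "- int j - l"] by (cases "i > r") (auto simp: fnth cspan_zero)
      qed
    qed
  qed
  ultimately show ?case unfolding hm by simp
qed

lemma shift_scaled_term:
  assumes "j \<ge> 1"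
  shows "fls_nth (sf_shift a b (mprod e (mset \<nu>))) (- int j) * fls_nth (fps_to_fls (eta_scaled a)) (int r - int s + int j)
    \<in> cspan (I 1) (dom_set s (r # \<nu>))"
    and "fls_nth (sf_shift a b (mprod e (mset \<nu>))) (- int j) * fls_nth (fps_to_fls (eta_scaled a)) (int r + int j) \<in> cspan (I 1) (strict_set (r # \<nu>))"
proof -
  let ?g = "fls_nth (sf_shift a b (mprod e (mset \<nu>))) (- int j)"
  have g: "?g \<in> cspan (I 1) (dom_set j \<nu>)" using sf_shift_eta_prod assms by blast
  show "?g * fls_nth (fps_to_fls (eta_scaled a)) (int r - int s + int j) \<in> cspan (I 1) (dom_set s (r # \<nu>))"
  proof (cases "s \<le> r + j")
    case True
    have "?g * fls_nth (fps_to_fls (eta_scaled a)) (int r - int s + int j)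
        = const_sf (a ^ (r + j - s)) * (e (r + j - s) * ?g)"
    proof -
      have "nat (int r - int s + int j) = r + j - s" "\<not> int r - int s + int j < 0" using True by auto
      then show ?thesis by (simp add: eta_scaled_def mult_ac)
    qed
    then show ?thesis using cspan_I_scale[OF cspan_dom_set_add[OF g True] R_power[OF R_a]] by simp
  next
    case False
    then show ?thesis by (simp add: cspan_zero)
  qed
  have "?g * fls_nth (fps_to_fls (eta_scaled a)) (int r + int j) = const_sf (a ^ (r + j)) * (e (r + j) * ?g)"
    by (simp add: eta_scaled_def mult_ac nat_add_distrib)
  then show "?g * fls_nth (fps_to_fls (eta_scaled a)) (int r + int j) \<in> cspan (I 1) (strict_set (r # \<nu>))"
    using cspan_I_scale[OF cspan_strict_set_add[OF g assms] R_power[OF R_a]] by simp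
qed

text \<open>For s > 0 a factor 1 - b is always present: the one term of the recursion without an
  explicit factor inherits it from the same s and one row less, down to the empty product, where
  only s = 0 gives something nonzero.\<close>

lemma D_low_dom_set:
  "D_low a b s (mprod e (mset \<nu>)) \<in> cspan (if s = 0 then I 0 else I 1) (dom_set s \<nu>)"
proof (induction \<nu> arbitrary: s)
  case Nil
  have "fps_nth exp_neg 0 = (1 :: 'k symfun)" using newton_0[OF newton_exp_neg] .
  then have "D_low a b s (mprod e (mset [])) = (if s = 0 then 1 else 0)"
    by (simp add: D_low_def Dz_def)
  moreover have "1 \<in> dom_set 0 []" unfolding dom_set_def
    by (intro image_eqI[of _ _ "{#}"]) (auto simp: dom_cond_def)
  ultimately show ?case by (simp add: cspan_zero I_0 cspan_base[OF R_1])
next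
  case (Cons r \<nu>)
  let ?F = "mprod e (mset \<nu>)" and ?J = "\<lambda>s. if s = 0 then I 0 else I 1"
  have IH0: "D_low a b s ?F \<in> cspan (I 0) (dom_set s \<nu>)" for s
    using Cons.IH[of s] by (auto intro: cspan_I_mono split: if_splits)
  have 1: "const_sf b * (e r * D_low a b s ?F) \<in> cspan (?J s) (dom_set s (r # \<nu>))"
    using cspan_dom_set_add[OF Cons.IH[of s], of s r] by (auto intro: cspan_I_scale[OF _ R_b])
  have 2: "fls_nth (sf_shift a b ?F * fps_to_fls (eta_scaled a)) (int r - int s) \<in> cspan (I 0) (dom_set s (r # \<nu>))"
    unfolding fls_times_nth(2)
  proof (rule cspan_sum)
    fix l
    show "fls_nth (sf_shift a b ?F) l * fls_nth (fps_to_fls (eta_scaled a)) (int r - int s - l)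
        \<in> cspan (I 0) (dom_set s (r # \<nu>))"
    proof (cases l rule: int_sign_cases)
      case pos
      then show ?thesis using sf_shift_eta_prod[of l \<nu>] by (simp add: cspan_zero)
    next
      case zero
      show ?thesis
      proof (cases "s \<le> r")
        case True
        have "?F \<in> cspan (I 0) (dom_set 0 \<nu>)" using dom_cond_refl[of \<nu>]
          by (auto simp: I_0 dom_set_def intro!: cspan_base[OF R_1])
        from cspan_dom_set_add[OF this, of s r] True
        have "const_sf (a ^ (r - s)) * (e (r - s) * ?F) \<in> cspan (I 0) (dom_set s (r # \<nu>))"
          by (auto intro: cspan_I_scale[OF _ R_power[OF R_a]])
        moreover have "nat (int r - int s) = r - s" using True by simp
        ultimately show ?thesis using zero True sf_shift_eta_prod[of l \<nu>] by (simp add: eta_scaled_def mult_ac)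
      next
        case False
        then show ?thesis using zero by (simp add: cspan_zero)
      qed
    next
      case (neg j)
      then show ?thesis using cspan_I_mono[OF shift_scaled_term(1)[OF neg(2), of \<nu> r s]] by simp
    qed
  qed
  have 3: "fls_nth (fps_to_fls (eta_tail a r) * Dz a b ?F) (- int s) \<in> cspan (I 0) (dom_set s (r # \<nu>))"
    unfolding fls_times_nth(2)
  proof (rule cspan_sum)
    fix l
    show "fls_nth (fps_to_fls (eta_tail a r)) l * fls_nth (Dz a b ?F) (- int s - l) \<in> cspan (I 0) (dom_set s (r # \<nu>))"
    proof (cases "l \<ge> 1")
      case True
      then have i: "l = int (nat l)" "nat l \<ge> 1" by auto
      define i where "i = nat l"
      note i = i[folded i_def]
      have "fls_nth (Dz a b ?F) (- int s - l) = D_low a b (s + i) ?F" 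
      proof -
        have "- int s - l = - int (s + i)" using i(1) by simp
        then show ?thesis by (simp only: D_low_def)
      qed
      then show ?thesis using cspan_dom_set_add[OF IH0[of "s + i"], of s r] i by (simp add: eta_tail_def)
    next
      case False
      then show ?thesis by (simp add: eta_tail_def cspan_zero)
    qed
  qed
  have "const_sf (1 - b) * (fls_nth (sf_shift a b ?F * fps_to_fls (eta_scaled a)) (int r - int s)
        - fls_nth (fps_to_fls (eta_tail a r) * Dz a b ?F) (- int s)) \<in> cspan (I (Suc 0)) (dom_set s (r # \<nu>))"
    by (intro cspan_I_Suc cspan_diff 2 3 I_uminus)
  then have "const_sf (1 - b) * (fls_nth (sf_shift a b ?F * fps_to_fls (eta_scaled a)) (int r - int s)
        - fls_nth (fps_to_fls (eta_tail a r) * Dz a b ?F) (- int s)) \<in> cspan (?J s) (dom_set s (r # \<nu>))"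
    by (auto intro: cspan_I_mono)
  then show ?case using cspan_add[OF 1] by (simp add: D_low_eta_times[OF a_pow])
qed

text \<open>Off the diagonal 1 - b occurs squared: one factor is explicit in the recursion, the
  other comes with the negative powers of z in the shifted product or in \<open>Dz\<close>. The
  later elimination spends one of them.\<close>

lemma macD_triangular:
  "macD a b (mprod e (mset \<nu>)) - const_sf (beta a b \<nu>) * mprod e (mset \<nu>) \<in> cspan (I 2) (strict_set \<nu>)"
proof (induction \<nu>)
  case Nil
  have "fps_nth exp_neg 0 = (1 :: 'k symfun)" using newton_0[OF newton_exp_neg] .
  then show ?case by (simp add: macD_def Dz_def cspan_zero)
next
  case (Cons r \<nu>)
  let ?F = "mprod e (mset \<nu>)"
  let ?C = "fls_nth (sf_shift a b ?F * fps_to_fls (eta_scaled a)) (int r)"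
  let ?T = "fls_nth (fps_to_fls (eta_tail a r) * Dz a b ?F) 0"
  have 1: "const_sf b * (e r * (macD a b ?F - const_sf (beta a b \<nu>) * ?F)) \<in> cspan (I 2) (strict_set (r # \<nu>))"
    by (intro cspan_I_scale[OF _ R_b] cspan_strict_set_Cons Cons.IH)
  have 2: "?C - const_sf (a ^ r) * (e r * ?F) \<in> cspan (I 1) (strict_set (r # \<nu>))"
  proof -
    \<comment> \<open>The constant term of the shift yields the diagonal contribution a^r; without
      it only negative powers remain, with coefficients in \<open>I 1\<close>.\<close>
    define f where "f = sf_shift a b ?F - fls_const ?F"
    have "sf_shift a b ?F * fps_to_fls (eta_scaled a)
        = fls_const ?F * fps_to_fls (eta_scaled a) + f * fps_to_fls (eta_scaled a)"
      by (simp add: f_def algebra_simps)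
    then have "?C = ?F * (const_sf (a ^ r) * e r) + fls_nth (f * fps_to_fls (eta_scaled a)) (int r)"
      by (simp add: eta_scaled_def)
    then have "?C - const_sf (a ^ r) * (e r * ?F) = fls_nth (f * fps_to_fls (eta_scaled a)) (int r)"
      by (simp add: algebra_simps)
    also have "\<dots> \<in> cspan (I 1) (strict_set (r # \<nu>))"
      unfolding fls_times_nth(2)
    proof (rule cspan_sum)
      fix l
      show "fls_nth f l * fls_nth (fps_to_fls (eta_scaled a)) (int r - l) \<in> cspan (I 1) (strict_set (r # \<nu>))"
      proof (cases "l < 0")
        case True
        then obtain j where j: "l = - int j" "j \<ge> 1"
          by (cases l rule: int_sign_cases) auto
        then have "fls_nth f l = fls_nth (sf_shift a b ?F) (- int j)" by (simp add: f_def)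
        then show ?thesis using shift_scaled_term(2)[OF j(2), of \<nu> r] j(1) by simp
      next
        case False
        then have "fls_nth f l = 0" using sf_shift_eta_prod[of l \<nu>] by (auto simp: f_def)
        then show ?thesis by (simp add: cspan_zero)
      qed
    qed
    finally show ?thesis .
  qed
  have 3: "?T \<in> cspan (I 1) (strict_set (r # \<nu>))"
    unfolding fls_times_nth(2)
  proof (rule cspan_sum)
    fix l
    show "fls_nth (fps_to_fls (eta_tail a r)) l * fls_nth (Dz a b ?F) (0 - l) \<in> cspan (I 1) (strict_set (r # \<nu>))"
    proof (cases "l \<ge> 1")
      case True
      then have i: "l = int (nat l)" "nat l \<ge> 1" by auto
      define i where "i = nat l"
      note i = i[folded i_def]
      have "fls_nth (Dz a b ?F) (0 - l) = D_low a b i ?F" by (simp add: D_low_def i(1))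
      then show ?thesis using cspan_strict_set_add[of "D_low a b i ?F" "I 1" i \<nu> r] D_low_dom_set[of i \<nu>] i
        by (simp add: eta_tail_def)
    next
      case False
      then show ?thesis by (simp add: eta_tail_def cspan_zero)
    qed
  qed
  have "const_sf (1 - b) * (?C - const_sf (a ^ r) * (e r * ?F) - ?T) \<in> cspan (I (Suc 1)) (strict_set (r # \<nu>))"
    by (intro cspan_I_Suc cspan_diff 2 3 I_uminus)
  moreover have "macD a b (mprod e (mset (r # \<nu>))) - const_sf (beta a b (r # \<nu>)) * mprod e (mset (r # \<nu>))
      = const_sf b * (e r * (macD a b ?F - const_sf (beta a b \<nu>) * ?F))
        + const_sf (1 - b) * (?C - const_sf (a ^ r) * (e r * ?F) - ?T)"
  proof -
    have "const_sf (beta a b (r # \<nu>)) * (e r * ?F)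
        = const_sf b * (e r * (const_sf (beta a b \<nu>) * ?F)) + const_sf (1 - b) * (const_sf (a ^ r) * (e r * ?F))"
      by (simp only: beta.simps const_sf_add const_sf_mult distrib_right) (simp only: mult_ac)
    then show ?thesis using D_low_eta_times[OF a_pow, of b 0 r ?F] unfolding D_low_0
      by (simp add: algebra_simps del: beta.simps)
  qed
  ultimately show ?case using cspan_add[OF 1] by (simp add: numeral_2_eq_2)
qed

end

subsection \<open>Dominance and eigenvectors\<close>

text \<open>Bases are indexed by multisets, for which products are sums of indices;
  \<open>plist\<close> leads back to the sorted lists of the definitions.\<close>

definition plist :: "nat multiset \<Rightarrow> nat list" where
  "plist K = rev (sorted_list_of_multiset K)"

lemma mset_plist [simp]: "mset (plist K) = K"
  by (simp add: plist_def)

lemma sum_list_plist [simp]: "sum_list (plist K) = sum_mset K"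
  using sum_mset_sum_list[of "plist K"] by simp

lemma set_plist [simp]: "set (plist K) = set_mset K"
  using set_mset_mset[of "plist K"] by simp

lemma sorted_plist: "sorted_wrt (\<ge>) (plist K)"
  by (simp add: plist_def sorted_wrt_rev)

lemma sorted_ge_mset_unique:
  assumes "sorted_wrt (\<ge>) xs" "sorted_wrt (\<ge>) ys" "mset xs = mset (ys :: nat list)"
  shows "xs = ys"
proof -
  have "sorted (rev xs)" "sorted (rev ys)" using assms by (simp_all add: sorted_wrt_rev)
  then have "rev xs = rev ys" using assms(3) by (metis mset_rev properties_for_sort)
  then show ?thesis by simp
qed

lemma plist_mset: "\<mu> \<in> partitions \<Longrightarrow> plist (mset \<mu>) = \<mu>"
  by (rule sorted_ge_mset_unique) (auto simp: sorted_plist partitions_def partitions_of_def)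

lemma plist_partition: "0 \<notin># K \<Longrightarrow> plist K \<in> partitions_of (sum_mset K)"
  by (simp add: partitions_of_def sorted_plist)

lemma plist_in_partitions: "0 \<notin># K \<Longrightarrow> plist K \<in> partitions"
  using plist_partition by (auto simp: partitions_def)

lemma mset_partition: "\<mu> \<in> partitions_of n \<Longrightarrow> 0 \<notin># mset \<mu> \<and> sum_mset (mset \<mu>) = n"
  by (simp add: partitions_of_def sum_mset_sum_list)

lemma partitions_pos: "\<mu> \<in> partitions \<Longrightarrow> 0 \<notin># mset \<mu>"
  by (auto simp: partitions_def partitions_of_def)

lemma dominates_refl: "dominates \<mu> \<mu>"
  by (simp add: dominates_def)

lemma dominates_trans: "dominates l \<mu> \<Longrightarrow> dominates \<mu> \<nu> \<Longrightarrow> dominates l \<nu>"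
  unfolding dominates_def using le_trans by blast

lemma take_sums_eq_imp_eq:
  fixes xs ys :: "nat list"
  assumes "\<forall>k. sum_list (take k xs) = sum_list (take k ys)" "0 \<notin> set xs" "0 \<notin> set ys"
  shows "xs = ys"
  using assms
proof (induction xs arbitrary: ys)
  case Nil
  then have "sum_list ys = 0" using Nil(1)[rule_format, of "length ys"] by simp
  then show ?case using Nil(3) by (cases ys) auto
next
  case (Cons x xs)
  show ?case
  proof (cases ys)
    case Nil
    then show ?thesis using Cons.prems(1)[rule_format, of 1] Cons.prems(2) by simp
  next
    case (Cons y ys')
    have "x = y" using Cons.prems(1)[rule_format, of 1] Cons by simp
    moreover have "sum_list (take k xs) = sum_list (take k ys')" for k
      using Cons.prems(1)[rule_format, of "Suc k"] Cons \<open>x = y\<close> by simp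
    ultimately show ?thesis using Cons.IH[of ys'] Cons Cons.prems by simp
  qed
qed

lemma dominates_antisym:
  assumes "dominates \<mu> \<nu>" "dominates \<nu> \<mu>" "0 \<notin> set \<mu>" "0 \<notin> set \<nu>"
  shows "\<mu> = \<nu>"
  using assms by (intro take_sums_eq_imp_eq allI le_antisym) (simp_all add: dominates_def)

definition dom_up :: "nat multiset \<Rightarrow> nat multiset set" where
  "dom_up L = {K \<in> pos_msets. sum_mset K = sum_mset L \<and> dominates (plist K) (plist L)}"

definition dom_above :: "nat multiset \<Rightarrow> nat multiset set" where
  "dom_above L = dom_up L - {L}"

lemma dom_up_self: "0 \<notin># L \<Longrightarrow> L \<in> dom_up L"
  by (simp add: dom_up_def dominates_refl)

lemma dom_up_trans: "K \<in> dom_up L \<Longrightarrow> dom_up K \<subseteq> dom_up L"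
  by (auto simp: dom_up_def intro: dominates_trans)

lemma dom_up_antisym: "K \<in> dom_up L \<Longrightarrow> L \<in> dom_up K \<Longrightarrow> K = L"
proof -
  assume *: "K \<in> dom_up L" "L \<in> dom_up K"
  then have "plist K = plist L" by (intro dominates_antisym) (auto simp: dom_up_def)
  then show "K = L" by (metis mset_plist)
qed

lemma finite_up: "finite (dom_up L)"
  by (rule finite_subset[OF _ finite_pos_msets[of "sum_mset L"]]) (auto simp: dom_up_def)

lemma dom_above_up: "K \<in> dom_above L \<Longrightarrow> dom_up K \<subseteq> dom_above L"
  unfolding dom_above_def using dom_up_trans[of K L] dom_up_antisym[of K L] by auto

lemma dom_above_pos: "K \<in> dom_above L \<Longrightarrow> 0 \<notin># K"
  by (simp add: dom_above_def dom_up_def)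

text \<open>Well-founded because the finite set of partitions above shrinks strictly when passing to
  a strictly dominating one.\<close>

lemma dominance_induct [consumes 1, case_names step]:
  assumes "0 \<notin># L" and step: "\<And>L. 0 \<notin># L \<Longrightarrow> (\<And>K. K \<in> dom_above L \<Longrightarrow> P K) \<Longrightarrow> P L"
  shows "P L"
  using assms(1)
proof (induction "card (dom_up L)" arbitrary: L rule: less_induct)
  case less
  show ?case
  proof (rule step[OF less.prems])
    fix K assume K: "K \<in> dom_above L"
    then have "dom_up K \<subseteq> dom_up L - {L}" using dom_above_up by (auto simp: dom_above_def)
    then have "card (dom_up K) < card (dom_up L)"
      using finite_up dom_up_self[OF less.prems] by (meson card_mono card_Diff1_less finite_Diff le_less_trans)
    then show "P K" using less.hyps dom_above_pos[OF K] by blast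
  qed
qed

lemma unitriangular_span:
  fixes x y :: "nat multiset \<Rightarrow> 'k::field symfun"
  assumes tri: "\<And>L. 0 \<notin># L \<Longrightarrow> y L - x L \<in> sf.span (x ` dom_above L)" and "0 \<notin># L"
  shows "x L \<in> sf.span (y ` dom_up L)"
  using assms(2)
proof (induction rule: dominance_induct)
  case (step L)
  have "x ` dom_above L \<subseteq> sf.span (y ` dom_up L)"
  proof
    fix z assume "z \<in> x ` dom_above L"
    then obtain K where K: "K \<in> dom_above L" "z = x K" by auto
    have "dom_up K \<subseteq> dom_up L" using K(1) dom_up_trans by (auto simp: dom_above_def)
    then show "z \<in> sf.span (y ` dom_up L)" using step.IH[OF K(1)] K(2) sf.span_mono[of "y ` dom_up K" "y ` dom_up L"] by blast
  qed
  then have "y L - x L \<in> sf.span (y ` dom_up L)"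
    using tri[OF step.hyps] sf.span_mono[OF \<open>x ` dom_above L \<subseteq> _\<close>] unfolding sf.span_span by blast
  moreover have "y L \<in> sf.span (y ` dom_up L)" using dom_up_self[OF step.hyps] by (auto intro: sf.span_base)
  ultimately have "y L - (y L - x L) \<in> sf.span (y ` dom_up L)" by (rule sf.span_diff[rotated])
  then show ?case by simp
qed

text \<open>Exchange argument: one entry of \<open>A\<close>, the head of the list if it occurs
  there, is traded for the head, which is at least as large.\<close>

lemma sum_submset_le_take:
  assumes "sorted_wrt (\<ge>) xs" "A \<subseteq># mset xs" "size A \<le> k"
  shows "sum_mset A \<le> sum_list (take k (xs :: nat list))"
  using assms
proof (induction xs arbitrary: k A)
  case Nil
  then show ?case by simp
next
  case (Cons x xs)
  show ?case
  proof (cases "A = {#}")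
    case False
    then obtain k' where k: "k = Suc k'" using Cons.prems(3) by (cases k) auto
    obtain y where y: "y \<in># A" "y \<le> x" "A - {#y#} \<subseteq># mset xs"
    proof (cases "x \<in># A")
      case True
      then have "A - {#x#} \<subseteq># mset xs"
        using Cons.prems(2) by (simp add: insert_subset_eq_iff subset_eq_diff_conv)
      then show ?thesis using that[of x] True by simp
    next
      case False
      then have "A \<subseteq># mset xs"
        using Cons.prems(2) by (metis diff_single_trivial mset.simps(2) subset_eq_diff_conv add_mset_add_single)
      moreover obtain y where "y \<in># A" using \<open>A \<noteq> {#}\<close> by blast
      moreover have "y \<le> x" using calculation Cons.prems(1) by (auto dest: mset_subset_eqD)
      ultimately show ?thesis using that[of y] by (meson diff_subset_eq_self subset_mset.trans)
    qed
    have "sum_mset (A - {#y#}) \<le> sum_list (take k' xs)"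
      using Cons.IH[of "A - {#y#}" k'] Cons.prems y k by (simp add: size_Diff_singleton)
    moreover have "sum_mset A = y + sum_mset (A - {#y#})" using y(1) by (simp add: sum_mset.remove)
    ultimately show ?thesis using y(2) k by simp
  qed simp
qed

lemma sum_filter_nonzero: "sum_mset (filter_mset (\<lambda>k. 0 < k) A) = sum_mset (A :: nat multiset)"
  by (induction A) auto

lemma mprod_filter_nonzero:
  assumes "x 0 = 1"
  shows "mprod x (filter_mset (\<lambda>k. 0 < k) K) = mprod x K"
  by (induction K) (use assms in auto)

text \<open>Parts equal to 0 stand for factors h_0 = 1 and are dropped. The largest k parts sum to
  at least as much as any k parts, so the witnesses in \<open>strict_cond\<close> turn into
  dominance of sorted lists.\<close>

lemma strict_cond_dom_above:
  assumes L: "0 \<notin># L" and K: "strict_cond (plist L) K"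
  shows "filter_mset (\<lambda>k. 0 < k) K \<in> dom_above L"
proof -
  define K0 where "K0 = filter_mset (\<lambda>k. 0 < k) K"
  have top: "sum_mset A \<le> sum_list (take k (plist K0))" if "A \<subseteq># K" "size A \<le> k" for A k
  proof -
    have "filter_mset (\<lambda>k. 0 < k) A \<subseteq># K0" using that(1) by (simp add: K0_def multiset_filter_mono)
    moreover have "size (filter_mset (\<lambda>k. 0 < k) A) \<le> k" using that(2) size_filter_mset_lesseq le_trans by blast
    ultimately show ?thesis using sum_submset_le_take[OF sorted_plist, of "filter_mset (\<lambda>k. 0 < k) A" K0 k]
      by (simp add: sum_filter_nonzero)
  qed
  have "sum_mset K0 = sum_mset L" using K
    by (simp add: K0_def sum_filter_nonzero strict_cond_def dom_cond_def)
  moreover have "dominates (plist K0) (plist L)"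
    unfolding dominates_def
  proof
    fix k
    obtain A where "A \<subseteq># K" "size A \<le> k" "sum_list (take k (plist L)) \<le> sum_mset A"
      using K by (auto simp: strict_cond_def dom_cond_def)
    then show "sum_list (take k (plist L)) \<le> sum_list (take k (plist K0))" using top le_trans by blast
  qed
  moreover have "K0 \<noteq> L"
  proof
    assume "K0 = L"
    moreover obtain k A where "A \<subseteq># K" "size A \<le> k" "sum_list (take k (plist L)) < sum_mset A"
      using K by (auto simp: strict_cond_def)
    ultimately show False using top[of A k] by simp
  qed
  moreover have "0 \<notin># K0" by (simp add: K0_def)
  ultimately show ?thesis by (auto simp: dom_above_def dom_up_def K0_def)
qed

section \<open>Eigenvectors by back substitution\<close>

context coeff_ring
begin

lemma e_0: "e 0 = 1"
  by (rule newton_0[OF newton_eta])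

abbreviation x :: "nat multiset \<Rightarrow> 'k symfun" where "x \<equiv> mprod e"

lemma strict_set_subset:
  assumes "0 \<notin># L"
  shows "strict_set (plist L) \<subseteq> x ` dom_above L"
proof
  fix g assume "g \<in> strict_set (plist L)"
  then obtain K where K: "strict_cond (plist L) K" "g = x K" by (auto simp: strict_set_def)
  then have "g = x (filter_mset (\<lambda>k. 0 < k) K)" by (simp add: mprod_filter_nonzero e_0)
  then show "g \<in> x ` dom_above L" using strict_cond_dom_above[OF assms K(1)] by blast
qed

abbreviation eigval :: "nat multiset \<Rightarrow> 'k" where "eigval L \<equiv> beta a b (plist L)"

lemma macD_triangular_up:
  assumes "0 \<notin># L"
  shows "macD a b (x L) - const_sf (eigval L) * x L \<in> cspan (I 2) (x ` dom_above L)"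
  using cspan_mono[OF macD_triangular[of "plist L"] order_refl strict_set_subset[OF assms]] by simp

end

text \<open>By \<open>units\<close> the quotient of 1 - b by a difference of eigenvalues of equal
  degree lies in \<open>R\<close>. Inverting such a difference therefore costs a single factor 1 -
  b, and \<open>macD_triangular\<close> supplies two.\<close>

locale eigen_ring = coeff_ring a b R for a b :: "'k::field_char_0" and R +
  assumes b_1: "b \<noteq> 1"
    and units: "\<And>K L. 0 \<notin># K \<Longrightarrow> 0 \<notin># L \<Longrightarrow> sum_mset K = sum_mset L \<Longrightarrow> K \<noteq> L \<Longrightarrow>
      \<exists>u\<in>R. u \<noteq> 0 \<and> u * (eigval K - eigval L) = 1 - b"
begin

lemma macD_eq_0: "macD a b 0 = 0"
  using macD_scale[of a b 0 0] by simp

lemma macD_diff: "macD a b (F - G) = macD a b F - macD a b G"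
  using macD_add[of a b "F - G" G] by simp

text \<open>One of the two factors 1 - b in \<open>I 2\<close> pays for the hypothesis, which only
  reaches (1 - b) times a basis element; the other one stays in the solution.\<close>

lemma solve_eigen:
  assumes IH: "\<And>K. K \<in> S \<Longrightarrow> \<exists>y\<in>cspan R (x ` S). macD a b y - const_sf c * y = const_sf (1 - b) * x K"
    and z: "z \<in> cspan (I 2) (x ` S)"
  shows "\<exists>w\<in>cspan (I 1) (x ` S). macD a b w - const_sf c * w = z"
  using z
proof (induction rule: cspan.induct)
  case cspan_zero
  show ?case by (intro bexI[of _ 0]) (auto simp: macD_eq_0 cspan.cspan_zero)
next
  case (cspan_step s g F)
  obtain r where r: "s = (1 - b) ^ 2 * r" "r \<in> R" using cspan_step(1) by (auto simp: I_def)
  obtain K where K: "K \<in> S" "g = x K" using cspan_step(2) by auto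
  obtain y where y: "y \<in> cspan R (x ` S)" "macD a b y - const_sf c * y = const_sf (1 - b) * x K"
    using IH[OF K(1)] by blast
  obtain w where w: "w \<in> cspan (I 1) (x ` S)" "macD a b w - const_sf c * w = F"
    using cspan_step by blast
  have "const_sf ((1 - b) * r) * y \<in> cspan (I 1) (x ` S)"
    by (rule cspan_scale[OF y(1)]) (use r(2) R_mult in \<open>auto simp: I_def mult.assoc\<close>)
  moreover have "macD a b (const_sf ((1 - b) * r) * y + w) - const_sf c * (const_sf ((1 - b) * r) * y + w)
      = const_sf ((1 - b) * r) * (macD a b y - const_sf c * y) + F"
    unfolding macD_add macD_scale w(2)[symmetric] by (simp add: algebra_simps)
  moreover have "\<dots> = const_sf s * g + F"
    unfolding y(2) r(1) K(2) by (simp only: const_sf_mult power2_eq_square mult_ac)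
  ultimately show ?case using cspan_add[OF _ w(1)] by metis
qed

text \<open>Going down from the top of the dominance order: \<open>w\<close> removes the
  off-diagonal part of the image of \<open>x K\<close>, and the multiplier \<open>u\<close> turns
  the remaining difference of eigenvalues into 1 - b.\<close>

lemma eigen_image:
  assumes L: "0 \<notin># L" and "0 \<notin># K" "K \<in> dom_above L"
  shows "\<exists>y\<in>cspan R (x ` dom_up K). macD a b y - const_sf (eigval L) * y = const_sf (1 - b) * x K"
  using assms(2,3)
proof (induction rule: dominance_induct)
  case (step K)
  define z where "z = macD a b (x K) - const_sf (eigval K) * x K"
  have z: "z \<in> cspan (I 2) (x ` dom_above K)" unfolding z_def by (rule macD_triangular_up[OF step.hyps])
  have "\<exists>y\<in>cspan R (x ` dom_above K). macD a b y - const_sf (eigval L) * y = const_sf (1 - b) * x K'"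
    if K': "K' \<in> dom_above K" for K'
  proof -
    have "K' \<in> dom_above L"
      using K' step.prems dom_above_up[of K L] by (auto simp: dom_above_def[of K])
    from step.IH[OF K' this] obtain y where y: "y \<in> cspan R (x ` dom_up K')"
      "macD a b y - const_sf (eigval L) * y = const_sf (1 - b) * x K'" by blast
    have "y \<in> cspan R (x ` dom_above K)" using y(1) by (rule cspan_mono) (use dom_above_up[OF K'] in auto)
    then show ?thesis using y(2) by blast
  qed
  from solve_eigen[OF this z] obtain w where w: "w \<in> cspan (I 1) (x ` dom_above K)"
    "macD a b w - const_sf (eigval L) * w = z" by blast
  have "sum_mset K = sum_mset L" "K \<noteq> L" using step.prems by (auto simp: dom_above_def dom_up_def)
  then obtain u where u: "u \<in> R" "u * (eigval K - eigval L) = 1 - b" using units[OF step.hyps L] by blast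
  have "w \<in> cspan R (x ` dom_up K)" using w(1)
    by (rule cspan_mono) (use I_mono[of 0 1] I_0 in \<open>auto simp: dom_above_def\<close>)
  moreover have "x K \<in> cspan R (x ` dom_up K)" using dom_up_self[OF step.hyps] by (auto intro: cspan_base[OF R_1])
  ultimately have "const_sf u * (x K - w) \<in> cspan R (x ` dom_up K)"
    by (intro cspan_scale[OF cspan_diff]) (auto intro: R_uminus R_mult u)
  moreover have "macD a b (x K - w) - const_sf (eigval L) * (x K - w) = const_sf (eigval K - eigval L) * x K"
  proof -
    have "macD a b w = const_sf (eigval L) * w + z" using w(2) by (simp add: algebra_simps)
    then show ?thesis by (simp add: macD_diff z_def const_sf_diff algebra_simps)
  qed
  then have "const_sf u * (macD a b (x K - w) - const_sf (eigval L) * (x K - w)) = const_sf (1 - b) * x K"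
    by (simp only: u(2)[symmetric] const_sf_mult mult.assoc)
  then have "macD a b (const_sf u * (x K - w)) - const_sf (eigval L) * (const_sf u * (x K - w))
      = const_sf (1 - b) * x K"
    unfolding macD_scale by (simp only: right_diff_distrib mult.left_commute)
  ultimately show ?case by blast
qed

text \<open>The vector is \<open>x L\<close> minus a solution for its off-diagonal part. That the
  correction lies in \<open>I 1\<close> makes the eigenvector congruent to \<open>x L\<close> modulo
  1 - b, which is what an evaluation at t = 1 can see.\<close>

lemma ex_eigenvector:
  assumes L: "0 \<notin># L"
  shows "\<exists>v. v - x L \<in> cspan (I 1) (x ` dom_above L) \<and> macD a b v = const_sf (eigval L) * v"
proof -
  define z where "z = macD a b (x L) - const_sf (eigval L) * x L"
  have z: "z \<in> cspan (I 2) (x ` dom_above L)" unfolding z_def by (rule macD_triangular_up[OF L])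
  have "\<exists>y\<in>cspan R (x ` dom_above L). macD a b y - const_sf (eigval L) * y = const_sf (1 - b) * x K"
    if K: "K \<in> dom_above L" for K
  proof -
    obtain y where y: "y \<in> cspan R (x ` dom_up K)" "macD a b y - const_sf (eigval L) * y = const_sf (1 - b) * x K"
      using eigen_image[OF L dom_above_pos[OF K] K] by blast
    have "y \<in> cspan R (x ` dom_above L)" using y(1) by (rule cspan_mono) (use dom_above_up[OF K] in auto)
    then show ?thesis using y(2) by blast
  qed
  from solve_eigen[OF this z] obtain w where w: "w \<in> cspan (I 1) (x ` dom_above L)"
    "macD a b w - const_sf (eigval L) * w = z" by blast
  have "macD a b w = const_sf (eigval L) * w + z" using w(2) by (simp add: algebra_simps)
  then have "macD a b (x L - w) = const_sf (eigval L) * (x L - w)"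
    by (simp add: macD_diff z_def algebra_simps)
  moreover have "x L - w - x L \<in> cspan (I 1) (x ` dom_above L)"
    using cspan_uminus[OF w(1) I_uminus] by simp
  ultimately show ?thesis by blast
qed

definition evec :: "nat multiset \<Rightarrow> 'k symfun" where
  "evec L = (SOME v. v - x L \<in> cspan (I 1) (x ` dom_above L) \<and> macD a b v = const_sf (eigval L) * v)"

lemma evec:
  assumes "0 \<notin># L"
  shows "evec L - x L \<in> cspan (I 1) (x ` dom_above L)" "macD a b (evec L) = const_sf (eigval L) * evec L"
  using someI_ex[OF ex_eigenvector[OF assms]] unfolding evec_def by (rule conjunct1, rule conjunct2)

lemma evec_in_span: "0 \<notin># L \<Longrightarrow> evec L \<in> sf.span (x ` dom_up L)"
proof -
  assume L: "0 \<notin># L"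
  have "evec L - x L \<in> sf.span (x ` dom_up L)"
    using evec(1)[OF L] cspan_subset_span sf.span_mono[of "x ` dom_above L" "x ` dom_up L"] by (auto simp: dom_above_def)
  moreover have "x L \<in> sf.span (x ` dom_up L)" using dom_up_self[OF L] by (auto intro: sf.span_base)
  ultimately show ?thesis using sf.span_add by fastforce
qed

lemma x_in_span_evec: "0 \<notin># L \<Longrightarrow> x L \<in> sf.span (evec ` dom_up L)"
  by (rule unitriangular_span[of evec x, OF subsetD[OF cspan_subset_span evec(1)]])

lemma power_in_span_x: "0 \<notin># K \<Longrightarrow> mprod power_sf K \<in> sf.span (x ` {L \<in> pos_msets. sum_mset L = sum_mset K})"
  by (rule power_sf_in_span_newton[OF newton_eta]) (simp_all add: a_pow[rule_format])

lemma power_in_span_evec: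
  assumes "0 \<notin># K"
  shows "mprod power_sf K \<in> sf.span (evec ` {L \<in> pos_msets. sum_mset L = sum_mset K})"
proof -
  have "x ` {L \<in> pos_msets. sum_mset L = sum_mset K} \<subseteq> sf.span (evec ` {L \<in> pos_msets. sum_mset L = sum_mset K})"
  proof
    fix z assume "z \<in> x ` {L \<in> pos_msets. sum_mset L = sum_mset K}"
    then obtain L where L: "z = x L" "0 \<notin># L" "sum_mset L = sum_mset K" by auto
    have "evec ` dom_up L \<subseteq> evec ` {L \<in> pos_msets. sum_mset L = sum_mset K}" using L by (auto simp: dom_up_def)
    then show "z \<in> sf.span (evec ` {L \<in> pos_msets. sum_mset L = sum_mset K})"
      using x_in_span_evec[OF L(2)] L(1) sf.span_mono by blast
  qed
  from sf.span_mono[OF this] show ?thesis using power_in_span_x[OF assms] unfolding sf.span_span by blast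
qed

lemma evec_indep: "sf_indep evec pos_msets"
  by (rule sf_indep_of_spanning[OF power_in_span_evec])

end

subsection \<open>Schur functions and the Hall scalar product\<close>

lemma sum_lessThan_card_le:
  assumes "finite S"
  shows "(\<Sum>i<card S. i) \<le> \<Sum>(S :: nat set)"
  using assms
proof (induction S rule: finite_linorder_max_induct)
  case (insert b S)
  have "S \<subseteq> {..<b}" using insert by auto
  then have "card S \<le> b" by (metis card_lessThan card_mono finite_lessThan)
  moreover have "b \<notin> S" using insert by auto
  ultimately show ?case using insert by simp
qed simp

lemma sum_permutes_ge:
  assumes "p permutes {0..<n}" "k \<le> n"
  shows "(\<Sum>i<k. i) \<le> (\<Sum>i<k. (p i :: nat))"
proof -
  have inj: "inj_on p {..<k}" using permutes_inj[OF assms(1)] by (rule inj_on_subset) simp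
  have "(\<Sum>i<k. i) = (\<Sum>i<card (p ` {..<k}). i)" using card_image[OF inj] by simp
  also have "\<dots> \<le> \<Sum>(p ` {..<k})" by (rule sum_lessThan_card_le) simp
  also have "\<dots> = (\<Sum>i<k. p i)" using inj by (simp add: sum.reindex)
  finally show ?thesis .
qed

text \<open>The k-th partial sum changes by the sum of the first k values of p minus 0 + ... + (k -
  1). This is nonnegative since the values are distinct, and it is positive just after the first
  index that p moves, because that index can only move up.\<close>

lemma strict_cond_permutes:
  assumes p: "p permutes {0..<n}" "p \<noteq> id" and n: "n = length \<nu>"
    and le: "\<And>i. i < n \<Longrightarrow> i \<le> \<nu> ! i + p i"
  shows "strict_cond \<nu> (image_mset (\<lambda>i. \<nu> ! i + p i - i) (mset_set {0..<n}))"
proof -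
  let ?f = "\<lambda>i. \<nu> ! i + p i - i"
  let ?A = "\<lambda>k. image_mset ?f (mset_set {0..<k})"
  have sum: "sum_mset (?A k) + (\<Sum>i<k. i) = sum_list (take k \<nu>) + (\<Sum>i<k. p i)" if "k \<le> n" for k
  proof -
    have "sum_mset (?A k) + (\<Sum>i<k. i) = (\<Sum>i<k. ?f i + i)"
      by (simp add: sum_unfold_sum_mset[symmetric] atLeast0LessThan sum.distrib)
    also have "\<dots> = (\<Sum>i<k. \<nu> ! i + p i)" using le that by (intro sum.cong) auto
    also have "\<dots> = sum_list (take k \<nu>) + (\<Sum>i<k. p i)"
      using that n by (simp add: sum.distrib sum_list_sum_nth atLeast0LessThan)
    finally show ?thesis .
  qed
  have sub: "?A k \<subseteq># ?A n" if "k \<le> n" for k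
    using that by (intro image_mset_subseteq_mono) (simp add: subset_imp_msubset_mset_set)
  have full: "(\<Sum>i<n. p i) = (\<Sum>i<n. i)"
    using sum.permute[OF p(1), of "\<lambda>i. i"] by (simp add: atLeast0LessThan comp_def)
  have dom: "\<exists>A. A \<subseteq># ?A n \<and> size A \<le> k \<and> sum_list (take k \<nu>) \<le> sum_mset A" for k
  proof (cases "k \<le> n")
    case True
    then show ?thesis using sub[OF True] sum[OF True] sum_permutes_ge[OF p(1) True]
      by (intro exI[of _ "?A k"]) auto
  next
    case False
    then show ?thesis using sum[of n] full n by (intro exI[of _ "?A n"]) auto
  qed
  define i0 where "i0 = (LEAST i. p i \<noteq> i)"
  have "\<exists>i. p i \<noteq> i" using p(2) by (auto simp: fun_eq_iff)
  then have i0: "p i0 \<noteq> i0" unfolding i0_def by (rule LeastI_ex)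
  have below: "p i = i" if "i < i0" for i using not_less_Least that unfolding i0_def by blast
  have "i0 < n" using i0 p(1) by (meson atLeastLessThan_iff not_le permutes_not_in zero_le)
  have "p i0 > i0"
  proof (rule ccontr)
    assume "\<not> p i0 > i0"
    then have "p i0 < i0" using i0 by simp
    then have "p (p i0) = p i0" by (rule below)
    then show False using i0 permutes_inj[OF p(1)] by (simp add: inj_eq)
  qed
  then have "(\<Sum>i<Suc i0. i) < (\<Sum>i<Suc i0. p i)" using below by simp
  then have "sum_list (take (Suc i0) \<nu>) < sum_mset (?A (Suc i0))"
    using sum[of "Suc i0"] \<open>i0 < n\<close> by simp
  moreover have "?A (Suc i0) \<subseteq># ?A n" using sub \<open>i0 < n\<close> by simp
  moreover have "size (?A (Suc i0)) \<le> Suc i0" by simp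
  moreover have "sum_mset (?A n) = sum_list \<nu>" using sum[of n] full n by simp
  then have "dom_cond 0 \<nu> (?A n)" unfolding dom_cond_def using dom by simp
  ultimately show ?thesis unfolding strict_cond_def by blast
qed

abbreviation hprod :: "nat multiset \<Rightarrow> 'k::comm_ring_1 symfun" where
  "hprod \<equiv> mprod complete_sf"

lemma complete_sf_0: "complete_sf 0 = 1"
  by (rule symfun_eqI) (simp add: coeff_sf_simps)

text \<open>In the Leibniz expansion of the Jacobi-Trudi determinant the identity contributes the
  product of the h indexed by the parts; any other permutation contributes a product for a strictly
  dominating partition, or 0 when an index is negative.\<close>

lemma schur_triangular:
  assumes L: "0 \<notin># L"
  shows "(schur_sf (plist L) :: 'k::field symfun) - hprod L \<in> sf.span (hprod ` dom_above L)"
proof -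
  let ?\<nu> = "plist L"
  let ?n = "length ?\<nu>"
  let ?M = "mat ?n ?n (\<lambda>(i, j). if i \<le> ?\<nu> ! i + j then complete_sf (?\<nu> ! i + j - i) else 0) :: 'k symfun mat"
  let ?P = "{p. p permutes {0..<?n}}"
  let ?t = "\<lambda>p. \<Prod>i = 0..<?n. ?M $$ (i, p i)"
  have fin: "finite ?P" by (rule finite_permutations) simp
  have "?t id = (\<Prod>i = 0..<?n. complete_sf (?\<nu> ! i))" by (intro prod.cong) auto
  also have "\<dots> = prod_list (map complete_sf ?\<nu>)"
    by (simp add: prod.list_conv_set_nth)
  also have "\<dots> = hprod (mset ?\<nu>)" by (metis mset_map prod_mset_prod_list)
  finally have id: "?t id = hprod L" by simp
  have summand: "?t p \<in> sf.span (hprod ` dom_above L)" if p: "p permutes {0..<?n}" "p \<noteq> id" for p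
  proof (cases "\<forall>i<?n. i \<le> ?\<nu> ! i + p i")
    case True
    have pn: "p i < ?n" if "i < ?n" for i using p(1) that permutes_in_image[OF p(1), of i] by simp
    let ?K = "image_mset (\<lambda>i. ?\<nu> ! i + p i - i) (mset_set {0..<?n})"
    have "?t p = (\<Prod>i = 0..<?n. complete_sf (?\<nu> ! i + p i - i))"
      using True pn by (intro prod.cong) auto
    also have "\<dots> = hprod ?K" by (simp add: prod_unfold_prod_mset image_mset.compositionality comp_def)
    also have "\<dots> = hprod (filter_mset (\<lambda>k. 0 < k) ?K)" by (simp only: mprod_filter_nonzero complete_sf_0)
    finally show ?thesis
      using strict_cond_dom_above[OF L strict_cond_permutes[OF p refl]] True by (auto intro: sf.span_base)
  next
    case False
    then obtain i where i: "i < ?n" "\<not> i \<le> ?\<nu> ! i + p i" by blast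
    then have "p i < ?n" using permutes_in_image[OF p(1), of i] by simp
    then have "?M $$ (i, p i) = 0" using i by simp
    then have "?t p = 0" using i(1) by (intro prod_zero) auto
    then show ?thesis by (simp only: sf.span_zero)
  qed
  have sgn: "signof p * F \<in> sf.span G" if "F \<in> sf.span G" for p F and G :: "'k symfun set"
    using that sf.span_neg[OF that] by (auto simp: sign_def)
  have "schur_sf ?\<nu> = (\<Sum>p\<in>?P. signof p * ?t p)"
    unfolding schur_sf_def by (subst det_def') auto
  also have "\<dots> = signof id * ?t id + (\<Sum>p\<in>?P - {id}. signof p * ?t p)"
    using fin by (subst sum.remove[of _ id]) (auto simp: permutes_id)
  finally have "schur_sf ?\<nu> - hprod L = (\<Sum>p\<in>?P - {id}. signof p * ?t p)"
    using id by (simp add: sign_id)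
  also have "\<dots> \<in> sf.span (hprod ` dom_above L)"
    by (intro sf.span_sum sgn summand) auto
  finally show ?thesis .
qed

lemma hprod_in_span_schur: "0 \<notin># L \<Longrightarrow> (hprod L :: 'k::field symfun) \<in> sf.span ((\<lambda>K. schur_sf (plist K)) ` dom_up L)"
  by (rule unitriangular_span[of "\<lambda>K. schur_sf (plist K)" hprod, OF schur_triangular])

lemma schur_in_span_hprod:
  assumes "0 \<notin># L"
  shows "(schur_sf (plist L) :: 'k::field symfun) \<in> sf.span (hprod ` dom_up L)"
proof -
  have "hprod ` dom_above L \<subseteq> (hprod ` dom_up L :: 'k symfun set)" by (auto simp: dom_above_def)
  then have "schur_sf (plist L) - hprod L \<in> sf.span (hprod ` dom_up L :: 'k symfun set)"
    using schur_triangular[OF assms] sf.span_mono by blast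
  moreover have "hprod L \<in> sf.span (hprod ` dom_up L :: 'k symfun set)"
    using dom_up_self[OF assms] by (auto intro: sf.span_base)
  ultimately show ?thesis using sf.span_add by fastforce
qed

lemma span_subset_span: "A \<subseteq> sf.span B \<Longrightarrow> F \<in> sf.span A \<Longrightarrow> F \<in> sf.span B"
  using sf.span_mono[of A "sf.span B"] by (auto simp: sf.span_span)

lemma span_schur_eq_span_hprod:
  "sf.span ((\<lambda>K. schur_sf (plist K)) ` dom_up L) = (sf.span (hprod ` dom_up L) :: 'k::field symfun set)"
proof -
  have sub: "dom_up K \<subseteq> dom_up L" and pos: "0 \<notin># K" if "K \<in> dom_up L" for K
    using that dom_up_trans by (auto simp: dom_up_def)
  have "(\<lambda>K. schur_sf (plist K)) ` dom_up L \<subseteq> (sf.span (hprod ` dom_up L) :: 'k symfun set)"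
    using sub schur_in_span_hprod[OF pos] sf.span_mono[OF image_mono] by blast
  moreover have "hprod ` dom_up L \<subseteq> sf.span ((\<lambda>K. schur_sf (plist K) :: 'k symfun) ` dom_up L)"
    using sub hprod_in_span_schur[OF pos] sf.span_mono[OF image_mono] by blast
  ultimately show ?thesis using span_subset_span by blast
qed

lemma power_in_span_hprod:
  assumes "0 \<notin># K"
  shows "(mprod power_sf K :: 'k::field_char_0 symfun) \<in> sf.span (hprod ` {L \<in> pos_msets. sum_mset L = sum_mset K})"
proof -
  have "fps_nth (Abs_fps complete_sf) = (complete_sf :: nat \<Rightarrow> 'k symfun)" by (simp add: fun_eq_iff)
  moreover have "(mprod power_sf K :: 'k symfun)
      \<in> sf.span (mprod (fps_nth (Abs_fps complete_sf)) ` {L \<in> pos_msets. sum_mset L = sum_mset K})"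
    by (rule power_sf_in_span_newton[OF _ _ assms, of "\<lambda>_. 1"]) (use newton_complete_sf in simp_all)
  ultimately show ?thesis by (simp only:)
qed

lemma power_in_span_schur:
  assumes "0 \<notin># K"
  shows "(mprod power_sf K :: 'k::field_char_0 symfun)
    \<in> sf.span ((\<lambda>K. schur_sf (plist K)) ` {L \<in> pos_msets. sum_mset L = sum_mset K})"
proof (rule span_subset_span[OF _ power_in_span_hprod[OF assms]], clarify)
  fix L assume L: "0 \<notin># L" "sum_mset L = sum_mset K"
  have "dom_up L \<subseteq> {L \<in> pos_msets. sum_mset L = sum_mset K}" using L by (auto simp: dom_up_def)
  then show "hprod L \<in> sf.span ((\<lambda>K. schur_sf (plist K) :: 'k symfun) ` {L \<in> pos_msets. sum_mset L = sum_mset K})"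
    using hprod_in_span_schur[OF L(1)] sf.span_mono[OF image_mono] by blast
qed

lemma schur_indep: "sf_indep (\<lambda>K. schur_sf (plist K) :: 'k::field_char_0 symfun) pos_msets"
  by (rule sf_indep_of_spanning[OF power_in_span_schur])

lemma schur_span: "sf.span ((\<lambda>K. schur_sf (plist K) :: 'k::field_char_0 symfun) ` pos_msets) = UNIV"
  by (rule span_UNIV_of_spanning[OF power_in_span_schur])

lemma homogeneous_in_span_schur:
  fixes F :: "'k::field_char_0 symfun"
  assumes "homogeneous_sf n F"
  shows "F \<in> sf.span ((\<lambda>K. schur_sf (plist K)) ` {L \<in> pos_msets. sum_mset L = n})"
proof (rule span_subset_span[OF _ homogeneous_span_power_sf[OF assms]], clarify)
  fix K assume "0 \<notin># K" "n = sum_mset K"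
  then show "mprod power_sf K \<in> sf.span ((\<lambda>K. schur_sf (plist K) :: 'k symfun) ` {L \<in> pos_msets. sum_mset L = sum_mset K})"
    using power_in_span_schur by blast
qed

section \<open>The Hall scalar product with a one-row Schur function\<close>

lemma linear_functionalD:
  assumes "Vector_Spaces.linear scale_sf (*) f"
  shows "f (F + G) = f F + f G" "f (const_sf c * F) = c * f F" "f 0 = 0"
proof -
  interpret Vector_Spaces.linear scale_sf "(*)" f by fact
  show "f (F + G) = f F + f G" "f (const_sf c * F) = c * f F" "f 0 = 0"
    by (simp_all add: add scale[unfolded scale_sf_def])
qed

lemma linear_functional_eq:
  assumes f: "Vector_Spaces.linear scale_sf (*) f" and g: "Vector_Spaces.linear scale_sf (*) g"
    and B: "\<And>x. x \<in> B \<Longrightarrow> f x = g x" and F: "F \<in> sf.span B"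
  shows "f F = g F"
  using F by (induction rule: sf.span_induct_alt)
    (simp_all add: linear_functionalD[OF f] linear_functionalD[OF g] scale_sf_def B)

lemma ex_linear_functional:
  assumes "sf.independent (B :: 'k::field symfun set)"
  shows "\<exists>f. Vector_Spaces.linear scale_sf (*) f \<and> (\<forall>x\<in>B. f x = (u x :: 'k))"
proof -
  have "vector_space ((*) :: 'k \<Rightarrow> 'k \<Rightarrow> 'k)"
    by (rule vector_space.intro) (simp_all add: distrib_left distrib_right)
  then interpret vector_space_pair scale_sf "(*) :: 'k \<Rightarrow> 'k \<Rightarrow> 'k"
    by (rule vector_space_pair.intro[OF vector_space_scale_sf])
  show ?thesis using linear_independent_extend[OF assms, where f = u] by blast
qed

text \<open>The form is obtained by linear extension in each argument from the coordinates in the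
  Schur basis, and orthonormality determines it there. Pairing with one Schur function is thus its
  coordinate functional.\<close>

lemma hall_inner_schur:
  fixes F :: "'k::field_char_0 symfun"
  assumes f: "Vector_Spaces.linear scale_sf (*) f" "0 \<notin># N"
    "\<And>K. 0 \<notin># K \<Longrightarrow> f (schur_sf (plist K)) = (if K = N then 1 else (0 :: 'k))"
  shows "hall_inner F (schur_sf (plist N)) = f F"
proof -
  let ?s = "\<lambda>K. schur_sf (plist K) :: 'k symfun"
  have ind: "sf.independent (?s ` pos_msets)" by (rule sf_indep_independent[OF schur_indep])
  have inj: "inj_on ?s pos_msets" by (rule sf_indep_inj[OF schur_indep])
  have basis_eq: "\<phi> = \<psi>" if "Vector_Spaces.linear scale_sf (*) \<phi>" "Vector_Spaces.linear scale_sf (*) \<psi>"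
    "\<And>K. 0 \<notin># K \<Longrightarrow> \<phi> (?s K) = \<psi> (?s K)" for \<phi> \<psi> :: "'k symfun \<Rightarrow> 'k"
  proof
    fix F show "\<phi> F = \<psi> F"
      by (rule linear_functional_eq[OF that(1,2), of "?s ` pos_msets"]) (use that(3) schur_span in auto)
  qed
  have ex: "\<exists>f. Vector_Spaces.linear scale_sf (*) f \<and> (\<forall>K. 0 \<notin># K \<longrightarrow> f (?s K) = u K)" for u :: "nat multiset \<Rightarrow> 'k"
    using ex_linear_functional[OF ind, of "\<lambda>x. u (the_inv_into pos_msets ?s x)"] the_inv_into_f_f[OF inj] by force
  define co where "co K = (SOME f. Vector_Spaces.linear scale_sf (*) f \<and> (\<forall>L. 0 \<notin># L \<longrightarrow> f (?s L) = (if L = K then 1 else 0)))" for K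
  have co: "Vector_Spaces.linear scale_sf (*) (co K)" "0 \<notin># L \<Longrightarrow> co K (?s L) = (if L = K then 1 else 0)" for K L
    using someI_ex[OF ex[of "\<lambda>L. if L = K then 1 else 0"]] unfolding co_def by blast+
  define B where "B F = (SOME f. Vector_Spaces.linear scale_sf (*) f \<and> (\<forall>L. 0 \<notin># L \<longrightarrow> f (?s L) = co L F))" for F
  have B: "Vector_Spaces.linear scale_sf (*) (B F)" "0 \<notin># L \<Longrightarrow> B F (?s L) = co L F" for F L
    using someI_ex[OF ex[of "\<lambda>L. co L F"]] unfolding B_def by blast+
  let ?Q = "\<lambda>B. (\<forall>G. Vector_Spaces.linear scale_sf (*) (\<lambda>F. B F G)) \<and>
     (\<forall>F. Vector_Spaces.linear scale_sf (*) (B F)) \<and>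
     (\<forall>\<nu>\<in>partitions. \<forall>\<mu>\<in>partitions. B (schur_sf \<nu>) (schur_sf \<mu>) = (if \<nu> = \<mu> then 1 else (0 :: 'k)))"
  have linI: "Vector_Spaces.linear scale_sf (*) g"
    if "\<And>F G. g (F + G) = g F + g G" "\<And>c F. g (const_sf c * F) = c * g F" for g :: "'k symfun \<Rightarrow> 'k"
    by unfold_locales (simp_all add: that scale_sf_def distrib_left distrib_right mult.assoc)
  have Bl: "Vector_Spaces.linear scale_sf (*) (\<lambda>F. B F G)" for G
  proof (rule linI)
    have add: "B (F + F') = (\<lambda>G. B F G + B F' G)" for F F'
      by (rule basis_eq[OF B(1)])
        (auto intro!: linI simp: linear_functionalD[OF B(1)] B(2) linear_functionalD[OF co(1)] distrib_left mult.left_commute)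
    then show "B (F + F') G = B F G + B F' G" for F F' by simp
    have sc: "B (const_sf c * F) = (\<lambda>G. c * B F G)" for c F
      by (rule basis_eq[OF B(1)])
        (auto intro!: linI simp: linear_functionalD[OF B(1)] B(2) linear_functionalD[OF co(1)] distrib_left mult.left_commute)
    then show "B (const_sf c * F) G = c * B F G" for c F by simp
  qed
  have par: "\<exists>K. 0 \<notin># K \<and> \<nu> = plist K" if "\<nu> \<in> partitions" for \<nu>
    using plist_mset[OF that] partitions_pos[OF that] by metis
  have pl: "plist K = plist L \<longleftrightarrow> K = L" for K L by (metis mset_plist)
  have Q: "?Q B" using Bl B co par by (auto simp: pl dest!: par)
  have uniq: "B' = B" if Q': "?Q B'" for B'
  proof
    fix F
    have "(\<lambda>F. B' F (?s K)) = (\<lambda>F. B F (?s K))" if K: "0 \<notin># K" for K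
    proof (rule basis_eq)
      fix L :: "nat multiset" assume L: "0 \<notin># L"
      show "B' (?s L) (?s K) = B (?s L) (?s K)"
        using Q' Q plist_in_partitions[OF K] plist_in_partitions[OF L] by metis
    qed (use Q Q' in blast)+
    then have "B' F (?s K) = B F (?s K)" if "0 \<notin># K" for K using that by metis
    then show "B' F = B F" by (intro basis_eq) (use Q Q' in blast)+
  qed
  have "hall_inner = B" unfolding hall_inner_def by (rule the_equality[where P = ?Q, OF Q uniq])
  moreover have "co N = f" by (rule basis_eq[OF co(1) f(1)]) (simp add: co(2) f(3))
  ultimately show ?thesis using B(2)[OF f(2)] by simp
qed

text \<open>Evaluation at the single variable \<open>x\<^sub>0 = 1\<close>.\<close>

definition ev1 :: "'k::field_char_0 symfun \<Rightarrow> 'k" where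
  "ev1 = sf_lift (\<lambda>c. c) (\<lambda>_. 1)"

lemma sf_hom_ev1: "sf_hom (\<lambda>c. c) ev1"
  unfolding ev1_def by (rule sf_lift) (unfold_locales, auto)

interpretation ev1: comm_ring_hom ev1
  by (rule sf_homD(1)[OF sf_hom_ev1])

lemma ev1_const: "ev1 (const_sf c) = c"
  by (rule sf_homD(2)[OF sf_hom_ev1])

lemma ev1_power_sf: "k \<ge> 1 \<Longrightarrow> ev1 (power_sf k) = 1"
  unfolding ev1_def by (rule sf_lift) (unfold_locales, auto)

lemma linear_ev1: "Vector_Spaces.linear scale_sf (*) ev1"
  by unfold_locales (simp_all add: ev1.hom_add ev1.hom_mult ev1_const scale_sf_def distrib_left distrib_right)

lemma newton_unique_field: "newton P F \<Longrightarrow> newton P G \<Longrightarrow> F = (G :: 'k::field_char_0 fps)"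
  by (rule newton_unique[of P]) auto

lemma ev1_complete_sf: "ev1 (complete_sf n) = (1 :: 'k::field_char_0)"
proof -
  have "newton (\<lambda>k. ev1 (power_sf k)) (Abs_fps (\<lambda>n. ev1 (complete_sf n) :: 'k))"
    using newton_hom[OF sf_homD(1)[OF sf_hom_ev1] newton_complete_sf] by simp
  then have "newton (\<lambda>k. 1 ^ k) (Abs_fps (\<lambda>n. ev1 (complete_sf n) :: 'k))"
    by (rule newton_cong) (simp add: ev1_power_sf)
  then have "Abs_fps (\<lambda>n. ev1 (complete_sf n) :: 'k) = Abs_fps (\<lambda>n. 1 ^ n)"
    by (rule newton_unique_field[OF _ newton_geometric])
  then show ?thesis by (simp add: fps_eq_iff)
qed

text \<open>In one variable every h_k becomes 1. If there are two rows, the first two rows of the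
  Jacobi-Trudi matrix consist of ones, as no index in them is negative.\<close>

lemma ev1_schur:
  assumes "0 \<notin># K"
  shows "ev1 (schur_sf (plist K) :: 'k::field_char_0 symfun) = (if size K \<le> 1 then 1 else 0)"
proof -
  let ?\<nu> = "plist K"
  let ?n = "length ?\<nu>"
  have n: "?n = size K" by (metis mset_plist size_mset)
  have pos: "?\<nu> ! i \<ge> 1" if "i < ?n" for i using assms that by (metis One_nat_def Suc_leI gr0I nth_mem set_plist)
  let ?A = "mat ?n ?n (\<lambda>(i, j). if i \<le> ?\<nu> ! i + j then 1 else 0) :: 'k mat"
  have "ev1 (schur_sf ?\<nu>) = det ?A"
    unfolding schur_sf_def ev1.hom_det[symmetric]
    by (intro arg_cong[of _ _ det] eq_matI) (auto simp: ev1_complete_sf)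
  also have "\<dots> = (if size K \<le> 1 then 1 else 0)"
  proof (cases "?n \<le> 1")
    case True
    then consider "?n = 0" | "?n = 1" by linarith
    then show ?thesis
    proof cases
      case 1
      then show ?thesis using n by simp
    next
      case 2
      then have "det ?A = ?A $$ (0, 0)" by (intro det_single) auto
      then show ?thesis using 2 n by simp
    qed
  next
    case False
    have "0 < ?n" "1 < ?n" using False by auto
    then have "row ?A 0 = row ?A 1" using pos[of 1] by (intro eq_vecI) (auto simp: row_def)
    then have "det ?A = 0" using False by (intro det_identical_rows[of ?A ?n 0 1]) auto
    then show ?thesis using False n by simp
  qed
  finally show ?thesis .
qed

text \<open>In degree n evaluation in one variable kills every Schur function except s_(n), so it
  coincides with the coordinate at s_(n).\<close>

lemma hall_inner_one_row:
  fixes F :: "'k::field_char_0 symfun"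
  assumes "homogeneous_sf n F"
  shows "hall_inner F (schur_sf (if n = 0 then [] else [n])) = ev1 F"
proof -
  define N :: "nat multiset" where "N = (if n = 0 then {#} else {#n#})"
  have N: "0 \<notin># N" "plist N = (if n = 0 then [] else [n])" by (auto simp: N_def plist_def)
  let ?B = "(\<lambda>K. schur_sf (plist K)) ` pos_msets :: 'k symfun set"
  have inj: "inj_on (\<lambda>K. schur_sf (plist K) :: 'k symfun) pos_msets" by (rule sf_indep_inj[OF schur_indep])
  obtain f where f: "Vector_Spaces.linear scale_sf (*) f"
    "\<forall>x\<in>?B. f x = (if the_inv_into pos_msets (\<lambda>K. schur_sf (plist K)) x = N then 1 else (0 :: 'k))"
    using ex_linear_functional[OF sf_indep_independent[OF schur_indep],
        of "\<lambda>x. if the_inv_into pos_msets (\<lambda>K. schur_sf (plist K)) x = N then 1 else 0"] by blast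
  have fs: "f (schur_sf (plist K)) = (if K = N then 1 else 0)" if "0 \<notin># K" for K
    using f(2) the_inv_into_f_f[OF inj, of K] that by auto
  have "hall_inner F (schur_sf (plist N)) = f F" by (rule hall_inner_schur[OF f(1) N(1) fs])
  also have "\<dots> = ev1 F"
  proof (rule linear_functional_eq[OF f(1) linear_ev1 _ homogeneous_in_span_schur[OF assms]])
    fix x :: "'k symfun" assume "x \<in> (\<lambda>K. schur_sf (plist K)) ` {L \<in> pos_msets. sum_mset L = n}"
    then obtain K where K: "x = schur_sf (plist K)" "0 \<notin># K" "sum_mset K = n" by auto
    have "size K \<le> 1 \<longleftrightarrow> K = N"
    proof
      assume "size K \<le> 1"
      then have "K = {#} \<or> (\<exists>k. K = {#k#})" by (metis One_nat_def le_Suc_eq le_zero_eq size_1_singleton_mset size_eq_0_iff_empty)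
      then show "K = N" using K by (auto simp: N_def)
    qed (auto simp: N_def)
    then show "f x = ev1 x" unfolding K(1) fs[OF K(2)] ev1_schur[OF K(2)] by simp
  qed
  finally show ?thesis using N(2) by simp
qed

subsection \<open>Cells of partitions\<close>

text \<open>\<open>B_poly\<close> over an arbitrary ring, so that it can be compared at (q, t), at t
  = 1, at t = 1/q and with q and t exchanged.\<close>

definition cell_sum :: "'a::comm_ring_1 \<Rightarrow> 'a \<Rightarrow> nat list \<Rightarrow> 'a" where
  "cell_sum a b \<nu> = (\<Sum>(i, j)\<in>cells \<nu>. a ^ j * b ^ i)"

lemma cells_Nil [simp]: "cells [] = {}"
  by (simp add: cells_def)

lemma cells_Cons: "cells (r # \<nu>) = Pair 0 ` {..<r} \<union> (\<lambda>(i, j). (Suc i, j)) ` cells \<nu>"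
proof (rule Set.set_eqI)
  fix c show "c \<in> cells (r # \<nu>) \<longleftrightarrow> c \<in> Pair 0 ` {..<r} \<union> (\<lambda>(i, j). (Suc i, j)) ` cells \<nu>"
    by (cases c; cases "fst c") (auto simp: cells_def image_iff)
qed

lemma finite_cells [simp]: "finite (cells \<nu>)"
  by (induction \<nu>) (auto simp: cells_Cons)

lemma sum_cells_Cons: "(\<Sum>c\<in>cells (r # \<nu>). f c) = (\<Sum>j<r. f (0, j)) + (\<Sum>(i, j)\<in>cells \<nu>. f (Suc i, j))"
proof -
  have inj: "inj_on (\<lambda>(i, j). (Suc i, j)) (cells \<nu>)" by (auto simp: inj_on_def)
  have "(\<Sum>c\<in>cells (r # \<nu>). f c) = sum f (Pair 0 ` {..<r}) + sum f ((\<lambda>(i, j). (Suc i, j)) ` cells \<nu>)"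
    unfolding cells_Cons by (rule sum.union_disjoint) auto
  then show ?thesis unfolding sum.reindex[OF inj]
    by (simp add: sum.reindex inj_on_def case_prod_unfold comp_def)
qed

lemma card_cells: "card (cells \<nu>) = sum_list \<nu>"
proof (induction \<nu>)
  case (Cons r \<nu>)
  then show ?case using sum_cells_Cons[of "\<lambda>_. 1 :: nat" r \<nu>] by (simp add: case_prod_unfold)
qed simp

lemma cell_sum_Cons: "cell_sum a b (r # \<nu>) = (\<Sum>j<r. a ^ j) + b * cell_sum a b \<nu>"
  by (simp add: cell_sum_def sum_cells_Cons sum_distrib_left case_prod_unfold mult_ac)

lemma length_filter_less_iff:
  assumes "sorted_wrt (\<ge>) \<nu>"
  shows "i < length (filter (\<lambda>r. j < r) \<nu>) \<longleftrightarrow> i < length \<nu> \<and> j < (\<nu> ! i :: nat)"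
  using assms
proof (induction \<nu> arbitrary: i)
  case (Cons x \<nu>)
  show ?case
  proof (cases "j < x")
    case True
    then show ?thesis using Cons by (cases i) auto
  next
    case False
    then have "\<not> j < r" if "r \<in> set (x # \<nu>)" for r using Cons.prems that by auto
    then have "filter (\<lambda>r. j < r) (x # \<nu>) = []" "i < length (x # \<nu>) \<longrightarrow> \<not> j < (x # \<nu>) ! i"
      unfolding filter_empty_conv using nth_mem[of i "x # \<nu>"] by blast+
    then show ?thesis by (metis list.size(3) not_less_zero)
  qed
qed simp

lemma partitionD:
  assumes "\<nu> \<in> partitions_of n"
  shows "sorted_wrt (\<ge>) \<nu>" "0 \<notin> set \<nu>" "sum_list \<nu> = n" "i < length \<nu> \<Longrightarrow> \<nu> ! i > 0"
  using assms by (auto simp: partitions_of_def) (metis gr0I nth_mem)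

lemma length_conjugate: "length (conjugate \<nu>) = (case \<nu> of [] \<Rightarrow> 0 | r # _ \<Rightarrow> r)"
  by (simp add: conjugate_def)

lemma nth_conjugate: "j < length (conjugate \<nu>) \<Longrightarrow> conjugate \<nu> ! j = length (filter (\<lambda>r. j < r) \<nu>)"
  unfolding length_conjugate by (simp add: conjugate_def)

lemma cells_conjugate:
  assumes "\<nu> \<in> partitions_of n"
  shows "cells (conjugate \<nu>) = prod.swap ` cells \<nu>"
proof (rule Set.set_eqI)
  fix c :: "nat \<times> nat"
  obtain j i where c: "c = (j, i)" by (cases c)
  have "i < length \<nu> \<and> j < \<nu> ! i \<Longrightarrow> j < length (conjugate \<nu>)"
  proof (cases \<nu>)
    case (Cons r \<nu>')
    moreover assume "i < length \<nu> \<and> j < \<nu> ! i"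
    ultimately have "\<nu> ! i \<le> r" "j < \<nu> ! i" using partitionD(1)[OF assms] by (cases i; auto)+
    then show ?thesis using Cons by (simp add: length_conjugate)
  qed simp
  then have "(j, i) \<in> cells (conjugate \<nu>) \<longleftrightarrow> (i, j) \<in> cells \<nu>"
    unfolding cells_def using length_filter_less_iff[OF partitionD(1)[OF assms]]
    by (auto simp: nth_conjugate)
  then show "c \<in> cells (conjugate \<nu>) \<longleftrightarrow> c \<in> prod.swap ` cells \<nu>" using c by force
qed

lemma cell_sum_conjugate:
  assumes "\<nu> \<in> partitions_of n"
  shows "cell_sum b a (conjugate \<nu>) = cell_sum a b \<nu>"
proof -
  have inj: "inj_on prod.swap (cells \<nu>)" by (auto simp: inj_on_def)
  show ?thesis unfolding cell_sum_def cells_conjugate[OF assms] sum.reindex[OF inj]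
    by (intro sum.cong refl) (simp add: case_prod_unfold mult.commute)
qed

lemma conjugate_partition:
  assumes "\<nu> \<in> partitions_of n"
  shows "conjugate \<nu> \<in> partitions_of n"
proof -
  have "sum_list (conjugate \<nu>) = n"
    unfolding card_cells[symmetric] cells_conjugate[OF assms] using card_cells[of \<nu>] partitionD(3)[OF assms]
    by (simp add: card_image)
  moreover have "sorted_wrt (\<ge>) (conjugate \<nu>)"
    unfolding sorted_wrt_iff_nth_less
  proof (intro allI impI)
    fix i j assume ij: "i < j" "j < length (conjugate \<nu>)"
    have "length (filter (\<lambda>r. j < r) \<nu>) \<le> length (filter (\<lambda>r. i < r) \<nu>)"
      using ij(1) by (induction \<nu>) auto
    then show "conjugate \<nu> ! j \<le> conjugate \<nu> ! i" using ij by (simp add: nth_conjugate)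
  qed
  moreover have "0 \<notin> set (conjugate \<nu>)"
  proof
    assume "0 \<in> set (conjugate \<nu>)"
    then obtain j where j: "j < length (conjugate \<nu>)" "conjugate \<nu> ! j = 0" by (metis in_set_conv_nth)
    then obtain r \<nu>' where r: "\<nu> = r # \<nu>'" "j < r" by (cases \<nu>) (auto simp: length_conjugate)
    then show False using j(2) nth_conjugate[OF j(1)] by simp
  qed
  ultimately show ?thesis by (simp add: partitions_of_def)
qed

lemma partition_eq_if_cells_eq:
  assumes \<mu>: "\<mu> \<in> partitions_of m" and \<nu>: "\<nu> \<in> partitions_of n" and eq: "cells \<mu> = cells \<nu>"
  shows "\<mu> = \<nu>"
proof (rule nth_equalityI)
  have len: "{i. (i, 0) \<in> cells \<kappa>} = {..<length \<kappa>}" if "\<kappa> \<in> partitions_of k" for \<kappa> k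
    using partitionD(4)[OF that] by (auto simp: cells_def)
  show l: "length \<mu> = length \<nu>" using len[OF \<mu>] len[OF \<nu>] eq by (metis card_lessThan)
  fix i assume i: "i < length \<mu>"
  have "{j. (i, j) \<in> cells \<kappa>} = {..<\<kappa> ! i}" if "i < length \<kappa>" for \<kappa>
    using that by (auto simp: cells_def)
  then show "\<mu> ! i = \<nu> ! i" using i l eq by (metis card_lessThan)
qed

section \<open>Dominance and conjugation\<close>

lemma sum_take_le: "sum_list (take k \<nu>) \<le> k * m + sum_list (map (\<lambda>r. r - m) \<nu>)" for m :: nat
proof (induction \<nu> arbitrary: k)
  case (Cons x \<nu>)
  show ?case
  proof (cases k)
    case (Suc k')
    then show ?thesis using Cons.IH[of k'] by simp
  qed simp
qed simp

text \<open>The parts above m come first, and each is m plus its excess over m. Together with the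
  upper bound for all k this expresses dominance through sums of excesses, which are counts of cells
  in columns.\<close>

lemma sum_take_eq:
  fixes m :: nat
  assumes "sorted_wrt (\<ge>) \<nu>"
  defines "k \<equiv> length (filter (\<lambda>r. m < r) \<nu>)"
  shows "sum_list (take k \<nu>) = k * m + sum_list (map (\<lambda>r. r - m) (\<nu> :: nat list))"
  using assms(1) unfolding k_def
proof (induction \<nu>)
  case (Cons x \<nu>)
  show ?case
  proof (cases "m < x")
    case True
    then show ?thesis using Cons by simp
  next
    case False
    then have *: "\<forall>r\<in>set (x # \<nu>). r \<le> m" using Cons.prems by auto
    then have "filter (\<lambda>r. m < r) (x # \<nu>) = []" by (auto simp: filter_empty_conv)
    moreover have "sum_list (map (\<lambda>r. r - m) (x # \<nu>)) = 0" using * by (auto simp: sum_list_eq_0_iff)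
    ultimately show ?thesis by simp
  qed
qed simp

text \<open>The first m columns contain \<open>min r m\<close> cells of a row \<open>r\<close>; the
  excesses over m count the rest.\<close>

lemma sum_take_conjugate:
  assumes "\<nu> \<in> partitions_of n"
  shows "sum_list (take m (conjugate \<nu>)) + sum_list (map (\<lambda>r. r - m) \<nu>) = n"
proof -
  let ?l = "length (conjugate \<nu>)"
  let ?f = "\<lambda>j. length (filter (\<lambda>r. j < r) \<nu>)"
  have "sum_list (take m (conjugate \<nu>)) = (\<Sum>j<min m ?l. conjugate \<nu> ! j)"
    by (simp add: sum_list_sum_nth atLeast0LessThan min.commute)
  also have "\<dots> = (\<Sum>j<min m ?l. ?f j)" by (intro sum.cong) (auto simp: nth_conjugate)
  also have "\<dots> = (\<Sum>j<m. ?f j)"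
  proof (rule sum.mono_neutral_left)
    show "\<forall>j\<in>{..<m} - {..<min m ?l}. ?f j = 0"
    proof
      fix j assume "j \<in> {..<m} - {..<min m ?l}"
      then have "?l \<le> j" by auto
      then show "?f j = 0"
        using partitionD(1)[OF assms] by (cases \<nu>) (auto simp: length_conjugate filter_empty_conv)
    qed
  qed auto
  also have "\<dots> = sum_list (map (\<lambda>r. min r m) \<nu>)"
  proof (induction \<nu>)
    case (Cons x \<nu>)
    have "(\<Sum>j<m. length (filter (\<lambda>r. j < r) (x # \<nu>))) = (\<Sum>j<m. (if j < x then 1 else 0) + length (filter (\<lambda>r. j < r) \<nu>))"
      by (intro sum.cong) auto
    also have "\<dots> = card ({..<m} \<inter> {j. j < x}) + (\<Sum>j<m. length (filter (\<lambda>r. j < r) \<nu>))"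
      by (simp add: sum.distrib sum.If_cases)
    also have "{..<m} \<inter> {j. j < x} = {..<min x m}" by auto
    finally show ?case using Cons.IH by simp
  qed simp
  finally have "sum_list (take m (conjugate \<nu>)) + sum_list (map (\<lambda>r. r - m) \<nu>)
      = sum_list (map (\<lambda>r. min r m + (r - m)) \<nu>)" by (simp add: sum_list_addf)
  also have "(\<lambda>r. min r m + (r - m)) = (\<lambda>r. r)" by auto
  finally show ?thesis using partitionD(3)[OF assms] by simp
qed

text \<open>Dominance of rows bounds the sums of the first columns in the opposite direction,
  through the excesses over m. With the second hypothesis all these sums agree.\<close>

lemma dominates_conjugate_antisym:
  assumes l: "l \<in> partitions_of n" and \<mu>: "\<mu> \<in> partitions_of n"
    and dom: "dominates l \<mu>" "dominates (conjugate l) (conjugate \<mu>)"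
  shows "l = \<mu>"
proof -
  have eq: "sum_list (take m (conjugate l)) = sum_list (take m (conjugate \<mu>))" for m
  proof (rule antisym)
    show "sum_list (take m (conjugate \<mu>)) \<le> sum_list (take m (conjugate l))"
      using dom(2) by (simp add: dominates_def)
    let ?k = "length (filter (\<lambda>r. m < r) \<mu>)"
    have "?k * m + sum_list (map (\<lambda>r. r - m) \<mu>) = sum_list (take ?k \<mu>)"
      using sum_take_eq[OF partitionD(1)[OF \<mu>]] by simp
    also have "\<dots> \<le> sum_list (take ?k l)" using dom(1) by (simp add: dominates_def)
    also have "\<dots> \<le> ?k * m + sum_list (map (\<lambda>r. r - m) l)" by (rule sum_take_le)
    finally show "sum_list (take m (conjugate l)) \<le> sum_list (take m (conjugate \<mu>))"
      using sum_take_conjugate[OF l, of m] sum_take_conjugate[OF \<mu>, of m] by linarith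
  qed
  have "conjugate l = conjugate \<mu>"
    using eq conjugate_partition[OF l] conjugate_partition[OF \<mu>]
    by (intro take_sums_eq_imp_eq) (auto dest: partitionD(2))
  then have "prod.swap ` cells l = prod.swap ` cells \<mu>"
    using cells_conjugate[OF l] cells_conjugate[OF \<mu>] by simp
  then have "cells l = cells \<mu>" by (simp add: inj_image_eq_iff)
  then show ?thesis by (rule partition_eq_if_cells_eq[OF l \<mu>])
qed

text \<open>Both sides satisfy the same recursion in the first row, since 1 - a times the geometric
  sum of a row of length r is 1 - a^r.\<close>

lemma beta_eq_cell_sum: "beta a b \<nu> = 1 - (1 - a) * (1 - b) * cell_sum a b \<nu>"
proof (induction \<nu>)
  case (Cons r \<nu>)
  have geo: "(1 - a) * (\<Sum>j<r. a ^ j) = 1 - a ^ r"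
  proof (induction r)
    case (Suc r)
    show ?case by (simp only: sum.lessThan_Suc distrib_left Suc.IH) (simp add: algebra_simps)
  qed simp
  define x where "x = (1 - a) * (1 - b) * cell_sum a b \<nu>"
  have "(1 - a) * (1 - b) * cell_sum a b (r # \<nu>) = (1 - b) * ((1 - a) * (\<Sum>j<r. a ^ j)) + b * x"
    unfolding cell_sum_Cons x_def by (simp only: distrib_left) (simp only: mult_ac)
  then show ?case unfolding geo beta.simps Cons.IH x_def[symmetric] by (simp add: algebra_simps)
qed (simp add: cell_sum_def)

text \<open>Contents and columns: the partition is recovered from the exponents at \<open>t = 1/q\<close> and at \<open>t = 1\<close>.\<close>

lemma sum_powers_q_gen_eq:
  assumes "(\<Sum>c\<in>C. q_gen ^ f c) = (\<Sum>c\<in>C'. q_gen ^ f c)" "finite C" "finite C'"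
  shows "card {c \<in> C. f c = d} = card {c \<in> C'. f c = d}"
proof -
  have pw: "q_gen ^ k = to_fract (monom 1 k)" for k
    by (induction k) (simp_all add: q_gen_def monom_0 monom_Suc one_pCons[symmetric] flip: to_fract_mult)
  have sm: "(\<Sum>c\<in>C. q_gen ^ f c) = to_fract (\<Sum>c\<in>C. monom 1 (f c))" if "finite C" for C
    using that by (induction C) (simp_all add: pw)
  have "(\<Sum>c\<in>C. monom 1 (f c)) = (\<Sum>c\<in>C'. monom (1 :: rat) (f c))"
    using assms(1) unfolding sm[OF assms(2)] sm[OF assms(3)] by (simp only: to_fract_eq_iff)
  then have "poly.coeff (\<Sum>c\<in>C. monom 1 (f c)) d = poly.coeff (\<Sum>c\<in>C'. monom (1 :: rat) (f c)) d" by simp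
  then have "(\<Sum>c\<in>C. if f c = d then 1 else 0) = (\<Sum>c\<in>C'. if f c = d then 1 else (0 :: rat))"
    by (simp add: coeff_sum)
  then show ?thesis using assms(2,3) by (simp add: sum.If_cases Int_def)
qed

lemma q_gen_nonzero: "q_gen \<noteq> 0"
  by (simp add: q_gen_def)

lemma q_gen_power_neq_1: "k \<ge> 1 \<Longrightarrow> q_gen ^ k \<noteq> 1"
proof
  assume "k \<ge> 1" "q_gen ^ k = 1"
  \<comment> \<open>The exponents k and 0 are compared as two families with a single index each,
    taken from \<open>bool\<close>.\<close>
  have "card {c \<in> {True}. (if c then k else 0) = k} = card {c \<in> {False}. (if c then k else 0) = k}"
    by (rule sum_powers_q_gen_eq) (simp_all add: \<open>q_gen ^ k = 1\<close>)
  moreover have "{c \<in> {True}. (if c then k else 0) = k} = {True}" "{c \<in> {False}. (if c then k else 0) = k} = {}"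
    using \<open>k \<ge> 1\<close> by auto
  ultimately have "card {True} = card ({} :: bool set)" by (simp only:)
  then show False by simp
qed

text \<open>At t = 1 a cell contributes q to the power of its column, so the heights of the columns
  can be read off.\<close>

lemma cell_sum_q_1_inject:
  assumes \<mu>: "\<mu> \<in> partitions_of m" and \<nu>: "\<nu> \<in> partitions_of n"
    and eq: "cell_sum q_gen 1 \<mu> = cell_sum q_gen 1 \<nu>"
  shows "\<mu> = \<nu>"
proof (rule partition_eq_if_cells_eq[OF \<mu> \<nu>])
  have "card {c \<in> cells \<mu>. snd c = d} = card {c \<in> cells \<nu>. snd c = d}" for d
    by (rule sum_powers_q_gen_eq) (use eq in \<open>simp_all add: cell_sum_def case_prod_unfold\<close>)
  moreover have "(i, d) \<in> cells \<kappa> \<longleftrightarrow> i < card {c \<in> cells \<kappa>. snd c = d}" if \<kappa>: "\<kappa> \<in> partitions_of k" for \<kappa> k i d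
  proof -
    have "{c \<in> cells \<kappa>. snd c = d} = (\<lambda>i. (i, d)) ` {..<length (filter (\<lambda>r. d < r) \<kappa>)}"
      unfolding cells_def using length_filter_less_iff[OF partitionD(1)[OF \<kappa>]] by auto
    then have "card {c \<in> cells \<kappa>. snd c = d} = length (filter (\<lambda>r. d < r) \<kappa>)"
      by (simp add: card_image inj_on_def)
    then show ?thesis unfolding cells_def using length_filter_less_iff[OF partitionD(1)[OF \<kappa>]] by auto
  qed
  ultimately show "cells \<mu> = cells \<nu>" using \<mu> \<nu> by auto
qed

text \<open>The cells of a given content j - i form an initial segment of their diagonal, since a
  partition contains with a cell also its predecessors on the diagonal. So their number decides
  membership, \<open>min i j\<close> being the position on the diagonal. The summand n keeps the
  subtraction in the natural numbers exact.\<close>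

lemma cells_diagonal:
  assumes \<kappa>: "\<kappa> \<in> partitions_of n" and i: "i \<le> n"
  shows "(i, j) \<in> cells \<kappa> \<longleftrightarrow> min i j < card {c \<in> cells \<kappa>. n + snd c - fst c = n + j - i}"
proof -
  define D where "D = {c \<in> cells \<kappa>. n + snd c - fst c = n + j - i}"
  define mn where "mn c = min (fst c) (snd c)" for c :: "nat \<times> nat"
  have len: "length \<kappa> \<le> n"
  proof -
    have "length \<kappa> \<le> sum_list \<kappa>" using partitionD(2)[OF \<kappa>] by (induction \<kappa>) auto
    then show ?thesis using partitionD(3)[OF \<kappa>] by simp
  qed
  have D_iff: "c \<in> D \<longleftrightarrow> c \<in> cells \<kappa> \<and> snd c + i = j + fst c" for c
  proof -
    have "fst c \<le> n" if "c \<in> cells \<kappa>" using that len by (cases c) (auto simp: cells_def)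
    then show ?thesis unfolding D_def using i by auto
  qed
  have fin: "finite D" by (simp add: D_def)
  have down: "(i', j') \<in> cells \<kappa>" if "(i' + d, j' + d) \<in> cells \<kappa>" for i' j' d
  proof -
    have "\<kappa> ! (i' + d) \<le> \<kappa> ! i'"
      using that partitionD(1)[OF \<kappa>] by (cases "d = 0") (auto simp: cells_def sorted_wrt_iff_nth_less)
    then show ?thesis using that by (auto simp: cells_def)
  qed
  have inj: "inj_on mn D"
  proof (rule inj_onI)
    fix x y assume "x \<in> D" "y \<in> D" "mn x = mn y"
    then show "x = y" unfolding D_iff mn_def by (auto simp: min_def prod_eq_iff split: if_splits)
  qed
  have img: "mn ` D = {..<card (mn ` D)}"
  proof -
    have closed: "y \<in> mn ` D" if xD: "x \<in> mn ` D" and yx: "y \<le> x" for x y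
    proof -
      obtain c where c: "c \<in> D" "x = mn c" using xD by blast
      define d where "d = x - y"
      have "(fst c - d + d, snd c - d + d) \<in> cells \<kappa>" using c(1) yx unfolding D_iff by (simp add: d_def c(2) mn_def min_def)
      then have "(fst c - d, snd c - d) \<in> cells \<kappa>" by (rule down)
      moreover have "snd c - d + i = j + (fst c - d)" using c yx unfolding D_iff by (auto simp: d_def mn_def min_def)
      ultimately have "(fst c - d, snd c - d) \<in> D" unfolding D_iff by simp
      moreover have "y = mn (fst c - d, snd c - d)" using c(2) yx by (auto simp: d_def mn_def min_def)
      ultimately show ?thesis by blast
    qed
    have fin: "finite (mn ` D)" using fin by simp
    show ?thesis
    proof (cases "mn ` D = {}")
      case False
      let ?M = "Max (mn ` D)"
      have "mn ` D = {..?M}" using closed[OF Max_in[OF fin False]] Max_ge[OF fin] by blast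
      then have "card (mn ` D) = Suc ?M" by (metis card_atMost)
      then show ?thesis using \<open>mn ` D = {..?M}\<close> by (simp only: lessThan_Suc_atMost)
    qed simp
  qed
  have "(i, j) \<in> cells \<kappa> \<longleftrightarrow> min i j \<in> mn ` D"
  proof
    assume "(i, j) \<in> cells \<kappa>"
    then have "(i, j) \<in> D" unfolding D_iff by simp
    then show "min i j \<in> mn ` D" by (intro image_eqI[of _ _ "(i, j)"]) (simp_all add: mn_def)
  next
    assume "min i j \<in> mn ` D"
    then obtain c where c: "c \<in> D" "min i j = mn c" by blast
    then have "c = (i, j)" unfolding D_iff mn_def by (auto simp: min_def prod_eq_iff split: if_splits)
    then show "(i, j) \<in> cells \<kappa>" using c(1) unfolding D_iff by simp
  qed
  also have "\<dots> \<longleftrightarrow> min i j < card (mn ` D)" by (subst img) simp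
  also have "card (mn ` D) = card D" by (rule card_image[OF inj])
  finally show ?thesis unfolding D_def .
qed

lemma cell_sum_q_inverse_inject:
  assumes \<mu>: "\<mu> \<in> partitions_of n" and \<nu>: "\<nu> \<in> partitions_of n"
    and eq: "cell_sum q_gen (1 / q_gen) \<mu> = cell_sum q_gen (1 / q_gen) \<nu>"
  shows "\<mu> = \<nu>"
proof (rule partition_eq_if_cells_eq[OF \<mu> \<nu>])
  have len: "i \<le> n" if "(i, j) \<in> cells \<kappa>" "\<kappa> \<in> partitions_of n" for i j \<kappa>
  proof -
    have "length \<kappa> \<le> sum_list \<kappa>" using partitionD(2)[OF that(2)] by (induction \<kappa>) auto
    then show ?thesis using partitionD(3)[OF that(2)] that(1) by (auto simp: cells_def)
  qed
  \<comment> \<open>Multiplication by q^n clears all negative powers, as no row index exceeds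
    n.\<close>
  have pow: "q_gen ^ n * (q_gen ^ j * (1 / q_gen) ^ i) = q_gen ^ (n + j - i)" if "i \<le> n" for i j
    using that q_gen_nonzero by (simp add: power_diff power_add power_divide)
  have "q_gen ^ n * cell_sum q_gen (1 / q_gen) \<kappa> = (\<Sum>c\<in>cells \<kappa>. q_gen ^ (n + snd c - fst c))"
    if "\<kappa> \<in> partitions_of n" for \<kappa>
    unfolding cell_sum_def sum_distrib_left
    by (intro sum.cong) (use len[OF _ that] pow in \<open>auto simp: case_prod_unfold\<close>)
  then have "(\<Sum>c\<in>cells \<mu>. q_gen ^ (n + snd c - fst c)) = (\<Sum>c\<in>cells \<nu>. q_gen ^ (n + snd c - fst c))"
    using \<mu> \<nu> eq by metis
  from sum_powers_q_gen_eq[OF this]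
  have card: "card {c \<in> cells \<mu>. n + snd c - fst c = d} = card {c \<in> cells \<nu>. n + snd c - fst c = d}" for d by simp
  show "cells \<mu> = cells \<nu>"
  proof (rule Set.set_eqI)
    fix c :: "nat \<times> nat"
    obtain i j where c: "c = (i, j)" by (cases c)
    show "c \<in> cells \<mu> \<longleftrightarrow> c \<in> cells \<nu>"
    proof (cases "i \<le> n")
      case True
      then show ?thesis unfolding c cells_diagonal[OF \<mu> True] cells_diagonal[OF \<nu> True] card by simp
    next
      case False
      then show ?thesis using c len \<mu> \<nu> by blast
    qed
  qed
qed

subsection \<open>Eigenspaces\<close>

lemma homogeneous_zero: "homogeneous_sf n (0 :: 'k::comm_ring_1 symfun)"
  by (simp add: homogeneous_sf_def coeff_sf_simps)

lemma homogeneous_add: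
  fixes F G :: "'k::comm_ring_1 symfun"
  assumes "homogeneous_sf n F" "homogeneous_sf n G"
  shows "homogeneous_sf n (F + G)"
  unfolding homogeneous_sf_def
proof (intro allI impI)
  fix m assume "coeff_sf (F + G) m \<noteq> 0"
  then have "coeff_sf F m \<noteq> 0 \<or> coeff_sf G m \<noteq> 0" by (auto simp: coeff_sf_simps)
  then show "size m = n" using assms by (auto simp: homogeneous_sf_def)
qed

lemma homogeneous_scale:
  fixes F :: "'k::comm_ring_1 symfun"
  assumes "homogeneous_sf n F"
  shows "homogeneous_sf n (const_sf c * F)"
  using assms unfolding homogeneous_sf_def coeff_sf_const_times by (metis mult_zero_right)

lemma homogeneous_sum:
  "(\<And>i. i \<in> A \<Longrightarrow> homogeneous_sf n (f i :: 'k::comm_ring_1 symfun)) \<Longrightarrow> homogeneous_sf n (\<Sum>i\<in>A. f i)"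
  by (induction A rule: infinite_finite_induct) (auto simp: homogeneous_zero homogeneous_add)

lemma homogeneous_mult:
  fixes F G :: "'k::comm_ring_1 symfun"
  assumes "homogeneous_sf m F" "homogeneous_sf n G"
  shows "homogeneous_sf (m + n) (F * G)"
  unfolding homogeneous_sf_def times_symfun.rep_eq
proof (intro allI impI)
  fix u assume "(\<Sum>(a, b) | a + b = u. coeff_sf F a * coeff_sf G b) \<noteq> 0"
  then obtain p where "p \<in> {(a, b). a + b = u}" "(case p of (a, b) \<Rightarrow> coeff_sf F a * coeff_sf G b) \<noteq> 0"
    by (rule sum.not_neutral_contains_not_neutral)
  then obtain a b where ab: "a + b = u" "coeff_sf F a * coeff_sf G b \<noteq> 0" by auto
  then have "coeff_sf F a \<noteq> 0" "coeff_sf G b \<noteq> 0" by auto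
  then have "size a = m" "size b = n" using assms by (auto simp: homogeneous_sf_def)
  then show "size u = m + n" using ab(1) by auto
qed

lemma homogeneous_one: "homogeneous_sf 0 (1 :: 'k::comm_ring_1 symfun)"
  by (auto simp: homogeneous_sf_def coeff_sf_simps split: if_splits)

lemma homogeneous_power_sf: "homogeneous_sf n (power_sf n :: 'k::comm_ring_1 symfun)"
  by (auto simp: homogeneous_sf_def coeff_sf_simps split: if_splits)

lemma homogeneous_elem_sf: "homogeneous_sf n (elem_sf n :: 'k::comm_ring_1 symfun)"
  by (auto simp: homogeneous_sf_def coeff_sf_simps split: if_splits)

lemma homogeneous_eta: "homogeneous_sf n (fps_nth (eta a) n)"
proof (induction n rule: less_induct)
  case (less n)
  show ?case
  proof (cases "n = 0")
    case True
    then show ?thesis using newton_0[OF newton_eta] homogeneous_one by metis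
  next
    case False
    have "homogeneous_sf n (const_sf (1 / (1 - a ^ k)) * power_sf k * fps_nth (eta a) (n - k))"
      if "k \<in> {1..n}" for k
    proof -
      have "n = k + (n - k)" using that by simp
      then show ?thesis unfolding mult.assoc
        using homogeneous_scale homogeneous_mult[OF homogeneous_power_sf less, of "n - k" k] that False by auto
    qed
    then have "homogeneous_sf n (of_nat n * fps_nth (eta a) n)"
      unfolding newton_rec[OF newton_eta] by (rule homogeneous_sum)
    then have "homogeneous_sf n (const_sf (inverse (of_nat n)) * (const_sf (of_nat n) * fps_nth (eta a) n))"
      unfolding const_sf_of_nat by (rule homogeneous_scale)
    then show ?thesis using False by simp
  qed
qed

lemma homogeneous_mprod:
  assumes "\<And>n. homogeneous_sf n (x n :: 'k::comm_ring_1 symfun)"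
  shows "homogeneous_sf (sum_mset K) (mprod x K)"
  by (induction K) (auto simp: homogeneous_one intro: homogeneous_mult assms)

lemma homogeneous_span:
  fixes B :: "'k::field symfun set"
  assumes "\<And>F. F \<in> B \<Longrightarrow> homogeneous_sf n F" "F \<in> sf.span B"
  shows "homogeneous_sf n F"
  using assms(2) by (induction rule: sf.span_induct_alt)
    (auto simp: homogeneous_zero scale_sf_def intro: homogeneous_add homogeneous_scale assms(1))

lemma span_image_finite:
  assumes "finite A" "F \<in> sf.span (v ` A)"
  shows "\<exists>c. F = (\<Sum>i\<in>A. const_sf (c i :: 'k::field) * v i)"
  using assms(2)
proof (induction rule: sf.span_induct_alt)
  case base
  show ?case by (intro exI[of _ "\<lambda>_. 0"]) simp
next
  case (step d y F)
  then obtain j c where j: "j \<in> A" "y = v j" and c: "F = (\<Sum>i\<in>A. const_sf (c i) * v i)" by auto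
  have "(\<Sum>i\<in>A. const_sf ((if i = j then d else 0) + c i) * v i)
      = (\<Sum>i\<in>A. const_sf (if i = j then d else 0) * v i) + F"
    by (simp add: c const_sf_add distrib_right sum.distrib)
  also have "(\<Sum>i\<in>A. const_sf (if i = j then d else 0) * v i) = (\<Sum>i\<in>A. if i = j then const_sf d * v j else 0)"
    by (intro sum.cong) auto
  also have "\<dots> = const_sf d * v j" using assms(1) j(1) by simp
  finally show ?case using j(2) by (auto simp: scale_sf_def intro!: exI[of _ "\<lambda>i. (if i = j then d else 0) + c i"])
qed

lemma span_Int_indep:
  fixes v :: "'i \<Rightarrow> 'k::field symfun"
  assumes v: "sf_indep v I" and A: "finite A" "A \<subseteq> I" and B: "finite B" "B \<subseteq> I"
    and F: "F \<in> sf.span (v ` A)" "F \<in> sf.span (v ` B)"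
  shows "F \<in> sf.span (v ` (A \<inter> B))"
proof -
  obtain c where c: "F = (\<Sum>i\<in>A. const_sf (c i) * v i)" using span_image_finite[OF A(1) F(1)] by blast
  obtain d where d: "F = (\<Sum>i\<in>B. const_sf (d i) * v i)" using span_image_finite[OF B(1) F(2)] by blast
  have ext: "(\<Sum>i\<in>A \<union> B. const_sf (if i \<in> S then u i else 0) * v i) = (\<Sum>i\<in>S. const_sf (u i) * v i)"
    if "S \<subseteq> A \<union> B" for S u
    using A(1) B(1) that by (intro sum.mono_neutral_cong_right) auto
  have "(\<Sum>i\<in>A \<union> B. const_sf ((if i \<in> A then c i else 0) - (if i \<in> B then d i else 0)) * v i) = F - F"
    unfolding const_sf_diff left_diff_distrib sum_subtractf ext[OF Un_upper1] ext[OF Un_upper2] c[symmetric] d[symmetric] ..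
  then have zero: "(\<Sum>i\<in>A \<union> B. const_sf ((if i \<in> A then c i else 0) - (if i \<in> B then d i else 0)) * v i) = 0" by simp
  have "c i = 0" if "i \<in> A - B" for i
    using sf_indepD[OF v _ _ zero, of i] that A B by auto
  then have "F = (\<Sum>i\<in>A \<inter> B. const_sf (c i) * v i)"
    unfolding c by (intro sum.mono_neutral_right) (use A(1) in auto)
  also have "\<dots> \<in> sf.span (v ` (A \<inter> B))" unfolding scale_sf_def[symmetric]
    by (intro sf.span_sum sf.span_scale sf.span_base) auto
  finally show ?thesis .
qed

lemma span_scale_mem: "F \<in> sf.span B \<Longrightarrow> const_sf c * F \<in> sf.span B"
  using sf.span_scale[of F B c] by (simp add: scale_sf_def)

lemma hom_span:
  assumes "sf_hom const_sf \<phi>" "F \<in> sf.span B"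
  shows "\<phi> F \<in> sf.span (\<phi> ` B)"
proof -
  interpret comm_ring_hom \<phi> by (rule sf_homD(1)[OF assms(1)])
  show ?thesis using assms(2)
  proof (induction rule: sf.span_induct_alt)
    case base
    show ?case by (simp add: sf.span_zero)
  next
    case (step c y F)
    have "\<phi> y \<in> sf.span (\<phi> ` B)" using step(1) by (auto intro: sf.span_base)
    from sf.span_add[OF span_scale_mem[OF this, of c] step(2)] show ?case
      by (simp add: hom_add hom_mult sf_homD(2)[OF assms(1)] scale_sf_def[of c])
  qed
qed

context coeff_ring
begin

lemma homogeneous_x: "homogeneous_sf (sum_mset K) (x K)"
  by (rule homogeneous_mprod[OF homogeneous_eta])

lemma homogeneous_span_x:
  assumes "F \<in> sf.span (x ` A)" "\<And>K. K \<in> A \<Longrightarrow> sum_mset K = n"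
  shows "homogeneous_sf n F"
  by (rule homogeneous_span[OF _ assms(1)]) (use homogeneous_x assms(2) in auto)

text \<open>In one variable \<open>exp_neg\<close> becomes 1 - z, so \<open>eta_exp_neg\<close>
  reads (1 - z) eta(z) = eta(az).\<close>

lemma ev1_e_Suc: "(1 - a ^ Suc n) * ev1 (e (Suc n)) = ev1 (e n)"
proof -
  have "newton (\<lambda>k. (- 1) ^ (k - 1) * (- 1) ^ k) (1 + fps_const (- 1) * fps_X :: 'k fps)"
    by (rule newton_linear)
  then have 1: "newton (\<lambda>k. - 1) (1 + fps_const (- 1) * fps_X :: 'k fps)"
  proof (rule newton_cong)
    fix k :: nat assume "k \<ge> 1"
    from neg_one_power_times_neg_power[OF this, of 1] show "(- 1) ^ (k - 1) * (- 1) ^ k = (- 1 :: 'k)" by simp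
  qed
  have "newton (\<lambda>k. ev1 (- power_sf k)) (Abs_fps (\<lambda>n. ev1 (fps_nth exp_neg n) :: 'k))"
    by (rule newton_hom[OF sf_homD(1)[OF sf_hom_ev1] newton_exp_neg])
  then have "newton (\<lambda>k. - 1) (Abs_fps (\<lambda>n. ev1 (fps_nth exp_neg n) :: 'k))"
    by (rule newton_cong) (simp add: ev1.hom_uminus ev1_power_sf)
  then have "Abs_fps (\<lambda>n. ev1 (fps_nth exp_neg n)) = (1 + fps_const (- 1) * fps_X :: 'k fps)"
    using 1 by (rule newton_unique_field)
  then have E: "ev1 (fps_nth exp_neg k) = fps_nth (1 + fps_const (- 1) * fps_X :: 'k fps) k" for k
    by (metis fps_nth_Abs_fps)
  have "ev1 (fps_nth (eta a * exp_neg) (Suc n)) = ev1 (e (Suc n)) - ev1 (e n)"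
  proof -
    have "ev1 (fps_nth (eta a * exp_neg) (Suc n)) = fps_nth (Abs_fps (\<lambda>n. ev1 (e n)) * (1 + fps_const (- 1) * fps_X)) (Suc n)"
      by (simp only: fps_mult_nth ev1.hom_sum ev1.hom_mult E fps_nth_Abs_fps)
    also have "\<dots> = ev1 (e (Suc n)) - ev1 (e n)"
      by (simp add: distrib_left mult.left_commute[of _ "fps_const (- 1)"])
    finally show ?thesis .
  qed
  then have "a ^ Suc n * ev1 (e (Suc n)) = ev1 (e (Suc n)) - ev1 (e n)"
    unfolding eta_exp_neg[OF a_pow] by (simp add: ev1.hom_mult ev1_const)
  then show ?thesis by (simp add: algebra_simps)
qed

end

context eigen_ring
begin

lemma eigval_inject:
  assumes "0 \<notin># K" "0 \<notin># L" "sum_mset K = sum_mset L" "eigval K = eigval L"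
  shows "K = L"
  using units[OF assms(1-3)] assms(4) b_1 by fastforce

text \<open>Eigenvalues within one degree are distinct, so in an expansion in eigenvectors only the
  term at \<open>L\<close> is compatible with the eigenvalue of \<open>L\<close>.\<close>

lemma eigenspace:
  assumes L: "0 \<notin># L" and F: "homogeneous_sf (sum_mset L) F" "macD a b F = const_sf (eigval L) * F"
  shows "\<exists>c. F = const_sf c * evec L"
proof -
  let ?P = "{K \<in> pos_msets. sum_mset K = sum_mset L}"
  have fin: "finite ?P" by (rule finite_pos_msets)
  have "mprod power_sf ` ?P \<subseteq> sf.span (evec ` ?P)"
  proof clarify
    fix K assume "0 \<notin># K" "sum_mset K = sum_mset L"
    then show "mprod power_sf K \<in> sf.span (evec ` ?P)" using power_in_span_evec[of K] by simp
  qed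
  then have "F \<in> sf.span (evec ` ?P)" using homogeneous_span_power_sf[OF F(1)] span_subset_span by blast
  then obtain c where c: "F = (\<Sum>K\<in>?P. const_sf (c K) * evec K)" using span_image_finite[OF fin] by blast
  have macD_sum: "macD a b (\<Sum>K\<in>A. f K) = (\<Sum>K\<in>A. macD a b (f K))" for f :: "nat multiset \<Rightarrow> 'k symfun" and A
    by (induction A rule: infinite_finite_induct) (simp_all add: macD_eq_0 macD_add)
  have "macD a b F = (\<Sum>K\<in>?P. const_sf (c K) * (const_sf (eigval K) * evec K))"
    unfolding c macD_sum macD_scale by (intro sum.cong refl) (simp add: evec(2))
  moreover have "const_sf (eigval L) * F = (\<Sum>K\<in>?P. const_sf (c K) * (const_sf (eigval L) * evec K))"
    unfolding c sum_distrib_left by (simp only: mult.left_commute)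
  ultimately have "(\<Sum>K\<in>?P. const_sf (c K) * (const_sf (eigval K) * evec K))
      - (\<Sum>K\<in>?P. const_sf (c K) * (const_sf (eigval L) * evec K)) = 0" using F(2) by simp
  then have "(\<Sum>K\<in>?P. const_sf (c K * (eigval K - eigval L)) * evec K) = 0"
    by (simp add: sum_subtractf[symmetric] const_sf_mult const_sf_diff algebra_simps)
  moreover have "?P \<subseteq> pos_msets" by blast
  ultimately have "c K * (eigval K - eigval L) = 0" if "K \<in> ?P" for K
    using sf_indepD[OF evec_indep fin _ _ that, of "\<lambda>K. c K * (eigval K - eigval L)"] by blast
  then have cz: "c K = 0" if "K \<in> ?P" "K \<noteq> L" for K
    using that eigval_inject[OF _ L] by fastforce
  have "F = (\<Sum>K\<in>{L}. const_sf (c K) * evec K)"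
    unfolding c by (rule sum.mono_neutral_right) (use fin L cz in auto)
  then show ?thesis by auto
qed

lemma homogeneous_evec: "0 \<notin># L \<Longrightarrow> homogeneous_sf (sum_mset L) (evec L)"
  using evec_in_span by (rule homogeneous_span_x) (auto simp: dom_up_def)

lemma evec_nonzero: "0 \<notin># L \<Longrightarrow> evec L \<noteq> 0"
proof
  assume "0 \<notin># L" "evec L = 0"
  then have "(\<Sum>K\<in>{L}. const_sf 1 * evec K) = 0" by simp
  from sf_indepD[OF evec_indep _ _ this, of L] \<open>0 \<notin># L\<close> show False by simp
qed

lemma span_x_eq_span_evec:
  "sf.span (x ` dom_up L) = sf.span (evec ` dom_up L)"
proof -
  have sub: "dom_up K \<subseteq> dom_up L" and pos: "0 \<notin># K" if "K \<in> dom_up L" for K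
    using that dom_up_trans by (auto simp: dom_up_def)
  have "x ` dom_up L \<subseteq> sf.span (evec ` dom_up L)"
  proof clarify
    fix K assume K: "K \<in> dom_up L"
    show "x K \<in> sf.span (evec ` dom_up L)"
      using x_in_span_evec[OF pos[OF K]] sf.span_mono[OF image_mono[OF sub[OF K]]] by blast
  qed
  moreover have "evec ` dom_up L \<subseteq> sf.span (x ` dom_up L)"
  proof clarify
    fix K assume K: "K \<in> dom_up L"
    show "evec K \<in> sf.span (x ` dom_up L)"
      using evec_in_span[OF pos[OF K]] sf.span_mono[OF image_mono[OF sub[OF K]]] by blast
  qed
  ultimately show ?thesis using span_subset_span by blast
qed

end

subsection \<open>The field \<open>\<rat>(q,t)\<close>\<close>

lemma rval_cell_sum: "rval x y (cell_sum q_var t_var \<nu>) (cell_sum x y \<nu>)"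
  and rval_cell_sum_swap: "rval x y (cell_sum t_var q_var \<nu>) (cell_sum y x \<nu>)"
  unfolding cell_sum_def case_prod_unfold
  by (intro rval_sum rval_mult rval_power rval_q_var rval_t_var)+

lemma q_var_power_neq_1: "\<forall>k\<ge>1. q_var ^ k \<noteq> 1"
proof (intro allI impI notI)
  fix k :: nat assume k: "k \<ge> 1" "q_var ^ k = 1"
  have "rval q_gen 1 (q_var ^ k) (q_gen ^ k)" by (intro rval_power rval_q_var)
  then have "q_gen ^ k = 1" unfolding k(2) by (rule rval_unique[OF _ rval_1])
  then show False using q_gen_power_neq_1 k(1) by blast
qed

lemma t_var_power_neq_1: "\<forall>k\<ge>1. t_var ^ k \<noteq> 1"
proof (intro allI impI notI)
  fix k :: nat assume k: "k \<ge> 1" "t_var ^ k = 1"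
  have "rval 1 q_gen (t_var ^ k) (q_gen ^ k)" by (intro rval_power rval_t_var)
  then have "q_gen ^ k = 1" unfolding k(2) by (rule rval_unique[OF _ rval_1])
  then show False using q_gen_power_neq_1 k(1) by blast
qed

lemma t_var_neq_1: "t_var \<noteq> 1"
  using t_var_power_neq_1[rule_format, of 1] by simp

lemma q_var_neq_1: "q_var \<noteq> 1"
  using q_var_power_neq_1[rule_format, of 1] by simp

lemma q_gen_neq_1: "q_gen \<noteq> 1"
  using q_gen_power_neq_1[of 1] by simp

text \<open>The local ring at \<open>t = 1\<close>: there the eigenvectors of \<open>macD\<close> degenerate to products of \<open>h\<^sub>n[X / (1 - q)]\<close>,
  which gives \<open>ev1_evec_nonzero\<close>.\<close>

abbreviation R1 :: "ratfun set" where
  "R1 \<equiv> {f. ratfun_defined_at q_gen 1 f}"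

lemma coeff_ring_qt: "coeff_ring q_var t_var {f. ratfun_defined_at x y f}"
proof
  show "\<forall>k\<ge>1. q_var ^ k \<noteq> 1" by (rule q_var_power_neq_1)
qed (auto intro: rvalD(1)[OF rval_1] rvalD(1)[OF rval_q_var] rvalD(1)[OF rval_t_var]
    rvalD(1)[OF rval_add[OF rval_self rval_self]] rvalD(1)[OF rval_mult[OF rval_self rval_self]]
    rvalD(1)[OF rval_uminus[OF rval_self]])

text \<open>A difference of eigenvalues is 1 - t times 1 - q times a difference of two B_mu. The
  last two factors stay nonzero at t = 1, where B_mu determines the partition, so the inverse of
  their product belongs to the local ring.\<close>

interpretation mac: eigen_ring q_var t_var R1
proof (intro eigen_ring.intro coeff_ring_qt eigen_ring_axioms.intro t_var_neq_1)
  fix K L :: "nat multiset"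
  assume KL: "0 \<notin># K" "0 \<notin># L" "sum_mset K = sum_mset L" "K \<noteq> L"
  define d where "d = (1 - q_var) * (cell_sum q_var t_var (plist L) - cell_sum q_var t_var (plist K))"
  define v where "v = (1 - q_gen) * (cell_sum q_gen 1 (plist L) - cell_sum q_gen 1 (plist K))"
  have "plist K \<noteq> plist L" using KL(4) by (metis mset_plist)
  then have "cell_sum q_gen 1 (plist K) \<noteq> cell_sum q_gen 1 (plist L)"
    using cell_sum_q_1_inject plist_partition KL(1,2) by blast
  then have v: "v \<noteq> 0" using q_gen_neq_1 by (simp add: v_def)
  have d: "rval q_gen 1 d v"
    unfolding d_def v_def by (intro rval_mult rval_diff rval_1 rval_q_var rval_cell_sum)
  then have "d \<noteq> 0" using v rval_unique[OF _ rval_0] by blast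
  have "beta q_var t_var (plist K) - beta q_var t_var (plist L) = (1 - t_var) * d"
    unfolding beta_eq_cell_sum d_def by (simp add: algebra_simps)
  then have "inverse d * (beta q_var t_var (plist K) - beta q_var t_var (plist L)) = 1 - t_var"
    using \<open>d \<noteq> 0\<close> by simp
  moreover have "inverse d \<in> R1" "inverse d \<noteq> 0" using rvalD(1)[OF rval_inverse[OF d v]] \<open>d \<noteq> 0\<close> by auto
  ultimately show "\<exists>u\<in>R1. u \<noteq> 0 \<and> u * (beta q_var t_var (plist K) - beta q_var t_var (plist L)) = 1 - t_var" by blast
qed

text \<open>The operator with q and t exchanged. Its eigenvectors only have to supply the second
  triangularity, so the whole field serves as coefficient ring.\<close>

interpretation mac': eigen_ring t_var q_var UNIV
proof (intro eigen_ring.intro coeff_ring.intro eigen_ring_axioms.intro t_var_power_neq_1 q_var_neq_1)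
  fix K L :: "nat multiset"
  assume KL: "0 \<notin># K" "0 \<notin># L" "sum_mset K = sum_mset L" "K \<noteq> L"
  have "plist K \<noteq> plist L" using KL(4) by (metis mset_plist)
  then have "cell_sum q_gen 1 (plist K) \<noteq> cell_sum q_gen 1 (plist L)"
    using cell_sum_q_1_inject plist_partition KL(1,2) by blast
  then have "cell_sum t_var q_var (plist K) \<noteq> cell_sum t_var q_var (plist L)"
    using rval_cell_sum_swap[of 1 q_gen] rval_unique by metis
  then have ne: "beta t_var q_var (plist K) - beta t_var q_var (plist L) \<noteq> 0"
    unfolding beta_eq_cell_sum using t_var_neq_1 q_var_neq_1 by simp
  show "\<exists>u\<in>UNIV. u \<noteq> 0 \<and> u * (beta t_var q_var (plist K) - beta t_var q_var (plist L)) = 1 - q_var"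
    using ne q_var_neq_1
    by (intro bexI[of _ "(1 - q_var) / (beta t_var q_var (plist K) - beta t_var q_var (plist L))"]) auto
qed auto

lemma rval_ev1_e: "\<exists>v. rval q_gen 1 (ev1 (mac.e n)) v \<and> v \<noteq> 0"
proof (induction n)
  case 0
  then show ?case using rval_1[of q_gen 1] by (auto simp: mac.e_0)
next
  case (Suc n)
  then obtain v where v: "rval q_gen 1 (ev1 (mac.e n)) v" "v \<noteq> 0" by blast
  have d: "rval q_gen 1 (1 - q_var ^ Suc n) (1 - q_gen ^ Suc n)"
    by (intro rval_diff rval_1 rval_power rval_q_var)
  have nz: "1 - q_gen ^ Suc n \<noteq> 0" using q_gen_power_neq_1[of "Suc n"] by simp
  have "1 - q_var ^ Suc n \<noteq> 0" using q_var_power_neq_1[rule_format, of "Suc n"] by simp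
  then have "ev1 (mac.e (Suc n)) = inverse (1 - q_var ^ Suc n) * ev1 (mac.e n)"
    unfolding mac.ev1_e_Suc[of n, symmetric] mult.assoc[symmetric] by simp
  then have "rval q_gen 1 (ev1 (mac.e (Suc n))) (inverse (1 - q_gen ^ Suc n) * v)"
    using rval_mult[OF rval_inverse[OF d nz] v(1)] by simp
  moreover have "inverse (1 - q_gen ^ Suc n) * v \<noteq> 0" using v(2) nz by (simp del: power_Suc)
  ultimately show ?case by blast
qed

lemma rval_ev1_x: "\<exists>v. rval q_gen 1 (ev1 (mac.x K)) v \<and> v \<noteq> 0"
proof (induction K)
  case (add k K)
  then obtain v w where "rval q_gen 1 (ev1 (mac.e k)) v" "v \<noteq> 0" "rval q_gen 1 (ev1 (mac.x K)) w" "w \<noteq> 0"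
    using rval_ev1_e[of k] by blast
  then have "rval q_gen 1 (ev1 (mac.x (add_mset k K))) (v * w)" "v * w \<noteq> 0"
    using rval_mult by (simp_all add: ev1.hom_mult)
  then show ?case by blast
qed (use rval_1[of q_gen 1] in auto)

text \<open>Up to terms that vanish at t = 1, the value of the eigenvector in one variable is that
  of a product of h_n[X/(1 - q)], which is nonzero there. This makes the normalization of H_mu
  possible.\<close>

lemma ev1_evec_nonzero:
  assumes "0 \<notin># L"
  shows "ev1 (mac.evec L) \<noteq> 0"
proof -
  have "rval q_gen 1 (ev1 F) 0" if "F \<in> cspan (mac.I 1) (mac.x ` A)" for F A
    using that
  proof (induction rule: cspan.induct)
    case cspan_zero
    show ?case by (simp add: rval_0)
  next
    case (cspan_step s g F)
    then obtain r K where r: "s = (1 - t_var) * r" "ratfun_defined_at q_gen 1 r" "g = mac.x K"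
      unfolding mac.I_def by auto
    obtain v where v: "rval q_gen 1 (ev1 g) v" using rval_ev1_x[of K] r(3) by blast
    have "rval q_gen 1 (s * ev1 g + ev1 F) ((1 - 1) * ratfun_eval q_gen 1 r * v + 0)"
      unfolding r(1) by (intro rval_add rval_mult rval_diff rval_1 rval_t_var rval_self r(2) v cspan_step.IH)
    then show ?case by (simp add: ev1.hom_add ev1.hom_mult ev1_const)
  qed
  from this[OF mac.evec(1)[OF assms]] have d: "rval q_gen 1 (ev1 (mac.evec L - mac.x L)) 0" .
  obtain v where v: "rval q_gen 1 (ev1 (mac.x L)) v" "v \<noteq> 0" using rval_ev1_x by blast
  have "rval q_gen 1 (ev1 (mac.evec L - mac.x L) + ev1 (mac.x L)) (0 + v)" by (rule rval_add[OF d v(1)])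
  then have "rval q_gen 1 (ev1 (mac.evec L)) v" by (simp flip: ev1.hom_add)
  then show ?thesis using v(2) rval_unique[OF _ rval_0] by metis
qed

subsection \<open>Modified Macdonald polynomials and Delta operators\<close>

lemma conjugate_conjugate:
  assumes "\<nu> \<in> partitions_of n"
  shows "conjugate (conjugate \<nu>) = \<nu>"
proof (rule partition_eq_if_cells_eq[OF conjugate_partition[OF conjugate_partition[OF assms]] assms])
  show "cells (conjugate (conjugate \<nu>)) = cells \<nu>"
    unfolding cells_conjugate[OF conjugate_partition[OF assms]] cells_conjugate[OF assms]
    by (simp add: image_image)
qed

definition mconj :: "nat multiset \<Rightarrow> nat multiset" where
  "mconj L = mset (conjugate (plist L))"

lemma plist_mconj: "0 \<notin># L \<Longrightarrow> plist (mconj L) = conjugate (plist L)"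
  unfolding mconj_def using conjugate_partition[OF plist_partition] by (intro plist_mset) (auto simp: partitions_def)

lemma mconj_pos: "0 \<notin># L \<Longrightarrow> 0 \<notin># mconj L"
  and sum_mconj: "0 \<notin># L \<Longrightarrow> sum_mset (mconj L) = sum_mset L"
  using mset_partition[OF conjugate_partition[OF plist_partition[of L]]] unfolding mconj_def by auto

lemma mconj_mconj: "0 \<notin># L \<Longrightarrow> mconj (mconj L) = L"
  using conjugate_conjugate[OF plist_partition[of L]] unfolding mconj_def[of "mconj L"]
  by (simp add: plist_mconj)

lemma dom_up_mconj_antisym:
  assumes L: "0 \<notin># L" and K: "K \<in> dom_up L" "mconj K \<in> dom_up (mconj L)"
  shows "K = L"
proof -
  have K': "0 \<notin># K" "sum_mset K = sum_mset L" using K(1) by (auto simp: dom_up_def)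
  have "plist K = plist L"
  proof (rule dominates_conjugate_antisym)
    show "plist K \<in> partitions_of (sum_mset L)" using plist_partition[OF K'(1)] K'(2) by simp
    show "plist L \<in> partitions_of (sum_mset L)" by (rule plist_partition[OF L])
    show "dominates (plist K) (plist L)" using K(1) by (simp add: dom_up_def)
    show "dominates (conjugate (plist K)) (conjugate (plist L))"
      using K(2) plist_mconj[OF K'(1)] plist_mconj[OF L] by (simp add: dom_up_def)
  qed
  then show ?thesis by (metis mset_plist)
qed

text \<open>\<open>rescale a\<close> is \<open>X \<mapsto> X (1 - a)\<close>, inverse to \<open>unscale a\<close>.\<close>

definition rescale :: "'k::field_char_0 \<Rightarrow> 'k symfun \<Rightarrow> 'k symfun" where
  "rescale a = sf_lift const_sf (\<lambda>k. const_sf (1 - a ^ k) * power_sf k)"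

lemma sf_hom_rescale: "sf_hom const_sf (rescale a)"
  unfolding rescale_def by (rule sf_lift[OF comm_ring_hom_const_sf])

interpretation rescale: comm_ring_hom "rescale a"
  by (rule sf_homD(1)[OF sf_hom_rescale])

lemma rescale_power_sf: "k \<ge> 1 \<Longrightarrow> rescale a (power_sf k) = const_sf (1 - a ^ k) * power_sf k"
  unfolding rescale_def by (rule sf_lift[OF comm_ring_hom_const_sf])

lemma rescale_const: "rescale a (const_sf c) = const_sf c"
  by (rule sf_homD(2)[OF sf_hom_rescale])

lemma sf_hom_comp: "sf_hom const_sf \<phi> \<Longrightarrow> sf_hom const_sf \<psi> \<Longrightarrow> sf_hom const_sf (\<lambda>F. \<phi> (\<psi> F))"
proof -
  assume *: "sf_hom const_sf \<phi>" "sf_hom const_sf \<psi>"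
  interpret \<phi>: comm_ring_hom \<phi> by (rule sf_homD(1)[OF *(1)])
  interpret \<psi>: comm_ring_hom \<psi> by (rule sf_homD(1)[OF *(2)])
  show ?thesis unfolding sf_hom_def
    by (auto simp: sf_homD(2)[OF *(1)] sf_homD(2)[OF *(2)]) (unfold_locales, simp_all add: \<phi>.hom_add \<phi>.hom_mult \<psi>.hom_add \<psi>.hom_mult)
qed

lemma sf_hom_id: "sf_hom const_sf (\<lambda>F. F)"
  unfolding sf_hom_def by (auto) (unfold_locales, auto)

lemma rescale_unscale:
  assumes "\<forall>k\<ge>1. a ^ k \<noteq> 1"
  shows "rescale a (unscale a F) = F" "unscale a (rescale a F) = F"
proof -
  have nz: "1 - a ^ k \<noteq> 0" if "k \<ge> 1" for k using assms that by auto
  have "(\<lambda>F. rescale a (unscale a F)) = (\<lambda>F. F)"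
  proof (rule sf_hom_unique[OF sf_hom_comp[OF sf_hom_rescale sf_hom_unscale] sf_hom_id])
    fix k :: nat assume k: "k \<ge> 1"
    show "rescale a (unscale a (power_sf k)) = power_sf k"
      unfolding unscale_power_sf[OF k] rescale.hom_mult rescale_const rescale_power_sf[OF k]
      using nz[OF k] by (simp add: divide_inverse)
  qed
  then show "rescale a (unscale a F) = F" by metis
  have "(\<lambda>F. unscale a (rescale a F)) = (\<lambda>F. F)"
  proof (rule sf_hom_unique[OF sf_hom_comp[OF sf_hom_unscale sf_hom_rescale] sf_hom_id])
    fix k :: nat assume k: "k \<ge> 1"
    show "unscale a (rescale a (power_sf k)) = power_sf k"
      unfolding rescale_power_sf[OF k] unscale.hom_mult unscale_const unscale_power_sf[OF k]
      using nz[OF k] by (simp add: divide_inverse)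
  qed
  then show "unscale a (rescale a F) = F" by metis
qed

text \<open>The hypothesis expresses that raising q and t to the k-th power raises \<open>a\<close>
  to the k-th power, as is the case for q and for t themselves.\<close>

lemma plethysm_X_minus:
  assumes "\<And>k. rval (q_var ^ k) (t_var ^ k) a (a ^ k)"
  shows "plethysm F (X_sf * (1 - const_sf a)) = rescale a F"
proof -
  have "X_sf * (1 - const_sf a) = X_sf * const_sf (1 - a)" by (simp add: const_sf_diff)
  moreover have "ratfun_eval (q_var ^ k) (t_var ^ k) (1 - a) = 1 - a ^ k" for k
    by (rule rvalD(2)[OF rval_diff[OF rval_1 assms]])
  ultimately have "raise_all k (X_sf * (1 - const_sf a)) = power_sf k * const_sf (1 - a ^ k)" if "k \<ge> 1" for k
    using raise_all_X_const[OF that] by simp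
  then have "rescale a = sf_lift const_sf (\<lambda>k. raise_all k (X_sf * (1 - const_sf a)))"
    by (intro sf_lift_eqI[OF sf_hom_rescale _ comm_ring_hom_const_sf]) (simp add: rescale_power_sf mult.commute)
  then show ?thesis by (simp add: plethysm_eq)
qed

lemma plethysm_X_q: "plethysm F (X_sf * (1 - const_sf q_var)) = rescale q_var F"
  by (rule plethysm_X_minus[OF rval_q_var])

lemma plethysm_X_t: "plethysm F (X_sf * (1 - const_sf t_var)) = rescale t_var F"
  by (rule plethysm_X_minus[OF rval_t_var])

context coeff_ring
begin

lemma rescale_x: "rescale a (x K) = hprod K"
proof -
  have "rescale a (e n) = complete_sf n" for n
    using rescale_unscale(1)[OF a_pow] by (simp add: eta_def)
  then show ?thesis by (induction K) (simp_all add: rescale.hom_mult)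
qed

lemma rescale_in_span_iff: "rescale a F \<in> sf.span (hprod ` A) \<longleftrightarrow> F \<in> sf.span (x ` A)"
proof
  assume "rescale a F \<in> sf.span (hprod ` A)"
  from hom_span[OF sf_hom_unscale[of a] this] have "F \<in> sf.span (unscale a ` hprod ` A)"
    by (simp only: rescale_unscale(2)[OF a_pow])
  moreover have "unscale a (hprod K) = x K" for K
    using rescale_unscale(2)[OF a_pow, of "x K"] by (simp only: rescale_x)
  ultimately show "F \<in> sf.span (x ` A)" by (simp add: image_image)
next
  assume "F \<in> sf.span (x ` A)"
  from hom_span[OF sf_hom_rescale[of a] this] show "rescale a F \<in> sf.span (hprod ` A)"
    by (simp add: image_image rescale_x)
qed

end

lemma schur_set_eq:
  assumes "0 \<notin># L"
  shows "{schur_sf \<nu> | \<nu>. \<nu> \<in> partitions_of (sum_mset L) \<and> dominates \<nu> (plist L)} = (\<lambda>K. schur_sf (plist K)) ` dom_up L"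
    (is "?A = ?B")
proof (intro equalityI subsetI)
  fix F assume "F \<in> ?A"
  then obtain \<nu> where \<nu>: "F = schur_sf \<nu>" "\<nu> \<in> partitions_of (sum_mset L)" "dominates \<nu> (plist L)" by blast
  have p: "plist (mset \<nu>) = \<nu>" using \<nu>(2) by (intro plist_mset) (auto simp: partitions_def)
  have "mset \<nu> \<in> dom_up L" using mset_partition[OF \<nu>(2)] \<nu>(3) p by (simp add: dom_up_def)
  then show "F \<in> ?B" using \<nu>(1) p by (intro image_eqI[of _ _ "mset \<nu>"]) simp_all
next
  fix F assume "F \<in> ?B"
  then obtain K where K: "K \<in> dom_up L" "F = schur_sf (plist K)" by auto
  then have "plist K \<in> partitions_of (sum_mset L)" "dominates (plist K) (plist L)"
    using plist_partition[of K] by (auto simp: dom_up_def)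
  then show "F \<in> ?A" using K(2) by blast
qed

lemma eigval_mconj: "0 \<notin># L \<Longrightarrow> beta t_var q_var (plist (mconj L)) = beta q_var t_var (plist L)"
  unfolding beta_eq_cell_sum plist_mconj cell_sum_conjugate[OF plist_partition] by (simp add: mult.commute)

text \<open>Both vectors belong to one operator. Conjugation exchanges q and t in B_mu, so their
  eigenvalues agree, and eigenspaces within a degree are one-dimensional.\<close>

lemma evec_mconj:
  assumes "0 \<notin># L"
  shows "\<exists>c. c \<noteq> 0 \<and> mac'.evec (mconj L) = const_sf c * mac.evec L"
proof -
  have "macD q_var t_var (mac'.evec (mconj L)) = const_sf (beta q_var t_var (plist L)) * mac'.evec (mconj L)"
    using mac'.evec(2)[OF mconj_pos[OF assms]] eigval_mconj[OF assms] macD_commute[of q_var t_var] by simp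
  moreover have "homogeneous_sf (sum_mset L) (mac'.evec (mconj L))"
    using mac'.homogeneous_evec[OF mconj_pos[OF assms]] by (simp add: sum_mconj[OF assms])
  ultimately obtain c where c: "mac'.evec (mconj L) = const_sf c * mac.evec L"
    using mac.eigenspace[OF assms] by blast
  have "c \<noteq> 0" using c mac'.evec_nonzero[OF mconj_pos[OF assms]] by auto
  then show ?thesis using c by blast
qed

text \<open>In the eigenbasis the two spans are indexed by the partitions above \<open>L\<close> and
  by those whose conjugates lie above the conjugate of \<open>L\<close>. As conjugation reverses
  dominance, only \<open>L\<close> is in both.\<close>

lemma macdonald_space:
  assumes L: "0 \<notin># L"
  shows "F \<in> sf.span (mac.x ` dom_up L) \<and> F \<in> sf.span (mac'.x ` dom_up (mconj L)) \<longleftrightarrow> (\<exists>c. F = const_sf c * mac.evec L)"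
proof
  assume F: "F \<in> sf.span (mac.x ` dom_up L) \<and> F \<in> sf.span (mac'.x ` dom_up (mconj L))"
  let ?B = "mconj ` dom_up (mconj L)"
  have "mac'.evec ` dom_up (mconj L) \<subseteq> sf.span (mac.evec ` ?B)"
  proof clarify
    fix K assume K: "K \<in> dom_up (mconj L)"
    then have pos: "0 \<notin># K" by (simp add: dom_up_def)
    obtain c where "mac'.evec K = const_sf c * mac.evec (mconj K)"
      using evec_mconj[OF mconj_pos[OF pos]] mconj_mconj[OF pos] by auto
    then show "mac'.evec K \<in> sf.span (mac.evec ` ?B)" using K by (auto intro: span_scale_mem sf.span_base)
  qed
  then have FB: "F \<in> sf.span (mac.evec ` ?B)"
    using F span_subset_span unfolding mac'.span_x_eq_span_evec by blast
  have FA: "F \<in> sf.span (mac.evec ` dom_up L)" using F unfolding mac.span_x_eq_span_evec by blast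
  have "?B \<subseteq> pos_msets" "dom_up L \<subseteq> pos_msets" using mconj_pos by (auto simp: dom_up_def)
  then have "F \<in> sf.span (mac.evec ` (dom_up L \<inter> ?B))"
    using FA FB by (intro span_Int_indep[OF mac.evec_indep] finite_imageI finite_up)
  moreover have "dom_up L \<inter> ?B \<subseteq> {L}"
  proof clarify
    fix K assume K: "mconj K \<in> dom_up L" "K \<in> dom_up (mconj L)"
    then have "0 \<notin># K" by (simp add: dom_up_def)
    then show "mconj K = L" using dom_up_mconj_antisym[OF L K(1)] K(2) mconj_mconj by simp
  qed
  ultimately have "F \<in> sf.span (mac.evec ` {L})"
    using sf.span_mono[OF image_mono[of "dom_up L \<inter> ?B" "{L}" mac.evec]] by blast
  then show "\<exists>c. F = const_sf c * mac.evec L"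
    using span_image_finite[of "{L}" F mac.evec] by auto
next
  assume "\<exists>c. F = const_sf c * mac.evec L"
  then obtain c where c: "F = const_sf c * mac.evec L" by blast
  obtain d where d: "d \<noteq> 0" "mac'.evec (mconj L) = const_sf d * mac.evec L" using evec_mconj[OF L] by blast
  have "mac.evec L = const_sf (inverse d) * mac'.evec (mconj L)" using d by simp
  then have "mac.evec L \<in> sf.span (mac'.x ` dom_up (mconj L))"
    using span_scale_mem mac'.evec_in_span[OF mconj_pos[OF L]] by simp
  then show "F \<in> sf.span (mac.x ` dom_up L) \<and> F \<in> sf.span (mac'.x ` dom_up (mconj L))"
    unfolding c using span_scale_mem mac.evec_in_span[OF L] by blast
qed

text \<open>Schur functions and products of the h span the same spaces above \<open>L\<close>, so
  undoing X -> X (1 - q) and X -> X (1 - t) turns the triangularity conditions into those of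
  \<open>macdonald_space\<close>. The normalization then fixes the scalar.\<close>

lemma macdonald_H_eq:
  assumes L: "0 \<notin># L"
  shows "macdonald_H (plist L) = const_sf (inverse (ev1 (mac.evec L))) * mac.evec L"
proof -
  let ?n = "sum_mset L"
  have 1: "plethysm F (X_sf * (1 - const_sf q_var)) \<in>
       sf.span {schur_sf \<nu> | \<nu>. \<nu> \<in> partitions_of ?n \<and> dominates \<nu> (plist L)} \<longleftrightarrow> F \<in> sf.span (mac.x ` dom_up L)" for F
    unfolding plethysm_X_q schur_set_eq[OF L] span_schur_eq_span_hprod mac.rescale_in_span_iff ..
  have 2: "plethysm F (X_sf * (1 - const_sf t_var)) \<in>
       sf.span {schur_sf \<nu> | \<nu>. \<nu> \<in> partitions_of ?n \<and> dominates \<nu> (conjugate (plist L))} \<longleftrightarrow>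
       F \<in> sf.span (mac'.x ` dom_up (mconj L))" for F
  proof -
    have "{schur_sf \<nu> | \<nu>. \<nu> \<in> partitions_of ?n \<and> dominates \<nu> (conjugate (plist L))}
        = (\<lambda>K. schur_sf (plist K) :: ratfun symfun) ` dom_up (mconj L)"
      using schur_set_eq[OF mconj_pos[OF L]] unfolding plist_mconj[OF L] sum_mconj[OF L] .
    then show ?thesis
      by (simp only: plethysm_X_t span_schur_eq_span_hprod mac'.rescale_in_span_iff)
  qed
  let ?v = "mac.evec L"
  have nz: "ev1 ?v \<noteq> 0" by (rule ev1_evec_nonzero[OF L])
  have hom: "homogeneous_sf ?n (const_sf c * ?v)" for c
    by (intro homogeneous_scale mac.homogeneous_evec L)
  show ?thesis
    unfolding macdonald_H_def Let_def sum_list_plist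
  proof (rule the_equality, unfold 1 2)
    show "homogeneous_sf ?n (const_sf (inverse (ev1 ?v)) * ?v) \<and>
      const_sf (inverse (ev1 ?v)) * ?v \<in> sf.span (mac.x ` dom_up L) \<and>
      const_sf (inverse (ev1 ?v)) * ?v \<in> sf.span (mac'.x ` dom_up (mconj L)) \<and>
      hall_inner (const_sf (inverse (ev1 ?v)) * ?v) (schur_sf (if ?n = 0 then [] else [?n])) = 1"
    proof (intro conjI)
      show "hall_inner (const_sf (inverse (ev1 ?v)) * ?v) (schur_sf (if ?n = 0 then [] else [?n])) = 1"
        unfolding hall_inner_one_row[OF hom] using nz by (simp add: ev1.hom_mult ev1_const)
    qed (use hom macdonald_space[OF L] in blast)+
  next
    fix F assume F: "homogeneous_sf ?n F \<and> F \<in> sf.span (mac.x ` dom_up L) \<and>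
      F \<in> sf.span (mac'.x ` dom_up (mconj L)) \<and> hall_inner F (schur_sf (if ?n = 0 then [] else [?n])) = 1"
    then obtain c where c: "F = const_sf c * ?v" using macdonald_space[OF L] by blast
    have "ev1 F = 1" using F hall_inner_one_row[of ?n F] by metis
    then have "c * ev1 ?v = 1" using c by (simp add: ev1.hom_mult ev1_const)
    then have "c = inverse (ev1 ?v)" using nz by (simp add: field_simps)
    then show "F = const_sf (inverse (ev1 ?v)) * ?v" using c by simp
  qed
qed

text \<open>\<open>sf_alphabet x C f\<close> is \<open>f\<close> evaluated at the variables \<open>x c\<close>, \<open>c \<in> C\<close>.\<close>

definition sf_alphabet :: "('c \<Rightarrow> 'k::field_char_0) \<Rightarrow> 'c set \<Rightarrow> 'k symfun \<Rightarrow> 'k" where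
  "sf_alphabet x C = sf_lift (\<lambda>c. c) (\<lambda>k. \<Sum>c\<in>C. x c ^ k)"

lemma sf_hom_alphabet: "sf_hom (\<lambda>c. c) (sf_alphabet x C)"
  unfolding sf_alphabet_def by (rule sf_lift) (unfold_locales, auto)

lemma sf_alphabet_power_sf: "k \<ge> 1 \<Longrightarrow> sf_alphabet x C (power_sf k) = (\<Sum>c\<in>C. x c ^ k)"
  unfolding sf_alphabet_def by (rule sf_lift) (unfold_locales, auto)

lemma sf_alphabet_elem_sf:
  assumes "finite C"
  shows "sf_alphabet x C (elem_sf n) = fps_nth (\<Prod>c\<in>C. 1 + fps_const (x c) * fps_X) n"
proof -
  let ?\<phi> = "sf_alphabet x C"
  interpret \<phi>: comm_ring_hom ?\<phi> by (rule sf_homD(1)[OF sf_hom_alphabet])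
  have "newton (\<lambda>k. ?\<phi> ((- 1) ^ (k - 1) * power_sf k)) (Abs_fps (\<lambda>n. ?\<phi> (elem_sf n)))"
    using newton_hom[OF sf_homD(1)[OF sf_hom_alphabet] newton_elem_sf] by simp
  then have "newton (\<lambda>k. (- 1) ^ (k - 1) * (\<Sum>c\<in>C. x c ^ k)) (Abs_fps (\<lambda>n. ?\<phi> (elem_sf n)))"
    by (rule newton_cong) (simp add: \<phi>.hom_mult \<phi>.hom_power \<phi>.hom_uminus sf_alphabet_power_sf)
  then have "Abs_fps (\<lambda>n. ?\<phi> (elem_sf n)) = (\<Prod>c\<in>C. 1 + fps_const (x c) * fps_X)"
    by (rule newton_unique_field[OF _ newton_prod[OF assms]])
  then show ?thesis by (metis fps_nth_Abs_fps)
qed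

abbreviation cell_weight :: "'a::comm_ring_1 \<Rightarrow> 'a \<Rightarrow> nat \<times> nat \<Rightarrow> 'a" where
  "cell_weight a b c \<equiv> a ^ snd c * b ^ fst c"

text \<open>Raising q and t to the k-th power in B_mu gives the k-th power sum of the cell weights,
  so the plethysm evaluates f at these weights.\<close>

lemma plethysm_B_poly:
  "plethysm f (const_sf (B_poly \<mu>)) = const_sf (sf_alphabet (cell_weight q_var t_var) (cells \<mu>) f)"
proof -
  let ?\<phi> = "sf_alphabet (cell_weight q_var t_var) (cells \<mu>)"
  interpret \<phi>: comm_ring_hom ?\<phi> by (rule sf_homD(1)[OF sf_hom_alphabet])
  have B: "B_poly \<mu> = cell_sum q_var t_var \<mu>" by (simp add: B_poly_def cell_sum_def)
  have "comm_ring_hom (\<lambda>f. const_sf (?\<phi> f))"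
    by unfold_locales (simp_all add: \<phi>.hom_add \<phi>.hom_mult const_sf_add const_sf_mult)
  then have hom: "sf_hom const_sf (\<lambda>f. const_sf (?\<phi> f))"
    by (simp add: sf_hom_def sf_homD(2)[OF sf_hom_alphabet])
  have "const_sf (?\<phi> (power_sf k)) = raise_all k (const_sf (B_poly \<mu>))" if k: "k \<ge> 1" for k
    unfolding raise_all_const[OF k] B rvalD(2)[OF rval_cell_sum] sf_alphabet_power_sf[OF k]
    by (simp add: cell_sum_def case_prod_unfold power_mult_distrib power_mult[symmetric] mult.commute)
  then have "(\<lambda>f. const_sf (?\<phi> f)) = sf_lift const_sf (\<lambda>k. raise_all k (const_sf (B_poly \<mu>)))"
    by (intro sf_lift_eqI[OF hom _ comm_ring_hom_const_sf]) simp
  from fun_cong[OF this, of f] show ?thesis unfolding plethysm_eq by simp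
qed

abbreviation f_val :: "ratfun symfun \<Rightarrow> nat multiset \<Rightarrow> ratfun" where
  "f_val f L \<equiv> sf_alphabet (cell_weight q_var t_var) (cells (plist L)) f"

lemma linear_sfI:
  fixes D :: "'k::field symfun \<Rightarrow> 'k symfun"
  assumes "\<And>F G. D (F + G) = D F + D G" "\<And>c F. D (const_sf c * F) = const_sf c * D F"
  shows "linear_sf D"
  unfolding linear_sf_def by unfold_locales (simp_all add: assms scale_sf_def)

lemma linear_sfD:
  assumes "linear_sf D"
  shows "D (F + G) = D F + D G" "D (const_sf c * F) = const_sf c * D F" "D 0 = 0"
proof -
  interpret Vector_Spaces.linear scale_sf scale_sf D using assms by (simp add: linear_sf_def)
  show "D (F + G) = D F + D G" "D (const_sf c * F) = const_sf c * D F" "D 0 = 0"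
    by (simp_all add: add scale[unfolded scale_sf_def])
qed

lemma linear_sf_eq_on_span:
  assumes "linear_sf D" "linear_sf D'" "\<And>x. x \<in> B \<Longrightarrow> D x = D' x" "F \<in> sf.span B"
  shows "D F = D' F"
  using assms(4) by (induction rule: sf.span_induct_alt)
    (simp_all add: linear_sfD[OF assms(1)] linear_sfD[OF assms(2)] scale_sf_def assms(3))

text \<open>H_mu and the eigenvector differ by a nonzero scalar, so the defining condition of
  \<open>Delta_op\<close> can be transferred to the eigenbasis, on which a linear map exists and is
  unique.\<close>

lemma Delta_op_evec:
  shows "linear_sf (Delta_op f)" "0 \<notin># L \<Longrightarrow> Delta_op f (mac.evec L) = const_sf (f_val f L) * mac.evec L"
proof -
  let ?v = "mac.evec"
  have span: "sf.span (?v ` pos_msets) = UNIV" by (rule span_UNIV_of_spanning[OF mac.power_in_span_evec])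
  have inj: "inj_on ?v pos_msets" by (rule sf_indep_inj[OF mac.evec_indep])
  interpret vector_space_pair "scale_sf :: ratfun \<Rightarrow> _" "scale_sf :: ratfun \<Rightarrow> _"
    by (rule vector_space_pair.intro[OF vector_space_scale_sf vector_space_scale_sf])
  from linear_independent_extend[OF sf_indep_independent[OF mac.evec_indep],
      where f = "\<lambda>y. const_sf (f_val f (the_inv_into pos_msets ?v y)) * y"]
  obtain D where D: "linear_sf D" "\<forall>y\<in>?v ` pos_msets. D y = const_sf (f_val f (the_inv_into pos_msets ?v y)) * y"
    unfolding linear_sf_def by blast
  have Dv: "D (?v L) = const_sf (f_val f L) * ?v L" if "0 \<notin># L" for L
    using D(2) the_inv_into_f_f[OF inj, of L] that by simp
  have H: "(\<forall>\<mu>\<in>partitions. D' (macdonald_H \<mu>) = plethysm f (const_sf (B_poly \<mu>)) * macdonald_H \<mu>)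
      \<longleftrightarrow> (\<forall>L. 0 \<notin># L \<longrightarrow> D' (?v L) = const_sf (f_val f L) * ?v L)" if D': "linear_sf D'" for D'
  proof -
    have "D' (macdonald_H (plist L)) = plethysm f (const_sf (B_poly (plist L))) * macdonald_H (plist L)
        \<longleftrightarrow> D' (?v L) = const_sf (f_val f L) * ?v L" if L: "0 \<notin># L" for L
    proof -
      let ?c = "inverse (ev1 (?v L))"
      have c: "?c \<noteq> 0" using ev1_evec_nonzero[OF L] by simp
      have "D' (macdonald_H (plist L)) = plethysm f (const_sf (B_poly (plist L))) * macdonald_H (plist L)
          \<longleftrightarrow> const_sf ?c * D' (?v L) = const_sf ?c * (const_sf (f_val f L) * ?v L)"
        unfolding macdonald_H_eq[OF L] linear_sfD(2)[OF D'] plethysm_B_poly by (simp only: mult.left_commute)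
      also have "\<dots> \<longleftrightarrow> D' (?v L) = const_sf (f_val f L) * ?v L"
      proof
        assume "const_sf ?c * D' (?v L) = const_sf ?c * (const_sf (f_val f L) * ?v L)"
        then have "const_sf (inverse ?c) * (const_sf ?c * D' (?v L))
            = const_sf (inverse ?c) * (const_sf ?c * (const_sf (f_val f L) * ?v L))" by (simp only:)
        then show "D' (?v L) = const_sf (f_val f L) * ?v L" by (simp only: const_sf_inverse_cancel(1)[OF c])
      qed (simp only:)
      finally show ?thesis .
    qed
    moreover have "(\<forall>\<mu>\<in>partitions. P \<mu>) \<longleftrightarrow> (\<forall>L. 0 \<notin># L \<longrightarrow> P (plist L))" for P
    proof (intro iffI ballI allI impI)
      fix \<mu> assume "\<forall>L. 0 \<notin># L \<longrightarrow> P (plist L)" "\<mu> \<in> partitions"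
      then have "P (plist (mset \<mu>))" using partitions_pos by blast
      then show "P \<mu>" using plist_mset[OF \<open>\<mu> \<in> partitions\<close>] by simp
    qed (use plist_in_partitions in blast)
    ultimately show ?thesis by simp
  qed
  have "Delta_op f = D"
    unfolding Delta_op_def
  proof (rule the_equality)
    show "linear_sf D \<and> (\<forall>\<mu>\<in>partitions. D (macdonald_H \<mu>) = plethysm f (const_sf (B_poly \<mu>)) * macdonald_H \<mu>)"
      using D(1) H[OF D(1)] Dv by blast
  next
    fix D' assume D': "linear_sf D' \<and> (\<forall>\<mu>\<in>partitions. D' (macdonald_H \<mu>) = plethysm f (const_sf (B_poly \<mu>)) * macdonald_H \<mu>)"
    then have v: "\<forall>L. 0 \<notin># L \<longrightarrow> D' (?v L) = const_sf (f_val f L) * ?v L" using H by blast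
    show "D' = D"
    proof
      fix F show "D' F = D F"
        by (rule linear_sf_eq_on_span[of D' D "?v ` pos_msets"]) (use D' D(1) v Dv span in auto)
    qed
  qed
  then show "linear_sf (Delta_op f)" "0 \<notin># L \<Longrightarrow> Delta_op f (?v L) = const_sf (f_val f L) * ?v L"
    using D(1) Dv by auto
qed

subsection \<open>Delta operators as polynomials in \<open>macD\<close>\<close>

primrec macD_prod :: "'k::field_char_0 \<Rightarrow> 'k \<Rightarrow> 'k list \<Rightarrow> 'k symfun \<Rightarrow> 'k symfun" where
  "macD_prod a b [] F = F"
| "macD_prod a b (c # cs) F = macD a b (macD_prod a b cs F) - const_sf c * macD_prod a b cs F"

lemma macD_prod_add: "macD_prod a b cs (F + G) = macD_prod a b cs F + macD_prod a b cs G"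
  by (induction cs) (simp_all add: macD_add algebra_simps)

lemma macD_prod_scale: "macD_prod a b cs (const_sf c * F) = const_sf c * macD_prod a b cs F"
proof (induction cs)
  case (Cons d cs)
  then show ?case by (simp add: macD_scale right_diff_distrib mult.left_commute)
qed simp

lemma macD_prod_eigen:
  assumes "macD a b v = const_sf g * v"
  shows "macD_prod a b cs v = const_sf (\<Prod>c\<leftarrow>cs. g - c) * v"
proof (induction cs)
  case (Cons c cs)
  have "macD_prod a b (c # cs) v = const_sf (\<Prod>c\<leftarrow>cs. g - c) * (const_sf g * v - const_sf c * v)"
    unfolding macD_prod.simps Cons macD_scale assms by (simp only: right_diff_distrib mult.left_commute)
  also have "\<dots> = const_sf (\<Prod>c\<leftarrow>c # cs. g - c) * v"
    by (simp only: list.map prod_list.Cons const_sf_mult const_sf_diff left_diff_distrib right_diff_distrib)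
       (simp only: mult_ac)
  finally show ?case .
qed simp

text \<open>
  Lagrange interpolation in the operator \<open>macD\<close>: on an eigenvector with eigenvalue \<open>\<beta> K\<close> it acts as
  multiplication by \<open>f K\<close>. The point is that the interpolation has no poles at \<open>t = 1/q\<close>.
\<close>

definition lagr :: "'k::field_char_0 \<Rightarrow> 'k \<Rightarrow> ('i \<Rightarrow> 'k) \<Rightarrow> ('i \<Rightarrow> 'k) \<Rightarrow> 'i list \<Rightarrow> 'k symfun \<Rightarrow> 'k symfun" where
  "lagr a b \<beta> f Ks F = (\<Sum>K\<in>set Ks. const_sf (f K * (\<Prod>J\<leftarrow>remove1 K Ks. inverse (\<beta> K - \<beta> J)))
     * macD_prod a b (map \<beta> (remove1 K Ks)) F)"

lemma lagr_add: "lagr a b \<beta> f Ks (F + G) = lagr a b \<beta> f Ks F + lagr a b \<beta> f Ks G"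
  by (simp add: lagr_def macD_prod_add distrib_left sum.distrib)

lemma lagr_scale: "lagr a b \<beta> f Ks (const_sf c * F) = const_sf c * lagr a b \<beta> f Ks F"
  unfolding lagr_def macD_prod_scale sum_distrib_left by (simp only: mult.left_commute)

lemma linear_lagr: "linear_sf (lagr a b \<beta> f Ks)"
  by (rule linear_sfI) (rule lagr_add, rule lagr_scale)

lemma inverse_times_cancel: "d \<noteq> 0 \<Longrightarrow> inverse d * p * (d * r) = p * (r :: 'a::field)"
  by simp

lemma sum_singleton: "(\<Sum>i\<in>{a}. f i) = f a"
  by simp

lemma lagr_eigen:
  assumes Ks: "distinct Ks" "inj_on \<beta> (set Ks)" "L \<in> set Ks" and v: "macD a b v = const_sf (\<beta> L) * v"
  shows "lagr a b \<beta> f Ks v = const_sf (f L) * v"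
proof -
  have z: "(\<Prod>c\<leftarrow>map \<beta> (remove1 K Ks). \<beta> L - c) = 0" if "K \<noteq> L" for K
    using that Ks(3) by (force simp: prod_list_zero_iff)
  have inv: "(\<Prod>J\<leftarrow>Js. inverse (\<beta> L - \<beta> J)) * (\<Prod>c\<leftarrow>map \<beta> Js. \<beta> L - c) = 1"
    if "set Js \<subseteq> set Ks - {L}" for Js
    using that
  proof (induction Js)
    case (Cons J Js)
    then have "\<beta> L - \<beta> J \<noteq> 0" using Ks(2,3) by (auto dest: inj_onD)
    then show ?case using Cons by (simp add: inverse_times_cancel)
  qed simp
  have "lagr a b \<beta> f Ks v = (\<Sum>K\<in>{L}. const_sf (f K * (\<Prod>J\<leftarrow>remove1 K Ks. inverse (\<beta> K - \<beta> J)))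
     * macD_prod a b (map \<beta> (remove1 K Ks)) v)"
    unfolding lagr_def macD_prod_eigen[OF v]
  proof (rule sum.mono_neutral_right)
    show "\<forall>K\<in>set Ks - {L}. const_sf (f K * (\<Prod>J\<leftarrow>remove1 K Ks. inverse (\<beta> K - \<beta> J)))
        * (const_sf (\<Prod>c\<leftarrow>map \<beta> (remove1 K Ks). \<beta> L - c) * v) = 0"
    proof
      fix K assume "K \<in> set Ks - {L}"
      then have "K \<noteq> L" by simp
      show "const_sf (f K * (\<Prod>J\<leftarrow>remove1 K Ks. inverse (\<beta> K - \<beta> J)))
        * (const_sf (\<Prod>c\<leftarrow>map \<beta> (remove1 K Ks). \<beta> L - c) * v) = 0"
        by (simp only: z[OF \<open>K \<noteq> L\<close>] const_sf_0 mult_zero_left mult_zero_right)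
    qed
  qed (use Ks(3) in auto)
  also have "\<dots> = const_sf (f L * ((\<Prod>J\<leftarrow>remove1 L Ks. inverse (\<beta> L - \<beta> J))
      * (\<Prod>c\<leftarrow>map \<beta> (remove1 L Ks). \<beta> L - c))) * v"
    by (simp only: macD_prod_eigen[OF v] const_sf_mult mult.assoc sum_singleton)
  also have "\<dots> = const_sf (f L) * v"
    using inv[of "remove1 L Ks"] Ks(1) by simp
  finally show ?thesis .
qed

section \<open>Specialization of the interpolated operator\<close>

lemma fls_times_nth_bounds:
  fixes f g :: "'a::comm_ring_1 fls"
  assumes f: "\<And>i. i < df \<Longrightarrow> fls_nth f i = 0" and g: "\<And>i. i < dg \<Longrightarrow> fls_nth g i = 0"
  shows "fls_nth (f * g) n = (\<Sum>i=df..n - dg. fls_nth f i * fls_nth g (n - i))"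
proof -
  let ?s = "fls_subdegree f" and ?t = "fls_subdegree g"
  let ?S = "{min df ?s..n - min dg ?t}"
  have 1: "(\<Sum>i=?s..n - ?t. fls_nth f i * fls_nth g (n - i)) = (\<Sum>i\<in>?S. fls_nth f i * fls_nth g (n - i))"
  proof (rule sum.mono_neutral_left)
    show "\<forall>i\<in>?S - {?s..n - ?t}. fls_nth f i * fls_nth g (n - i) = 0"
    proof
      fix i assume "i \<in> ?S - {?s..n - ?t}"
      then have "i < ?s \<or> n - i < ?t" by auto
      then show "fls_nth f i * fls_nth g (n - i) = 0" by (auto simp: fls_eq0_below_subdegree)
    qed
  qed auto
  have 2: "(\<Sum>i=df..n - dg. fls_nth f i * fls_nth g (n - i)) = (\<Sum>i\<in>?S. fls_nth f i * fls_nth g (n - i))"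
  proof (rule sum.mono_neutral_left)
    show "\<forall>i\<in>?S - {df..n - dg}. fls_nth f i * fls_nth g (n - i) = 0"
    proof
      fix i assume "i \<in> ?S - {df..n - dg}"
      then have "i < df \<or> n - i < dg" by auto
      then show "fls_nth f i * fls_nth g (n - i) = 0" using f g by auto
    qed
  qed auto
  show ?thesis unfolding fls_times_nth(2) 1 2 ..
qed

text \<open>\<open>prel x y F G\<close>: \<open>F\<close> is a polynomial in the power sums whose specialization at \<open>(x, y)\<close> is \<open>G\<close>.\<close>

inductive prel :: "'a::field_char_0 \<Rightarrow> 'a \<Rightarrow> ratfun symfun \<Rightarrow> 'a symfun \<Rightarrow> bool" for x y where
  prel_const: "rval x y c d \<Longrightarrow> prel x y (const_sf c) (const_sf d)"
| prel_power: "k \<ge> 1 \<Longrightarrow> prel x y (power_sf k) (power_sf k)"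
| prel_add: "prel x y F F' \<Longrightarrow> prel x y G G' \<Longrightarrow> prel x y (F + G) (F' + G')"
| prel_mult: "prel x y F F' \<Longrightarrow> prel x y G G' \<Longrightarrow> prel x y (F * G) (F' * G')"

lemma prel_0: "prel x y 0 0"
  using prel_const[OF rval_0] by simp

lemma prel_1: "prel x y 1 1"
  using prel_const[OF rval_1] by simp

lemma prel_uminus: "prel x y F G \<Longrightarrow> prel x y (- F) (- G)"
  using prel_mult[OF prel_const[OF rval_uminus[OF rval_1]]] by (fastforce simp: const_sf_uminus)

lemma prel_diff: "prel x y F F' \<Longrightarrow> prel x y G G' \<Longrightarrow> prel x y (F - G) (F' - G')"
  using prel_add[OF _ prel_uminus] by fastforce

lemma prel_sum: "(\<And>i. i \<in> I \<Longrightarrow> prel x y (f i) (g i)) \<Longrightarrow> prel x y (\<Sum>i\<in>I. f i) (\<Sum>i\<in>I. g i)"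
  by (induction I rule: infinite_finite_induct) (auto intro: prel_0 prel_add)

lemma prel_neg1_power: "prel x y ((- 1) ^ n) ((- 1) ^ n)"
  by (induction n) (auto intro: prel_1 prel_uminus)

lemma elem_sf_0: "elem_sf 0 = (1 :: 'k::comm_ring_1 symfun)"
  by (rule symfun_eqI) (auto simp: coeff_sf_simps)

lemma elem_sf_rec:
  assumes "n \<noteq> 0"
  shows "elem_sf n = const_sf (inverse (of_nat n))
    * (\<Sum>k=1..n. (- 1) ^ (k - 1) * power_sf k * elem_sf (n - k) :: 'k::field_char_0 symfun)"
proof -
  have "(\<Sum>k=1..n. (- 1) ^ (k - 1) * power_sf k * elem_sf (n - k) :: 'k symfun) = const_sf (of_nat n) * elem_sf n"
    using newton_rec[OF newton_elem_sf[where 'k = 'k], of n, symmetric] by (simp add: const_sf_of_nat)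
  then show ?thesis using assms by simp
qed

lemma prel_elem_sf: "prel x y (elem_sf n) (elem_sf n)"
proof (induction n rule: less_induct)
  case (less n)
  show ?case
  proof (cases "n = 0")
    case True
    then show ?thesis by (simp add: elem_sf_0 prel_1)
  next
    case False
    have "rval x y (inverse (of_nat n)) (inverse (of_nat n))"
      using False by (intro rval_inverse rval_of_nat) simp
    then show ?thesis unfolding elem_sf_rec[OF False]
      by (intro prel_mult prel_const prel_sum prel_neg1_power prel_power less) auto
  qed
qed

lemma prel_coeff: "prel x y F G \<Longrightarrow> rval x y (coeff_sf F m) (coeff_sf G m)"
proof (induction arbitrary: m rule: prel.induct)
  case (prel_mult F F' G G')
  have "rval x y (\<Sum>p | fst p + snd p = m. coeff_sf F (fst p) * coeff_sf G (snd p))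
    (\<Sum>p | fst p + snd p = m. coeff_sf F' (fst p) * coeff_sf G' (snd p))"
    by (intro rval_sum rval_mult prel_mult.IH)
  then show ?case by (simp add: times_symfun.rep_eq case_prod_unfold)
qed (auto simp: coeff_sf_simps intro: rval_add rval_0 rval_1)

lemma prel_specialize:
  assumes "prel q_gen (1 / q_gen) F G"
  shows "specializable F" "specialize F = G"
  using rvalD[OF prel_coeff[OF assms]]
  by (auto simp: specializable_def subst_sf_defined_def specialize_def subst_sf.rep_eq intro: symfun_eqI)

text \<open>The subdegree of a Laurent series may change under specialization, so both products are
  first written as sums over a common range of indices.\<close>

lemma prel_fls_mult:
  assumes "\<And>i. prel x y (fls_nth f i) (fls_nth f' i)" "\<And>i. prel x y (fls_nth g i) (fls_nth g' i)"
  shows "prel x y (fls_nth (f * g) n) (fls_nth (f' * g') n)"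
proof -
  let ?df = "min (fls_subdegree f) (fls_subdegree f')" and ?dg = "min (fls_subdegree g) (fls_subdegree g')"
  have "fls_nth (f * g) n = (\<Sum>i=?df..n - ?dg. fls_nth f i * fls_nth g (n - i))"
    by (rule fls_times_nth_bounds) (auto simp: fls_eq0_below_subdegree)
  moreover have "fls_nth (f' * g') n = (\<Sum>i=?df..n - ?dg. fls_nth f' i * fls_nth g' (n - i))"
    by (rule fls_times_nth_bounds) (auto simp: fls_eq0_below_subdegree)
  ultimately show ?thesis by (simp only:) (intro prel_sum prel_mult assms)
qed

lemma prel_sf_shift:
  "prel x y F G \<Longrightarrow> prel x y (fls_nth (sf_shift q_var t_var F) i) (fls_nth (sf_shift x y G) i)"
proof (induction arbitrary: i rule: prel.induct)
  case (prel_const c d)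
  then show ?case by (auto simp: sf_shift_const intro: prel.prel_const prel_0)
next
  case (prel_power k)
  have "rval x y ((1 - q_var ^ k) * (1 - t_var ^ k)) ((1 - x ^ k) * (1 - y ^ k))"
    by (intro rval_mult rval_diff rval_1 rval_power rval_q_var rval_t_var)
  then have "prel x y (const_sf ((1 - q_var ^ k) * (1 - t_var ^ k))) (const_sf ((1 - x ^ k) * (1 - y ^ k)))"
    by (rule prel.prel_const)
  then show ?case using prel.prel_power[OF prel_power] prel_0
    by (auto simp: sf_shift_power_sf[OF prel_power] intro!: prel_add)
next
  case (prel_add F F' G G')
  then show ?case by (auto simp: sf_shift.hom_add intro: prel.prel_add)
next
  case (prel_mult F F' G G')
  then show ?case unfolding sf_shift.hom_mult by (intro prel_fls_mult) auto
qed

lemma prel_macD: "prel x y F G \<Longrightarrow> prel x y (macD q_var t_var F) (macD x y G)"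
  unfolding macD_def Dz_def
proof (rule prel_fls_mult)
  show "prel x y F G \<Longrightarrow> prel x y (fls_nth (sf_shift q_var t_var F) i) (fls_nth (sf_shift x y G) i)" for i
    by (rule prel_sf_shift)
  show "prel x y (fls_nth (fps_to_fls exp_neg) i) (fls_nth (fps_to_fls exp_neg) i)" for i
    by (auto simp: exp_neg_def intro: prel_0 prel_mult prel_neg1_power prel_elem_sf)
qed

lemma prel_macD_prod:
  assumes "list_all2 (rval x y) cs ds" "prel x y F G"
  shows "prel x y (macD_prod q_var t_var cs F) (macD_prod x y ds G)"
  using assms(1) by (induction rule: list_all2_induct)
    (auto intro: prel_diff prel_macD prel_mult prel_const assms(2))

text \<open>The only denominators are differences of eigenvalues, whose specializations are nonzero
  by the injectivity of \<open>\<beta>'\<close>.\<close>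

lemma prel_lagr:
  assumes "distinct Ks" "inj_on \<beta>' (set Ks)" and \<beta>: "\<And>K. K \<in> set Ks \<Longrightarrow> rval x y (\<beta> K) (\<beta>' K)"
    and f: "\<And>K. K \<in> set Ks \<Longrightarrow> rval x y (f K) (f' K)" and F: "prel x y F G"
  shows "prel x y (lagr q_var t_var \<beta> f Ks F) (lagr x y \<beta>' f' Ks G)"
  unfolding lagr_def
proof (intro prel_sum prel_mult prel_const rval_mult f prel_macD_prod F)
  fix K assume K: "K \<in> set Ks"
  have sub: "set (remove1 K Ks) \<subseteq> set Ks - {K}" using assms(1) by simp
  then show "list_all2 (rval x y) (map \<beta> (remove1 K Ks)) (map \<beta>' (remove1 K Ks))"
    by (auto simp: list_all2_conv_all_nth intro!: \<beta>) (meson Diff_subset nth_mem subsetD)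
  have "rval x y (\<Prod>J\<leftarrow>Js. inverse (\<beta> K - \<beta> J)) (\<Prod>J\<leftarrow>Js. inverse (\<beta>' K - \<beta>' J))"
    if "set Js \<subseteq> set Ks - {K}" for Js
    using that
  proof (induction Js)
    case (Cons J Js)
    then have "\<beta>' K - \<beta>' J \<noteq> 0" using assms(2) K by (auto dest: inj_onD)
    then show ?case using Cons K by (auto intro!: rval_mult rval_inverse rval_diff \<beta>)
  qed (simp add: rval_1)
  then show "rval x y (\<Prod>J\<leftarrow>remove1 K Ks. inverse (\<beta> K - \<beta> J)) (\<Prod>J\<leftarrow>remove1 K Ks. inverse (\<beta>' K - \<beta>' J))"
    using sub by blast
qed

lemma Delta_op_eq_lagr:
  assumes Ks: "distinct Ks" "set Ks = {K \<in> pos_msets. sum_mset K = n}" and F: "homogeneous_sf n F"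
  shows "Delta_op f F = lagr q_var t_var (\<lambda>K. beta q_var t_var (plist K)) (f_val f) Ks F"
proof -
  have "mprod power_sf ` set Ks \<subseteq> sf.span (mac.evec ` set Ks)"
  proof clarify
    fix K assume "K \<in> set Ks"
    then show "mprod power_sf K \<in> sf.span (mac.evec ` set Ks)" using mac.power_in_span_evec[of K] Ks(2) by auto
  qed
  then have "F \<in> sf.span (mac.evec ` set Ks)"
    using homogeneous_span_power_sf[OF F] span_subset_span unfolding Ks(2)[symmetric] by blast
  moreover have "Delta_op f v = lagr q_var t_var (\<lambda>K. beta q_var t_var (plist K)) (f_val f) Ks v"
    if v: "v \<in> mac.evec ` set Ks" for v
  proof -
    obtain L where L: "v = mac.evec L" "L \<in> set Ks" using v by blast
    then have pos: "0 \<notin># L" using Ks(2) by blast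
    have "inj_on (\<lambda>K. beta q_var t_var (plist K)) (set Ks)"
      by (rule inj_onI) (use mac.eigval_inject Ks(2) in auto)
    then have "lagr q_var t_var (\<lambda>K. beta q_var t_var (plist K)) (f_val f) Ks v = const_sf (f_val f L) * v"
      unfolding L(1) by (intro lagr_eigen Ks(1) L(2) mac.evec(2) pos)
    then show ?thesis using Delta_op_evec(2)[OF pos] L(1) by simp
  qed
  ultimately show ?thesis by (rule linear_sf_eq_on_span[OF Delta_op_evec(1) linear_lagr, rotated])
qed

lemma rval_f_val_elem:
  "rval x y (f_val (elem_sf n) L) (fps_nth (\<Prod>c\<in>cells (plist L). 1 + fps_const (cell_weight x y c) * fps_X) n)"
proof -
  have "rval x y (fps_nth (\<Prod>c\<in>C. 1 + fps_const (cell_weight q_var t_var c) * fps_X) n)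
      (fps_nth (\<Prod>c\<in>C. 1 + fps_const (cell_weight x y c) * fps_X) n)" if "finite C" for C n
    using that
  proof (induction C arbitrary: n)
    case empty
    show ?case by (cases n) (auto intro: rval_0 rval_1)
  next
    case (insert c C)
    have c: "rval x y (cell_weight q_var t_var c) (cell_weight x y c)"
      by (intro rval_mult rval_power rval_q_var rval_t_var)
    show ?case
    proof (cases n)
      case 0
      then show ?thesis using insert by (simp add: distrib_right mult.assoc)
    next
      case (Suc m)
      then show ?thesis using rval_add[OF insert.IH[of n] rval_mult[OF c insert.IH[of m]]] insert.hyps
        by (simp add: distrib_right mult.assoc)
    qed
  qed
  then show ?thesis by (simp add: sf_alphabet_elem_sf)
qed

subsection \<open>Hooks at \<open>t = 1/q\<close>\<close>

text \<open>\<open>eps a\<close> is the series \<open>\<Sum>\<^sub>n e\<^sub>n[X / (1 - a)] z\<^sup>n\<close>.\<close>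

definition eps :: "'k::field_char_0 \<Rightarrow> 'k symfun fps" where
  "eps a = Abs_fps (\<lambda>n. unscale a (elem_sf n))"

definition eps_neg :: "'k::field_char_0 \<Rightarrow> 'k symfun fps" where
  "eps_neg a = Abs_fps (\<lambda>n. (- 1) ^ n * fps_nth (eps a) n)"

lemma newton_eps: "newton (\<lambda>k. (- 1) ^ (k - 1) * (const_sf (1 / (1 - a ^ k)) * power_sf k)) (eps a)"
proof -
  have "newton (\<lambda>k. unscale a ((- 1) ^ (k - 1) * power_sf k)) (eps a)"
    using newton_hom[OF sf_homD(1)[OF sf_hom_unscale] newton_elem_sf] by (simp add: eps_def)
  then show ?thesis
    by (rule newton_cong) (simp add: unscale.hom_mult unscale.hom_power unscale.hom_uminus unscale_power_sf)
qed

lemma neg_one_power_mult_cancel: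
  assumes "k \<ge> 1"
  shows "(- 1) ^ k * ((- 1) ^ (k - 1) * F) = - (F :: 'a::comm_ring_1)"
proof -
  obtain j where "k = Suc j" using assms by (cases k) auto
  moreover have "(- 1) ^ j * ((- 1) ^ j * F) = F"
    by (simp add: mult.assoc[symmetric] power_mult_distrib[symmetric])
  ultimately show ?thesis by simp
qed

text \<open>The identity H(z) E(-z) = 1 under X -> X/(1 - a).\<close>

lemma eta_eps_neg: "eta a * eps_neg a = 1"
proof (rule newton_unique_symfun)
  have "newton (\<lambda>k. (- 1) ^ k * ((- 1) ^ (k - 1) * (const_sf (1 / (1 - a ^ k)) * power_sf k))) (eps_neg a)"
    using newton_scale[OF newton_eps, of "- 1"] by (simp add: eps_neg_def)
  from newton_mult[OF newton_eta this]
  show "newton (\<lambda>k. 0) (eta a * eps_neg a)"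
    by (rule newton_cong) (simp only: neg_one_power_mult_cancel, simp)
  show "newton (\<lambda>k. 0) (1 :: 'a symfun fps)" by (rule newton_1)
qed

text \<open>As for \<open>eta\<close>, with the signs of the even power sums reversed: the factor is
  now (1 + u/z)/(1 + b u/z).\<close>

lemma sf_shift_eps_fps:
  assumes "\<forall>k\<ge>1. a ^ k \<noteq> 1"
  shows "Abs_fps (\<lambda>n. sf_shift a b (fps_nth (eps a) n)) = Abs_fps (\<lambda>n. fls_const (fps_nth (eps a) n))
    * ((1 + fps_const fls_X_inv * fps_X) * Abs_fps (\<lambda>n. (- (fls_const (const_sf b) * fls_X_inv)) ^ n))"
proof (rule newton_unique[OF torsion_free_fls_symfun])
  let ?w = "fls_const (const_sf b) * fls_X_inv"
  let ?Q = "\<lambda>k. (- 1) ^ (k - 1) * (const_sf (1 / (1 - a ^ k)) * power_sf k)"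
  let ?P = "\<lambda>k. fls_const (?Q k) + ((- 1) ^ (k - 1) * fls_X_inv ^ k + (- ?w) ^ k)"
  have hom: "comm_ring_hom (fls_const :: 'a symfun \<Rightarrow> _)"
    by unfold_locales (simp_all add: fls_plus_const)
  interpret c: comm_ring_hom "fls_const :: 'a symfun \<Rightarrow> _" by (rule hom)
  show "newton ?P (Abs_fps (\<lambda>n. fls_const (fps_nth (eps a) n))
    * ((1 + fps_const fls_X_inv * fps_X) * Abs_fps (\<lambda>n. (- ?w) ^ n)))"
    by (intro newton_mult newton_linear newton_geometric newton_hom[OF hom newton_eps])
  have "newton (\<lambda>k. sf_shift a b (?Q k)) (Abs_fps (\<lambda>n. sf_shift a b (fps_nth (eps a) n)))"
    by (rule newton_hom[OF sf_homD(1)[OF sf_hom_sf_shift] newton_eps])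
  then show "newton ?P (Abs_fps (\<lambda>n. sf_shift a b (fps_nth (eps a) n)))"
  proof (rule newton_cong)
    fix k :: nat assume k: "k \<ge> 1"
    have "sf_shift a b (const_sf (1 / (1 - a ^ k)) * power_sf k)
        = fls_const (const_sf (1 / (1 - a ^ k)) * power_sf k) + fls_const (const_sf (1 - b ^ k)) * fls_X_inv ^ k"
      by (simp add: sf_shift.hom_mult sf_shift_const sf_shift_power_sf[OF k] distrib_left
          mult.assoc[symmetric] const_sf_mult[symmetric] assms[rule_format, OF k])
    then have "sf_shift a b (?Q k) = fls_const (?Q k) + (- 1) ^ (k - 1) * (fls_const (const_sf (1 - b ^ k)) * fls_X_inv ^ k)"
      unfolding sf_shift.hom_mult[of a b "(- 1) ^ (k - 1)"] sf_shift.hom_power sf_shift.hom_uminus sf_shift.hom_one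
        c.hom_mult[of "(- 1) ^ (k - 1)"] c.hom_power c.hom_uminus c.hom_one by (simp only: distrib_left)
    moreover have "fls_const (const_sf (1 - b ^ k)) * fls_X_inv ^ k = fls_X_inv ^ k - ?w ^ k"
      by (simp add: power_mult_distrib fls_const_power const_sf_power const_sf_diff
          fls_minus_const[symmetric] left_diff_distrib)
    moreover have "(- 1) ^ (k - 1) * ?w ^ k = - ((- ?w) ^ k)"
      using neg_one_power_times_neg_power[OF k, of "- ?w"] by (simp only: minus_minus)
    ultimately show "sf_shift a b (?Q k) = ?P k" by (simp only: right_diff_distrib) simp
  qed
qed

text \<open>With w = u/z the factor (1 + w)/(1 + b w) has the coefficient (1 - b)(-b)^(n-1) at w^n
  for n >= 1. In contrast to \<open>eta\<close>, the weight depends on n.\<close>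

lemma sf_shift_eps_nth:
  assumes "\<forall>k\<ge>1. a ^ k \<noteq> 1"
  shows "fls_nth (sf_shift a b (fps_nth (eps a) r)) i
    = (if i = 0 then fps_nth (eps a) r
       else if i < 0 \<and> nat (- i) \<le> r then const_sf ((1 - b) * (- b) ^ (nat (- i) - 1)) * fps_nth (eps a) (r - nat (- i)) else 0)"
proof -
  let ?w = "fls_const (const_sf b) * fls_X_inv"
  have G: "fps_nth ((1 + fps_const fls_X_inv * fps_X) * Abs_fps (\<lambda>n. (- ?w) ^ n)) n
      = (if n = 0 then 1 else fls_const (const_sf ((1 - b) * (- b) ^ (n - 1))) * fls_X_inv ^ n)" for n
  proof (cases n)
    case (Suc m)
    have w: "- ?w = fls_const (const_sf (- b)) * fls_X_inv"
      by (simp add: const_sf_uminus)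
    have "fps_nth ((1 + fps_const fls_X_inv * fps_X) * Abs_fps (\<lambda>n. (- ?w) ^ n)) n = (- ?w) ^ Suc m + fls_X_inv * (- ?w) ^ m"
      by (simp add: Suc distrib_right mult.assoc)
    also have "\<dots> = (fls_const (const_sf (- b)) + 1) * fls_const (const_sf ((- b) ^ m)) * fls_X_inv ^ Suc m"
      unfolding w by (simp add: power_mult_distrib fls_const_power const_sf_power algebra_simps)
    also have "fls_const (const_sf (- b)) + 1 = fls_const (const_sf (1 - b))"
      by (rule fls_eqI) (simp add: const_sf_diff const_sf_uminus)
    finally show ?thesis by (simp add: Suc const_sf_mult flip: fls_const_mult_const)
  qed simp
  have "sf_shift a b (fps_nth (eps a) r) = (\<Sum>j=0..r. fls_const (fps_nth (eps a) j)
      * (if r - j = 0 then 1 else fls_const (const_sf ((1 - b) * (- b) ^ (r - j - 1))) * fls_X_inv ^ (r - j)))"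
    using arg_cong[OF sf_shift_eps_fps[OF assms, of b], of "\<lambda>f. fps_nth f r"]
    unfolding fps_mult_nth[of "Abs_fps (\<lambda>n. fls_const (fps_nth (eps a) n))"] G by simp
  then have "fls_nth (sf_shift a b (fps_nth (eps a) r)) i = (\<Sum>j=0..r. fps_nth (eps a) j
      * (if i = - int (r - j) then if r = j then 1 else const_sf ((1 - b) * (- b) ^ (r - j - 1)) else 0))"
    by (simp add: fls_nth_sum) (intro sum.cong refl, auto)
  also have "\<dots> = (\<Sum>j\<in>(if i \<le> 0 \<and> nat (- i) \<le> r then {r - nat (- i)} else {}). fps_nth (eps a) j
      * (if i = - int (r - j) then if r = j then 1 else const_sf ((1 - b) * (- b) ^ (r - j - 1)) else 0))"
    by (rule sum.mono_neutral_right) (auto split: if_splits)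
  also have "\<dots> = (if i = 0 then fps_nth (eps a) r
       else if i < 0 \<and> nat (- i) \<le> r then const_sf ((1 - b) * (- b) ^ (nat (- i) - 1)) * fps_nth (eps a) (r - nat (- i)) else 0)"
    by (auto simp: mult.commute)
  finally show ?thesis .
qed

text \<open>At \<open>b = 1/a\<close> the functions \<open>W r m\<close>, i.e. \<open>s\<^bsub>(r,1^m)\<^esub>[X / (1 - a)]\<close>, diagonalize \<open>macD\<close>.\<close>

locale hook =
  fixes a b :: "'k::field_char_0"
  assumes a_pow: "\<forall>k\<ge>1. a ^ k \<noteq> 1" and ab: "a * b = 1"
begin

abbreviation "\<eta> \<equiv> fps_nth (eta a)"
abbreviation "\<epsilon> \<equiv> fps_nth (eps a)"

lemma ab_power: "a ^ (k + m) * b ^ k = a ^ m" "(- b) ^ (k + m) * (- a) ^ k = (- b) ^ m"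
proof -
  have "a ^ k * b ^ k = 1" "(- b) ^ k * (- a) ^ k = 1"
    using ab by (simp_all add: power_mult_distrib[symmetric] mult.commute)
  then show "a ^ (k + m) * b ^ k = a ^ m" "(- b) ^ (k + m) * (- a) ^ k = (- b) ^ m"
    by (simp_all add: power_add algebra_simps)
qed

definition eps_scaled :: "'k symfun fps" where
  "eps_scaled = Abs_fps (\<lambda>n. const_sf ((- a) ^ n) * \<epsilon> n)"

definition eps_tail :: "nat \<Rightarrow> 'k symfun fps" where
  "eps_tail m = Abs_fps (\<lambda>k. if k = 0 then 0 else const_sf ((- a) ^ k) * \<epsilon> (m + k))"

text \<open>Since ab = 1, the weight (-b)^k at z^(-k) equals (-b)^m (-a)^(m-k), so the negative
  powers belong to one series \<open>eps_scaled\<close> divided by z^m. As for \<open>eta\<close>,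
  this series is completed and its positive part is subtracted.\<close>

lemma sf_shift_eps: "sf_shift a b (\<epsilon> m) = fls_const (const_sf a * \<epsilon> m)
  - fls_const (const_sf (a - 1)) * (fls_const (const_sf ((- b) ^ m)) * (fls_X_inv ^ m * fps_to_fls eps_scaled)
      - fps_to_fls (eps_tail m))"
proof (rule fls_eqI)
  fix i :: int
  have lhs: "fls_nth (sf_shift a b (\<epsilon> m)) i = (if i = 0 then \<epsilon> m
       else if i < 0 \<and> nat (- i) \<le> m then const_sf ((1 - b) * (- b) ^ (nat (- i) - 1)) * \<epsilon> (m - nat (- i)) else 0)"
    by (rule sf_shift_eps_nth[OF a_pow])
  have rhs: "fls_nth (fls_const (const_sf a * \<epsilon> m)
    - fls_const (const_sf (a - 1)) * (fls_const (const_sf ((- b) ^ m)) * (fls_X_inv ^ m * fps_to_fls eps_scaled)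
      - fps_to_fls (eps_tail m))) i
    = (if i = 0 then const_sf a * \<epsilon> m else 0) - const_sf (a - 1) * (const_sf ((- b) ^ m) *
        (if i + int m < 0 then 0 else const_sf ((- a) ^ nat (i + int m)) * \<epsilon> (nat (i + int m)))
        - (if i < 0 then 0 else fps_nth (eps_tail m) (nat i)))"
    unfolding fls_minus_nth fls_mult_const_nth fls_X_inv_power_times_conv_shift fls_shift_nth fps_to_fls_nth fls_const_nth
      by (simp add: eps_scaled_def)
  show "fls_nth (sf_shift a b (\<epsilon> m)) i = fls_nth (fls_const (const_sf a * \<epsilon> m)
    - fls_const (const_sf (a - 1)) * (fls_const (const_sf ((- b) ^ m)) * (fls_X_inv ^ m * fps_to_fls eps_scaled)
      - fps_to_fls (eps_tail m))) i"
  proof (cases "i \<ge> 0")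
    case True
    then obtain k where k: "i = int k" by (metis nonneg_int_cases)
    have "const_sf ((- b) ^ m) * (const_sf ((- a) ^ (m + k)) * \<epsilon> (m + k)) = const_sf ((- a) ^ k) * \<epsilon> (m + k)"
      using ab_power(2)[of m 0] by (simp add: mult.assoc[symmetric] const_sf_mult[symmetric] power_add)
    moreover have "nat (i + int m) = m + k" using k by simp
    ultimately show ?thesis unfolding lhs rhs using k
      by (cases "k = 0") (simp_all add: eps_tail_def const_sf_diff algebra_simps)
  next
    case False
    define k where "k = nat (- i)"
    have k: "i = - int k" "k \<ge> 1" using False by (simp_all add: k_def)
    show ?thesis
    proof (cases "k \<le> m")
      case True
      then obtain l where l: "m = l + k" by (metis le_add_diff_inverse2)
      have "(- b) ^ m * (- a) ^ l = (- b) ^ k" using ab_power(2)[of l k] by (simp add: l)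
      moreover have "(1 - b) * (- b) ^ (k - 1) = - ((a - 1) * (- b) ^ k)"
      proof -
        obtain j where j: "k = Suc j" using k(2) by (cases k) auto
        have "- ((a - 1) * (- b)) = 1 - b" using ab by (simp add: algebra_simps)
        then show ?thesis unfolding j by (simp only: power_Suc mult.assoc[symmetric] diff_Suc_1 mult_minus_left[symmetric]) 
      qed
      moreover have "nat (i + int m) = l" "nat (- i) = k" "m - k = l" using k l by auto
      ultimately show ?thesis unfolding lhs rhs using k l
        by (simp add: mult.assoc[symmetric] const_sf_mult[symmetric] const_sf_uminus)
    next
      case False
      then show ?thesis unfolding lhs rhs using k by simp
    qed
  qed
qed

text \<open>\<open>eps_scaled\<close> is eps(-az), the inverse of eta(az), and eta(az) = eta(z)
  \<open>exp_neg\<close>. What remains is the inverse of eta(z).\<close>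

lemma eps_scaled_exp_neg: "eps_scaled * exp_neg = eps_neg a"
proof -
  have hom: "Abs_fps (\<lambda>n. const_sf (a ^ n) * fps_nth (F * G) n)
      = Abs_fps (\<lambda>n. const_sf (a ^ n) * fps_nth F n) * Abs_fps (\<lambda>n. const_sf (a ^ n) * fps_nth G n)" for F G
  proof (rule fps_ext)
    fix n
    show "fps_nth (Abs_fps (\<lambda>n. const_sf (a ^ n) * fps_nth (F * G) n)) n
      = fps_nth (Abs_fps (\<lambda>n. const_sf (a ^ n) * fps_nth F n) * Abs_fps (\<lambda>n. const_sf (a ^ n) * fps_nth G n)) n"
      unfolding fps_nth_Abs_fps fps_mult_nth sum_distrib_left
    proof (rule sum.cong[OF refl])
      fix i assume "i \<in> {0..n}"
      then have "a ^ n = a ^ i * a ^ (n - i)" by (simp flip: power_add)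
      then show "const_sf (a ^ n) * (fps_nth F i * fps_nth G (n - i))
          = const_sf (a ^ i) * fps_nth F i * (const_sf (a ^ (n - i)) * fps_nth G (n - i))"
        by (simp only: const_sf_mult mult_ac)
    qed
  qed
  have "eps_scaled = Abs_fps (\<lambda>n. const_sf (a ^ n) * fps_nth (eps_neg a) n)"
    unfolding eps_scaled_def eps_neg_def
    by (simp add: power_minus[of a] const_sf_mult const_sf_power const_sf_uminus mult_ac)
  then have "eps_scaled * eta_scaled a = Abs_fps (\<lambda>n. const_sf (a ^ n) * fps_nth (eps_neg a * eta a) n)"
    unfolding eta_scaled_def hom by simp
  also have "eps_neg a * eta a = 1" using eta_eps_neg[of a] by (simp add: mult.commute)
  also have "Abs_fps (\<lambda>n. const_sf (a ^ n) * fps_nth (1 :: 'k symfun fps) n) = 1" by (simp add: fps_eq_iff)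
  finally have 1: "eps_scaled * eta_scaled a = 1" .
  have "eps_scaled * exp_neg = eps_scaled * (eta a * exp_neg) * eps_neg a"
    using eta_eps_neg[of a] by (metis (no_types) mult.assoc mult.commute mult.right_neutral)
  also have "\<dots> = eps_neg a" unfolding eta_exp_neg[OF a_pow] eta_scaled_def[symmetric] 1 by simp
  finally show ?thesis .
qed

text \<open>After multiplication by \<open>exp_neg\<close> the completed series is eps(-z)/z^m, so
  each nonpositive degree receives a single term from it; the subtracted tail only has positive
  powers.\<close>

lemma D_low_eps: "D_low a b s (\<epsilon> m) = (if s = 0 then const_sf a * \<epsilon> m else 0)
  - (if s \<le> m then const_sf ((a - 1) * b ^ m * (- 1) ^ s) * \<epsilon> (m - s) else 0)"
proof -
  have "Dz a b (\<epsilon> m) = fls_const (const_sf a * \<epsilon> m) * fps_to_fls exp_neg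
    - fls_const (const_sf (a - 1)) * (fls_const (const_sf ((- b) ^ m)) * (fls_X_inv ^ m * fps_to_fls (eps_neg a))
      - fps_to_fls (eps_tail m * exp_neg))"
    unfolding Dz_def sf_shift_eps eps_scaled_exp_neg[symmetric] fls_times_fps_to_fls
    by (simp only: left_diff_distrib right_diff_distrib mult.assoc)
  then have D: "D_low a b s (\<epsilon> m) = const_sf a * \<epsilon> m * fls_nth (fps_to_fls exp_neg) (- int s)
    - const_sf (a - 1) * (const_sf ((- b) ^ m) * fls_nth (fps_to_fls (eps_neg a)) (- int s + int m)
      - fls_nth (fps_to_fls (eps_tail m * exp_neg)) (- int s))"
    by (simp only: D_low_def fls_minus_nth fls_mult_const_nth fls_X_inv_power_times_conv_shift fls_shift_nth)
  have t: "fls_nth (fps_to_fls (eps_tail m * exp_neg)) (- int s) = 0"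
    by (simp add: eps_tail_def)
  have e: "fls_nth (fps_to_fls exp_neg) (- int s) = (if s = 0 then 1 else (0 :: 'k symfun))"
  proof -
    have "fps_nth exp_neg 0 = (1 :: 'k symfun)" by (rule newton_0[OF newton_exp_neg])
    then show ?thesis by simp
  qed
  have n: "const_sf ((- b) ^ m) * fls_nth (fps_to_fls (eps_neg a)) (- int s + int m)
      = (if s \<le> m then const_sf (b ^ m * (- 1) ^ s) * \<epsilon> (m - s) else 0)"
  proof (cases "s \<le> m")
    case True
    then obtain l where l: "m = l + s" by (metis le_add_diff_inverse2)
    have "(- 1) ^ l * (- 1) ^ l = (1 :: 'k)" by (simp flip: power_mult_distrib)
    then have "(- b) ^ m * (- 1) ^ l = b ^ m * (- 1) ^ s"
      unfolding power_minus[of b] by (simp add: l power_add mult_ac)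
    then have "const_sf ((- b) ^ m) * ((- 1) ^ l * \<epsilon> l) = const_sf (b ^ m * (- 1) ^ s) * \<epsilon> l"
      unfolding const_sf_power[of "- 1" l, unfolded const_sf_uminus const_sf_1, symmetric]
      by (simp only: const_sf_mult[symmetric] mult.assoc[symmetric])
    moreover have "nat (- int s + int m) = l" "\<not> - int s + int m < 0" using l by auto
    ultimately show ?thesis using True l by (simp add: eps_neg_def)
  next
    case False
    then show ?thesis by simp
  qed
  show ?thesis unfolding D t e n
    by (simp add: const_sf_mult mult.assoc)
qed

definition W :: "nat \<Rightarrow> nat \<Rightarrow> 'k symfun" where
  "W r m = (\<Sum>i\<le>m. const_sf ((- 1) ^ i) * (\<eta> (r + i) * \<epsilon> (m - i)))"

text \<open>The Pieri rule h_r e_m = s_(r,1^m) + s_(r+1,1^(m-1)) for r, m >= 1, solved repeatedly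
  for the first hook, gives the alternating sum \<open>W\<close>. \<open>W_rest\<close> is the
  second summand, which is 0 for m = 0.\<close>

definition W_rest :: "nat \<Rightarrow> nat \<Rightarrow> 'k symfun" where
  "W_rest r m = (\<Sum>i=1..m. const_sf ((- 1) ^ (i - 1)) * (\<eta> (r + i) * \<epsilon> (m - i)))"

lemma W_rest_0: "W_rest r 0 = 0"
  by (simp add: W_rest_def)

lemma W_rest_Suc: "W_rest r (Suc m) = W (Suc r) m"
proof -
  have "W_rest r (Suc m) = (\<Sum>i\<le>m. const_sf ((- 1) ^ (Suc i - 1)) * (\<eta> (r + Suc i) * \<epsilon> (Suc m - Suc i)))"
    unfolding W_rest_def
    by (rule sum.reindex_bij_witness[where i = Suc and j = "\<lambda>i. i - 1"]) auto
  then show ?thesis by (simp add: W_def)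
qed

lemma eta_eps_eq: "\<eta> r * \<epsilon> m = W r m + W_rest r m"
proof -
  have split: "{..m} = insert 0 {1..m}" by auto
  have "(\<Sum>i=1..m. const_sf ((- 1) ^ i) * (\<eta> (r + i) * \<epsilon> (m - i))) = - W_rest r m"
    unfolding W_rest_def sum_negf[symmetric]
  proof (rule sum.cong[OF refl])
    fix i assume "i \<in> {1..m}"
    then obtain j where "i = Suc j" by (cases i) auto
    then show "const_sf ((- 1) ^ i) * (\<eta> (r + i) * \<epsilon> (m - i)) = - (const_sf ((- 1) ^ (i - 1)) * (\<eta> (r + i) * \<epsilon> (m - i)))"
      by (simp add: const_sf_uminus)
  qed
  then show ?thesis unfolding W_def split by simp
qed

text \<open>Each of the three terms of \<open>D_low_eta_times\<close> is a combination of the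
  product itself and of \<open>W_rest\<close>: because ab = 1, the powers of a and b in every sum
  depend on the summation index only through a sign.\<close>

lemma macD_eta_eps: "macD a b (\<eta> r * \<epsilon> m)
  = const_sf (1 - (1 - b) * b ^ m + (1 - b) * a ^ r) * (\<eta> r * \<epsilon> m)
    + const_sf ((1 - b) * (1 - b) * a ^ Suc r - (1 - b) * (a - 1) * b ^ m) * W_rest r m"
proof -
  have 1: "fls_nth (sf_shift a b (\<epsilon> m) * fps_to_fls (eta_scaled a)) (int r - int 0)
      = const_sf (a ^ r) * (\<eta> r * \<epsilon> m) + const_sf ((1 - b) * a ^ Suc r) * W_rest r m"
  proof -
    have nth: "fls_nth (sf_shift a b (\<epsilon> m)) i = (if i = 0 then \<epsilon> m
       else if i < 0 \<and> nat (- i) \<le> m then const_sf ((1 - b) * (- b) ^ (nat (- i) - 1)) * \<epsilon> (m - nat (- i)) else 0)" for i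
      by (rule sf_shift_eps_nth[OF a_pow])
    have "fls_nth (sf_shift a b (\<epsilon> m) * fps_to_fls (eta_scaled a)) (int r)
        = (\<Sum>i=- int m..int r. fls_nth (sf_shift a b (\<epsilon> m)) i * fls_nth (fps_to_fls (eta_scaled a)) (int r - i))"
      using fls_times_nth_bounds[of "- int m" "sf_shift a b (\<epsilon> m)" 0 "fps_to_fls (eta_scaled a)" "int r"]
      by (simp add: nth)
    also have "\<dots> = (\<Sum>i\<in>insert 0 ((\<lambda>k. - int k) ` {1..m}). fls_nth (sf_shift a b (\<epsilon> m)) i * fls_nth (fps_to_fls (eta_scaled a)) (int r - i))"
    proof (rule sum.mono_neutral_right)
      show "\<forall>i\<in>{- int m..int r} - insert 0 ((\<lambda>k. - int k) ` {1..m}).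
          fls_nth (sf_shift a b (\<epsilon> m)) i * fls_nth (fps_to_fls (eta_scaled a)) (int r - i) = 0"
      proof
        fix i assume i: "i \<in> {- int m..int r} - insert 0 ((\<lambda>k. - int k) ` {1..m})"
        have "i > 0"
        proof (rule ccontr)
          assume "\<not> i > 0"
          then have "i = - int (nat (- i))" "nat (- i) \<in> {1..m}" using i by auto
          then show False using i by blast
        qed
        then show "fls_nth (sf_shift a b (\<epsilon> m)) i * fls_nth (fps_to_fls (eta_scaled a)) (int r - i) = 0" by (simp add: nth)
      qed
    qed auto
    also have "\<dots> = \<epsilon> m * (const_sf (a ^ r) * \<eta> r)
        + (\<Sum>k=1..m. fls_nth (sf_shift a b (\<epsilon> m)) (- int k) * fls_nth (fps_to_fls (eta_scaled a)) (int r + int k))"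
      by (subst sum.insert) (auto simp: nth eta_scaled_def sum.reindex inj_on_def)
    also have "(\<Sum>k=1..m. fls_nth (sf_shift a b (\<epsilon> m)) (- int k) * fls_nth (fps_to_fls (eta_scaled a)) (int r + int k))
        = const_sf ((1 - b) * a ^ Suc r) * W_rest r m"
      unfolding W_rest_def sum_distrib_left
    proof (rule sum.cong[OF refl])
      fix k assume k: "k \<in> {1..m}"
      then obtain j where j: "k = Suc j" by (cases k) auto
      have "(- b) ^ j * a ^ (r + k) = (- 1) ^ j * a ^ Suc r"
        using ab_power(1)[of j "Suc r"] unfolding power_minus[of b] by (simp add: j mult_ac add_ac)
      then have c: "(1 - b) * (- b) ^ (k - 1) * a ^ (r + k) = (1 - b) * a ^ Suc r * (- 1) ^ (k - 1)"
        unfolding mult.assoc by (simp add: j mult.commute)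
      have "fls_nth (fps_to_fls (eta_scaled a)) (int r + int k) = const_sf (a ^ (r + k)) * \<eta> (r + k)"
        by (simp add: eta_scaled_def nat_add_distrib)
      moreover have "fls_nth (sf_shift a b (\<epsilon> m)) (- int k) = const_sf ((1 - b) * (- b) ^ (k - 1)) * \<epsilon> (m - k)"
        using k by (simp add: nth)
      ultimately have "fls_nth (sf_shift a b (\<epsilon> m)) (- int k) * fls_nth (fps_to_fls (eta_scaled a)) (int r + int k)
          = const_sf ((1 - b) * (- b) ^ (k - 1) * a ^ (r + k)) * (\<eta> (r + k) * \<epsilon> (m - k))"
        by (simp only: const_sf_mult mult_ac)
      then show "fls_nth (sf_shift a b (\<epsilon> m)) (- int k) * fls_nth (fps_to_fls (eta_scaled a)) (int r + int k)
          = const_sf ((1 - b) * a ^ Suc r) * (const_sf ((- 1) ^ (k - 1)) * (\<eta> (r + k) * \<epsilon> (m - k)))"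
        unfolding c by (simp only: const_sf_mult mult.assoc)
    qed
    finally show ?thesis by (simp add: mult_ac)
  qed
  have 2: "fls_nth (fps_to_fls (eta_tail a r) * Dz a b (\<epsilon> m)) (- int 0) = const_sf ((a - 1) * b ^ m) * W_rest r m"
  proof -
    let ?f = "fps_to_fls (eta_tail a r)" and ?g = "Dz a b (\<epsilon> m)"
    have g: "fls_nth ?g (- int s) = D_low a b s (\<epsilon> m)" for s by (simp add: D_low_def)
    have g0: "fls_nth ?g i = 0" if "i < - int m" for i
    proof -
      have "i = - int (nat (- i))" using that by simp
      then have "fls_nth ?g i = D_low a b (nat (- i)) (\<epsilon> m)" using g by metis
      then show ?thesis unfolding D_low_eps using that by simp
    qed
    have "fls_nth (?f * ?g) 0 = (\<Sum>i=0..int m. fls_nth ?f i * fls_nth ?g (0 - i))"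
      using fls_times_nth_bounds[of 0 ?f "- int m" ?g 0] g0 by simp
    also have "\<dots> = (\<Sum>i\<in>int ` {1..m}. fls_nth ?f i * fls_nth ?g (0 - i))"
    proof (rule sum.mono_neutral_right)
      show "\<forall>i\<in>{0..int m} - int ` {1..m}. fls_nth ?f i * fls_nth ?g (0 - i) = 0"
      proof
        fix i assume i: "i \<in> {0..int m} - int ` {1..m}"
        have "i = 0"
        proof (rule ccontr)
          assume "i \<noteq> 0"
          then have "i = int (nat i)" "nat i \<in> {1..m}" using i by auto
          then show False using i by blast
        qed
        then show "fls_nth ?f i * fls_nth ?g (0 - i) = 0" by (simp add: eta_tail_def)
      qed
    qed auto
    also have "\<dots> = (\<Sum>k=1..m. fls_nth ?f (int k) * D_low a b k (\<epsilon> m))"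
      by (simp add: sum.reindex g)
    also have "\<dots> = const_sf ((a - 1) * b ^ m) * W_rest r m"
      unfolding W_rest_def sum_distrib_left
    proof (rule sum.cong[OF refl])
      fix k assume k: "k \<in> {1..m}"
      then obtain j where j: "k = Suc j" by (cases k) auto
      have "D_low a b k (\<epsilon> m) = const_sf ((a - 1) * b ^ m * (- 1) ^ (k - 1)) * \<epsilon> (m - k)"
        unfolding D_low_eps using k j by (simp add: const_sf_uminus)
      moreover have "fls_nth ?f (int k) = \<eta> (r + k)" using k by (simp add: eta_tail_def)
      ultimately show "fls_nth ?f (int k) * D_low a b k (\<epsilon> m)
          = const_sf ((a - 1) * b ^ m) * (const_sf ((- 1) ^ (k - 1)) * (\<eta> (r + k) * \<epsilon> (m - k)))"
        by (simp only: const_sf_mult mult_ac)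
    qed
    finally show ?thesis by simp
  qed
  have 3: "D_low a b 0 (\<epsilon> m) = const_sf (a - (a - 1) * b ^ m) * \<epsilon> m"
    unfolding D_low_eps by (simp add: const_sf_diff left_diff_distrib)
  have "macD a b (\<eta> r * \<epsilon> m) = const_sf b * (\<eta> r * (const_sf (a - (a - 1) * b ^ m) * \<epsilon> m))
    + const_sf (1 - b) * (const_sf (a ^ r) * (\<eta> r * \<epsilon> m) + const_sf ((1 - b) * a ^ Suc r) * W_rest r m
        - const_sf ((a - 1) * b ^ m) * W_rest r m)"
    using D_low_eta_times[OF a_pow, of b 0 r "\<epsilon> m"] unfolding 1 2 3 unfolding D_low_0 .
  also have "\<dots> = const_sf (b * (a - (a - 1) * b ^ m) + (1 - b) * a ^ r) * (\<eta> r * \<epsilon> m)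
    + const_sf ((1 - b) * ((1 - b) * a ^ Suc r) - (1 - b) * ((a - 1) * b ^ m)) * W_rest r m"
  proof -
    have alg: "B * (H * (X * E)) + C * (A * (H * E) + C * P * V - D * V) = (B * X + C * A) * (H * E) + (C * (C * P) - C * D) * V"
      for A B C D E H P V X :: "'k symfun"
      by (simp add: algebra_simps)
    show ?thesis
      unfolding const_sf_add const_sf_diff[of "(1 - b) * ((1 - b) * a ^ Suc r)"] const_sf_mult[of b] const_sf_mult[of "1 - b"]
      by (rule alg)
  qed
  also have "b * (a - (a - 1) * b ^ m) = 1 - (1 - b) * b ^ m"
  proof -
    have "b * (a - (a - 1) * b ^ m) = a * b - (a * b - b) * b ^ m" by (simp add: algebra_simps)
    then show ?thesis unfolding ab .
  qed
  finally show ?thesis by (simp only: mult.assoc)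
qed

text \<open>By the Pieri rule the product of \<open>\<eta> r\<close> and
  \<open>\<epsilon> (Suc m)\<close> is \<open>W r (Suc m) + W (Suc r) m\<close>. The second summand
  is an eigenvector by induction, and the two coefficients in \<open>macD_eta_eps\<close> add up to
  exactly its eigenvalue, so it drops out.\<close>

lemma macD_W: "macD a b (W r m) = const_sf (1 + (1 - b) * (a ^ r - b ^ m)) * W r m"
proof (induction m arbitrary: r)
  case 0
  have "W r 0 = \<eta> r * \<epsilon> 0" using eta_eps_eq[of r 0] by (simp add: W_rest_0)
  then show ?case using macD_eta_eps[of r 0] by (simp add: W_rest_0 algebra_simps)
next
  case (Suc m)
  let ?V = "W (Suc r) m"
  have s: "\<eta> r * \<epsilon> (Suc m) = W r (Suc m) + ?V" using eta_eps_eq[of r "Suc m"] by (simp add: W_rest_Suc)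
  let ?g = "1 - (1 - b) * b ^ Suc m + (1 - b) * a ^ r"
  let ?h = "(1 - b) * (1 - b) * a ^ Suc r - (1 - b) * (a - 1) * b ^ Suc m"
  have gh: "?g + ?h = 1 + (1 - b) * (a ^ Suc r - b ^ m)"
  proof -
    have "(1 - b) * a ^ Suc r = a ^ Suc r - a ^ r" "(a - 1) * b ^ Suc m = b ^ m - b ^ Suc m"
      using ab by (simp_all add: algebra_simps)
    then have "?g + ?h = 1 - (1 - b) * b ^ Suc m + (1 - b) * a ^ r + ((1 - b) * (a ^ Suc r - a ^ r) - (1 - b) * (b ^ m - b ^ Suc m))"
      by (simp only: mult.assoc)
    then show ?thesis by (simp only: right_diff_distrib) simp
  qed
  have "macD a b (W r (Suc m)) + macD a b ?V = const_sf ?g * (W r (Suc m) + ?V) + const_sf ?h * ?V"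
    using macD_eta_eps[of r "Suc m"] unfolding s W_rest_Suc macD_add .
  also have "\<dots> = const_sf ?g * W r (Suc m) + const_sf (?g + ?h) * ?V"
    by (simp only: const_sf_add distrib_left distrib_right add.assoc)
  finally have "macD a b (W r (Suc m)) = const_sf ?g * W r (Suc m)" unfolding gh Suc.IH by simp
  moreover have "?g = 1 + (1 - b) * (a ^ r - b ^ Suc m)" by (simp add: algebra_simps)
  ultimately show ?case by (simp only:)
qed

section \<open>Expansion of p_n and e_n in hooks\<close>

lemma sum_W:
  "(\<Sum>j<n. const_sf (c j) * W (n - j) j)
    = (\<Sum>l<n. const_sf (\<Sum>j=l..<n. c j * (- 1) ^ (j - l)) * (\<eta> (n - l) * \<epsilon> l))"
proof -
  have "(\<Sum>j<n. const_sf (c j) * W (n - j) j)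
      = (\<Sum>j<n. \<Sum>i\<le>j. const_sf (c j * (- 1) ^ i) * (\<eta> (n - j + i) * \<epsilon> (j - i)))"
    unfolding W_def sum_distrib_left by (simp only: const_sf_mult mult.assoc)
  also have "\<dots> = (\<Sum>j<n. \<Sum>l\<le>j. const_sf (c j * (- 1) ^ (j - l)) * (\<eta> (n - l) * \<epsilon> l))"
  proof (rule sum.cong[OF refl])
    fix j assume "j \<in> {..<n}"
    then show "(\<Sum>i\<le>j. const_sf (c j * (- 1) ^ i) * (\<eta> (n - j + i) * \<epsilon> (j - i)))
        = (\<Sum>l\<le>j. const_sf (c j * (- 1) ^ (j - l)) * (\<eta> (n - l) * \<epsilon> l))"
      by (intro sum.reindex_bij_witness[where i = "\<lambda>l. j - l" and j = "\<lambda>i. j - i"]) auto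
  qed
  also have "\<dots> = (\<Sum>l<n. \<Sum>j=l..<n. const_sf (c j * (- 1) ^ (j - l)) * (\<eta> (n - l) * \<epsilon> l))"
    unfolding sum.Sigma[OF finite_lessThan ballI[OF finite_atMost]] sum.Sigma[OF finite_lessThan ballI[OF finite_atLeastLessThan]]
    by (rule sum.reindex_bij_witness[where i = prod.swap and j = prod.swap]) auto
  also have "\<dots> = (\<Sum>l<n. const_sf (\<Sum>j=l..<n. c j * (- 1) ^ (j - l)) * (\<eta> (n - l) * \<epsilon> l))"
    by (simp only: const_sf_sum sum_distrib_right)
  finally show ?thesis .
qed

text \<open>The logarithmic derivative of eta is the series of the p_k/(1 - a^k), and 1/eta(z) =
  eps(-z). The factor n - l that the derivative puts on the product of \<open>\<eta> (n - l)\<close>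
  and \<open>\<epsilon> l\<close> is the number of hooks in which this product occurs.\<close>

lemma power_sf_W:
  assumes "n \<ge> 1"
  shows "power_sf n = const_sf (1 - a ^ n) * (\<Sum>j<n. const_sf ((- 1) ^ j) * W (n - j) j)"
proof -
  have inner: "(\<Sum>j=l..<n. (- 1) ^ j * (- 1) ^ (j - l)) = of_nat (n - l) * (- 1 :: 'k) ^ l" for l
  proof -
    have "(- 1) ^ j * (- 1) ^ (j - l) = (- 1 :: 'k) ^ l" if "j \<in> {l..<n}" for j
    proof -
      have "j = l + (j - l)" using that by simp
      then have "(- 1 :: 'k) ^ j = (- 1) ^ l * (- 1) ^ (j - l)" by (metis power_add)
      then show ?thesis by (simp add: mult.assoc power_mult_distrib[symmetric])
    qed
    then show ?thesis by simp
  qed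
  have eq: "fps_X * fps_deriv (eta a) = Abs_fps (\<lambda>k. if k = 0 then 0 else const_sf (1 / (1 - a ^ k)) * power_sf k) * eta a"
    using newton_eta[of a] by (simp add: newton_iff_deriv)
  have "fps_X * fps_deriv (eta a) * eps_neg a = Abs_fps (\<lambda>k. if k = 0 then 0 else const_sf (1 / (1 - a ^ k)) * power_sf k)"
    unfolding eq mult.assoc eta_eps_neg by simp
  then have "const_sf (1 / (1 - a ^ n)) * power_sf n = fps_nth (fps_X * fps_deriv (eta a) * eps_neg a) n"
    using assms by simp
  also have "\<dots> = (\<Sum>i=0..n. fps_nth (fps_X * fps_deriv (eta a)) i * fps_nth (eps_neg a) (n - i))"
    by (rule fps_mult_nth)
  also have "\<dots> = (\<Sum>l\<le>n. fps_nth (fps_X * fps_deriv (eta a)) (n - l) * fps_nth (eps_neg a) l)"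
    by (rule sum.reindex_bij_witness[where i = "\<lambda>l. n - l" and j = "\<lambda>i. n - i"]) auto
  also have "\<dots> = (\<Sum>l<n. fps_nth (fps_X * fps_deriv (eta a)) (n - l) * fps_nth (eps_neg a) l)"
    by (rule sum.mono_neutral_right) auto
  also have "\<dots> = (\<Sum>l<n. const_sf (of_nat (n - l) * (- 1) ^ l) * (\<eta> (n - l) * \<epsilon> l))"
  proof (rule sum.cong[OF refl])
    fix l assume "l \<in> {..<n}"
    then obtain d where d: "n - l = Suc d" by (metis Suc_diff_Suc lessThan_iff)
    have "fps_nth (fps_X * fps_deriv (eta a)) (n - l) = const_sf (of_nat (n - l)) * \<eta> (n - l)"
      unfolding d by (simp add: const_sf_of_nat del: of_nat_Suc)
    moreover have "fps_nth (eps_neg a) l = const_sf ((- 1) ^ l) * \<epsilon> l"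
      by (simp add: eps_neg_def const_sf_power const_sf_uminus)
    ultimately show "fps_nth (fps_X * fps_deriv (eta a)) (n - l) * fps_nth (eps_neg a) l
        = const_sf (of_nat (n - l) * (- 1) ^ l) * (\<eta> (n - l) * \<epsilon> l)"
      by (simp only: const_sf_mult mult_ac)
  qed
  also have "\<dots> = (\<Sum>j<n. const_sf ((- 1) ^ j) * W (n - j) j)"
    unfolding sum_W inner ..
  finally have "const_sf (1 - a ^ n) * (const_sf (1 / (1 - a ^ n)) * power_sf n)
      = const_sf (1 - a ^ n) * (\<Sum>j<n. const_sf ((- 1) ^ j) * W (n - j) j)" by (simp only:)
  moreover have "1 - a ^ n \<noteq> 0" using a_pow assms by auto
  ultimately show ?thesis by (simp add: divide_inverse)
qed

text \<open>The coefficient of z^n in (eta(z) - eta(az)) eps(-z) = 1 - \<open>exp_neg\<close>. The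
  factor 1 - a^(n-l) of a product is 1 - a times a geometric sum, taken over the hooks in which the
  product occurs.\<close>

lemma elem_sf_W:
  assumes "n \<ge> 1"
  shows "elem_sf n = const_sf (1 - a) * (\<Sum>j<n. const_sf ((- a) ^ (n - 1 - j)) * W (n - j) j)"
proof -
  have inner: "(1 - a) * (\<Sum>j=l..<n. (- a) ^ (n - 1 - j) * (- 1) ^ (j - l)) = (- 1) ^ (n - 1 - l) * (1 - a ^ (n - l))"
    if "l < n" for l
  proof -
    have "(\<Sum>j=l..<n. (- a) ^ (n - 1 - j) * (- 1) ^ (j - l)) = (\<Sum>j=l..<n. (- 1) ^ (n - 1 - l) * a ^ (n - 1 - j))"
    proof (rule sum.cong[OF refl])
      fix j assume j: "j \<in> {l..<n}"
      then have "n - 1 - l = (n - 1 - j) + (j - l)" by auto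
      then show "(- a) ^ (n - 1 - j) * (- 1) ^ (j - l) = (- 1) ^ (n - 1 - l) * a ^ (n - 1 - j)"
        unfolding power_minus[of a] by (simp add: power_add mult_ac)
    qed
    also have "\<dots> = (- 1) ^ (n - 1 - l) * (\<Sum>j=l..<n. a ^ (n - 1 - j))" by (simp add: sum_distrib_left)
    also have "(\<Sum>j=l..<n. a ^ (n - 1 - j)) = (\<Sum>i<n - l. a ^ i)"
      by (rule sum.reindex_bij_witness[where i = "\<lambda>i. n - 1 - i" and j = "\<lambda>j. n - 1 - j"]) (use that in auto)
    finally show ?thesis by (simp only: mult.left_commute[of "1 - a"] one_diff_power_eq)
  qed
  have "fps_nth (eta a * eps_neg a - eta_scaled a * eps_neg a) n = - fps_nth exp_neg n"
  proof -
    have "eta_scaled a * eps_neg a = exp_neg"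
      unfolding eta_scaled_def eta_exp_neg[OF a_pow, symmetric]
      using eta_eps_neg[of a] by (metis mult.assoc mult.commute mult.right_neutral)
    then show ?thesis unfolding eta_eps_neg using assms by simp
  qed
  also have "fps_nth exp_neg n = (- 1) ^ n * elem_sf n" by (simp add: exp_neg_def)
  finally have "- ((- 1) ^ n * elem_sf n) = fps_nth ((eta a - eta_scaled a) * eps_neg a) n"
    by (simp add: left_diff_distrib)
  also have "\<dots> = (\<Sum>i=0..n. fps_nth (eta a - eta_scaled a) i * fps_nth (eps_neg a) (n - i))"
    by (rule fps_mult_nth)
  also have "\<dots> = (\<Sum>l\<le>n. fps_nth (eta a - eta_scaled a) (n - l) * fps_nth (eps_neg a) l)"
    by (rule sum.reindex_bij_witness[where i = "\<lambda>l. n - l" and j = "\<lambda>i. n - i"]) auto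
  also have "\<dots> = (\<Sum>l<n. fps_nth (eta a - eta_scaled a) (n - l) * fps_nth (eps_neg a) l)"
    by (rule sum.mono_neutral_right) (auto simp: eta_scaled_def)
  also have "\<dots> = (\<Sum>l<n. const_sf ((1 - a ^ (n - l)) * (- 1) ^ l) * (\<eta> (n - l) * \<epsilon> l))"
  proof (rule sum.cong[OF refl])
    fix l
    have "fps_nth (eta a - eta_scaled a) (n - l) = const_sf (1 - a ^ (n - l)) * \<eta> (n - l)"
      by (simp add: eta_scaled_def const_sf_diff left_diff_distrib)
    moreover have "fps_nth (eps_neg a) l = const_sf ((- 1) ^ l) * \<epsilon> l"
      by (simp add: eps_neg_def const_sf_power const_sf_uminus)
    ultimately show "fps_nth (eta a - eta_scaled a) (n - l) * fps_nth (eps_neg a) l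
        = const_sf ((1 - a ^ (n - l)) * (- 1) ^ l) * (\<eta> (n - l) * \<epsilon> l)"
      by (simp only: const_sf_mult mult_ac)
  qed
  finally have e: "- ((- 1) ^ n * elem_sf n) = (\<Sum>l<n. const_sf ((1 - a ^ (n - l)) * (- 1) ^ l) * (\<eta> (n - l) * \<epsilon> l))" .
  have "elem_sf n = const_sf ((- 1) ^ (n - 1)) * - ((- 1) ^ n * elem_sf n)"
    unfolding const_sf_power const_sf_uminus const_sf_1 mult_minus_right mult.left_commute[of "(- 1) ^ (n - 1)"]
      neg_one_power_mult_cancel[OF assms] minus_minus ..
  also have "\<dots> = (\<Sum>l<n. const_sf ((1 - a) * (\<Sum>j=l..<n. (- a) ^ (n - 1 - j) * (- 1) ^ (j - l))) * (\<eta> (n - l) * \<epsilon> l))"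
    unfolding e sum_distrib_left[of "const_sf ((- 1) ^ (n - 1))"]
  proof (rule sum.cong[OF refl])
    fix l assume l: "l \<in> {..<n}"
    then have "n - 1 = (n - 1 - l) + l" by simp
    then have "(- 1 :: 'k) ^ (n - 1) = (- 1) ^ (n - 1 - l) * (- 1) ^ l" by (metis power_add)
    then have "(- 1) ^ (n - 1) * ((1 - a ^ (n - l)) * (- 1) ^ l) = (- 1) ^ (n - 1 - l) * (1 - a ^ (n - l))"
      by (simp add: mult_ac power_mult_distrib[symmetric])
    then show "const_sf ((- 1) ^ (n - 1)) * (const_sf ((1 - a ^ (n - l)) * (- 1) ^ l) * (\<eta> (n - l) * \<epsilon> l))
        = const_sf ((1 - a) * (\<Sum>j=l..<n. (- a) ^ (n - 1 - j) * (- 1) ^ (j - l))) * (\<eta> (n - l) * \<epsilon> l)"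
      using l inner[of l] by (simp only: mult.assoc[symmetric] const_sf_mult[symmetric] lessThan_iff)
  qed
  also have "\<dots> = const_sf (1 - a) * (\<Sum>j<n. const_sf ((- a) ^ (n - 1 - j)) * W (n - j) j)"
    unfolding sum_W sum_distrib_left[of "const_sf (1 - a)"] by (simp only: const_sf_mult mult.assoc)
  finally show ?thesis .
qed

end

section \<open>Elementary functions of the cell weights of a hook\<close>

lemma fps_prod_top_coeffs:
  fixes x :: "'c \<Rightarrow> 'a::field"
  assumes "finite C" "\<And>c. c \<in> C \<Longrightarrow> x c \<noteq> 0"
  defines "P \<equiv> \<Prod>c\<in>C. 1 + fps_const (x c) * fps_X"
  shows "fps_nth P (card C) = (\<Prod>c\<in>C. x c)"
    and "fps_nth (fps_X * P) (card C) = (\<Prod>c\<in>C. x c) * (\<Sum>c\<in>C. 1 / x c)"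
proof -
  \<comment> \<open>Multiplication by \<open>fps_X\<close> expresses the coefficient below the top
    without a subtraction, so empty C fits in; the vanishing above the top is carried along for the
    induction.\<close>
  have "fps_nth P (card C) = (\<Prod>c\<in>C. x c) \<and> (\<forall>m>card C. fps_nth P m = 0)
      \<and> fps_nth (fps_X * P) (card C) = (\<Prod>c\<in>C. x c) * (\<Sum>c\<in>C. 1 / x c)"
    using assms(1,2) unfolding P_def
  proof (induction C)
    case (insert c C)
    let ?P = "\<Prod>c\<in>C. 1 + fps_const (x c) * fps_X"
    have IH: "fps_nth ?P (card C) = (\<Prod>c\<in>C. x c)" "\<And>m. m > card C \<Longrightarrow> fps_nth ?P m = 0"
      "fps_nth (fps_X * ?P) (card C) = (\<Prod>c\<in>C. x c) * (\<Sum>c\<in>C. 1 / x c)"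
      using insert by auto
    have P: "(\<Prod>c\<in>insert c C. 1 + fps_const (x c) * fps_X) = ?P + fps_const (x c) * (fps_X * ?P)"
      using insert.hyps by (simp add: distrib_right mult.assoc)
    have XP: "fps_X * (?P + fps_const (x c) * (fps_X * ?P)) = fps_X * ?P + fps_const (x c) * (fps_X * (fps_X * ?P))"
      by (simp add: distrib_left mult.left_commute)
    have n: "fps_nth (fps_X * F) (Suc k) = fps_nth F k" for F :: "'a fps" and k by simp
    have card: "card (insert c C) = Suc (card C)" using insert.hyps by simp
    show ?case unfolding P
    proof (intro conjI allI impI)
      show "fps_nth (?P + fps_const (x c) * (fps_X * ?P)) (card (insert c C)) = (\<Prod>c\<in>insert c C. x c)"
        unfolding card fps_add_nth fps_mult_left_const_nth n using IH(1,2) insert.hyps by simp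
      show "fps_nth (?P + fps_const (x c) * (fps_X * ?P)) m = 0" if m: "m > card (insert c C)" for m
      proof -
        obtain k where "m = Suc k" "k > card C" using m unfolding card by (cases m) auto
        then show ?thesis using IH(2) by (simp only: fps_add_nth fps_mult_left_const_nth n) simp
      qed
      show "fps_nth (fps_X * (?P + fps_const (x c) * (fps_X * ?P))) (card (insert c C))
          = (\<Prod>c\<in>insert c C. x c) * (\<Sum>c\<in>insert c C. 1 / x c)"
        unfolding XP card fps_add_nth fps_mult_left_const_nth n IH(1,3)
        using insert.hyps insert.prems by (simp add: distrib_left)
    qed
  qed simp
  then show "fps_nth P (card C) = (\<Prod>c\<in>C. x c)"
    and "fps_nth (fps_X * P) (card C) = (\<Prod>c\<in>C. x c) * (\<Sum>c\<in>C. 1 / x c)" by blast+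
qed

lemma hook_partition: "j < n \<Longrightarrow> (n - j) # replicate j 1 \<in> partitions_of n"
proof -
  have "sorted_wrt (\<ge>) (replicate j (1 :: nat))" by (induction j) auto
  then show "j < n \<Longrightarrow> (n - j) # replicate j 1 \<in> partitions_of n"
    by (auto simp: partitions_of_def sum_list_replicate)
qed

lemma plist_hook: "j < n \<Longrightarrow> plist (mset ((n - j) # replicate j 1)) = (n - j) # replicate j 1"
  using hook_partition by (intro plist_mset) (auto simp: partitions_def)

lemma beta_column:
  assumes "a * b = (1 :: 'a::comm_ring_1)"
  shows "beta a b (replicate j 1) = a + (1 - a) * b ^ j"
proof (induction j)
  case (Suc j)
  have "b * (a + (1 - a) * b ^ j) + (1 - b) * a = a * b + (1 - a) * b ^ Suc j + a - a * b"
    by (simp add: algebra_simps)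
  then show ?case using Suc by (simp add: assms add.commute del: power_Suc)
qed simp

lemma beta_hook:
  assumes ab: "a * b = (1 :: 'a::comm_ring_1)"
  shows "beta a b (r # replicate j 1) = 1 + (1 - b) * (a ^ r - b ^ j)"
proof -
  have "b * (a + (1 - a) * b ^ j) = a * b + (b - a * b) * b ^ j" by (simp add: algebra_simps)
  then show ?thesis unfolding beta.simps beta_column[OF ab] ab by (simp add: algebra_simps)
qed

text \<open>The quotient of e_(n-1) by e_n in n variables is the sum of their inverses. With b =
  1/a, inverting the cell weights exchanges a and b, so this sum is \<open>cell_sum b a\<close>,
  which the eigenvalue formula \<open>beta_hook\<close> evaluates.\<close>

lemma hook_coeffs:
  fixes a b :: "'a::field"
  assumes ab: "a * b = 1" and a: "a \<noteq> 1" and j: "j < n"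
  defines "C \<equiv> cells ((n - j) # replicate j 1)"
  defines "P \<equiv> \<Prod>c\<in>C. 1 + fps_const (cell_weight a b c) * fps_X"
  shows "(1 - a ^ n) * fps_nth P n = (1 - a) * a ^ (n - 1 - j) * fps_nth P (n - 1)"
proof -
  have nz: "a \<noteq> 0" "b \<noteq> 0" using ab by auto
  then have b: "b = 1 / a" using ab by (simp add: field_simps)
  have C: "finite C" "card C = n" unfolding C_def using j by (simp_all add: finite_cells card_cells sum_list_replicate)
  define S where "S = cell_sum b a ((n - j) # replicate j 1)"
  have "(\<Sum>c\<in>C. 1 / cell_weight a b c) = S"
    unfolding S_def cell_sum_def C_def case_prod_unfold
    by (rule sum.cong[OF refl]) (simp add: b power_divide)
  then have S: "fps_nth P n = (\<Prod>c\<in>C. cell_weight a b c)" "fps_nth (fps_X * P) n = (\<Prod>c\<in>C. cell_weight a b c) * S"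
    using fps_prod_top_coeffs[OF C(1), of "cell_weight a b"] nz unfolding C(2) P_def by simp_all
  have "b * a = 1" using ab by (simp add: mult.commute)
  then have "1 + (1 - a) * (b ^ (n - j) - a ^ j) = 1 - (1 - a) * ((1 - b) * S)"
    using beta_hook[of b a "n - j" j] beta_eq_cell_sum[of b a "(n - j) # replicate j 1"]
    unfolding S_def by (simp add: mult_ac)
  then have "(1 - a) * ((1 - b) * S) = (1 - a) * (a ^ j - b ^ (n - j))" by (simp add: algebra_simps)
  then have S': "(1 - b) * S = a ^ j - b ^ (n - j)" using a by simp
  have "1 - a = a * (b - 1)" using ab by (simp add: algebra_simps)
  then have "(1 - a) * a ^ (n - 1 - j) * S = - (a * a ^ (n - 1 - j)) * ((1 - b) * S)"
    by (simp only:) (simp add: algebra_simps)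
  also have "a * a ^ (n - 1 - j) = a ^ (n - j)" using j by (simp flip: power_Suc add: Suc_diff_Suc)
  also have "- (a ^ (n - j)) * ((1 - b) * S) = (a * b) ^ (n - j) - a ^ (n - j) * a ^ j"
    unfolding S' power_mult_distrib by (simp add: algebra_simps)
  also have "\<dots> = 1 - a ^ n" using j ab by (simp flip: power_add)
  finally have E: "(1 - a) * a ^ (n - 1 - j) * S = 1 - a ^ n" .
  have "(1 - a ^ n) * fps_nth P n = (1 - a) * a ^ (n - 1 - j) * fps_nth (fps_X * P) n"
    unfolding S E[symmetric] by (simp only: mult_ac)
  moreover have "fps_nth (fps_X * P) n = fps_nth P (n - 1)" using j by simp
  ultimately show ?thesis by simp
qed

section \<open>Comparison of the two sides at t = 1/q\<close>

interpretation hk: hook q_gen "1 / q_gen"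
  using q_gen_power_neq_1 q_gen_nonzero by unfold_locales auto

lemma beta_q_gen_inject:
  assumes "0 \<notin># K" "0 \<notin># L" "sum_mset K = sum_mset L"
    and eq: "beta q_gen (1 / q_gen) (plist K) = beta q_gen (1 / q_gen) (plist L)"
  shows "K = L"
proof -
  have "(1 - q_gen) * (1 - 1 / q_gen) \<noteq> 0" using q_gen_neq_1 q_gen_nonzero by simp
  then have "cell_sum q_gen (1 / q_gen) (plist K) = cell_sum q_gen (1 / q_gen) (plist L)"
    using eq unfolding beta_eq_cell_sum by simp
  then have "plist K = plist L"
    using cell_sum_q_inverse_inject plist_partition[OF assms(1)] plist_partition[OF assms(2)] assms(3) by metis
  then show ?thesis by (metis mset_plist)
qed

lemma rval_beta: "rval x y (beta q_var t_var \<nu>) (beta x y \<nu>)"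
  unfolding beta_eq_cell_sum by (intro rval_diff rval_mult rval_1 rval_q_var rval_t_var rval_cell_sum)

definition elem_val :: "nat \<Rightarrow> nat multiset \<Rightarrow> rat poly fract" where
  "elem_val k L = fps_nth (\<Prod>c\<in>cells (plist L). 1 + fps_const (cell_weight q_gen (1 / q_gen) c) * fps_X) k"

definition lagr_q :: "nat \<Rightarrow> nat multiset list \<Rightarrow> rat poly fract symfun \<Rightarrow> rat poly fract symfun" where
  "lagr_q k = lagr q_gen (1 / q_gen) (\<lambda>K. beta q_gen (1 / q_gen) (plist K)) (elem_val k)"

lemma specialize_Delta_elem:
  assumes Ks: "distinct Ks" "set Ks = {K \<in> pos_msets. sum_mset K = n}"
    and F: "homogeneous_sf n F" "prel q_gen (1 / q_gen) F G"
  shows "specializable (Delta_op (elem_sf k) F)" "specialize (Delta_op (elem_sf k) F) = lagr_q k Ks G"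
proof -
  have "inj_on (\<lambda>K. beta q_gen (1 / q_gen) (plist K)) (set Ks)"
    by (rule inj_onI) (use beta_q_gen_inject Ks(2) in auto)
  then have "prel q_gen (1 / q_gen) (Delta_op (elem_sf k) F) (lagr_q k Ks G)"
    unfolding Delta_op_eq_lagr[OF Ks F(1)] lagr_q_def elem_val_def
    by (intro prel_lagr Ks(1) F(2) rval_beta rval_f_val_elem)
  then show "specializable (Delta_op (elem_sf k) F)" "specialize (Delta_op (elem_sf k) F) = lagr_q k Ks G"
    by (rule prel_specialize)+
qed

lemma lagr_q_scale: "lagr_q k Ks (const_sf c * F) = const_sf c * lagr_q k Ks F"
  unfolding lagr_q_def by (rule lagr_scale)

lemma lagr_q_sum: "lagr_q k Ks (\<Sum>i\<in>I. f i) = (\<Sum>i\<in>I. lagr_q k Ks (f i))"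
proof -
  have "lagr_q k Ks 0 = 0" unfolding lagr_q_def by (rule linear_sfD(3)[OF linear_lagr])
  then show ?thesis
    by (induction I rule: infinite_finite_induct) (simp_all add: lagr_q_def lagr_add)
qed

lemma lagr_q_W:
  assumes Ks: "distinct Ks" "set Ks = {K \<in> pos_msets. sum_mset K = n}" and j: "j < n"
  shows "lagr_q k Ks (hk.W (n - j) j) = const_sf (elem_val k (mset ((n - j) # replicate j 1))) * hk.W (n - j) j"
  unfolding lagr_q_def
proof (rule lagr_eigen[OF Ks(1)])
  let ?\<nu> = "(n - j) # replicate j (1 :: nat)"
  show "mset ?\<nu> \<in> set Ks" unfolding Ks(2) using mset_partition[OF hook_partition[OF j]] by simp
  note plist_hook[OF j]
  moreover have "beta q_gen (1 / q_gen) ?\<nu> = 1 + (1 - 1 / q_gen) * (q_gen ^ (n - j) - (1 / q_gen) ^ j)"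
    by (rule beta_hook) (simp add: q_gen_nonzero)
  ultimately show "macD q_gen (1 / q_gen) (hk.W (n - j) j)
      = const_sf (beta q_gen (1 / q_gen) (plist (mset ?\<nu>))) * hk.W (n - j) j"
    by (simp only: hk.macD_W)
  show "inj_on (\<lambda>K. beta q_gen (1 / q_gen) (plist K)) (set Ks)"
    by (rule inj_onI) (use beta_q_gen_inject Ks(2) in auto)
qed

lemma elem_val_hook:
  assumes "j < n"
  shows "(1 - q_gen ^ n) * elem_val n (mset ((n - j) # replicate j 1))
    = (1 - q_gen) * q_gen ^ (n - 1 - j) * elem_val (n - 1) (mset ((n - j) # replicate j 1))"
  unfolding elem_val_def plist_hook[OF assms] by (rule hook_coeffs[OF hk.ab q_gen_neq_1 assms])

theorem theorem7p8:
  fixes n :: nat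
  assumes "n \<ge> 1"
  shows "specializable (Delta_op (elem_sf n) (omega_sf (power_sf n)))
    \<and> specializable (Delta_op (elem_sf (n - 1)) (elem_sf n))
    \<and> specialize (Delta_op (elem_sf n) (omega_sf (power_sf n)))
      = specialize (Delta_op (elem_sf (n - 1)) (elem_sf n))"
proof -
  obtain Ks where Ks: "set Ks = {K \<in> pos_msets. sum_mset K = n}" "distinct Ks"
    using finite_distinct_list[OF finite_pos_msets] by blast
  let ?\<nu> = "\<lambda>j. mset ((n - j) # replicate j (1 :: nat))"
  have \<omega>: "omega_sf (power_sf n) = const_sf ((- 1) ^ (n - 1)) * (power_sf n :: ratfun symfun)"
    unfolding omega_sf_power_sf[OF assms] by (simp add: const_sf_power const_sf_uminus)
  have h1: "homogeneous_sf n (omega_sf (power_sf n) :: ratfun symfun)"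
    unfolding \<omega> by (intro homogeneous_scale homogeneous_power_sf)
  have p1: "prel q_gen (1 / q_gen) (omega_sf (power_sf n)) (const_sf ((- 1) ^ (n - 1)) * power_sf n)"
    unfolding \<omega> by (intro prel_mult prel_const rval_power rval_uminus rval_1 prel_power assms)
  note 1 = specialize_Delta_elem[OF Ks(2,1) h1 p1, of n]
  note 2 = specialize_Delta_elem[OF Ks(2,1) homogeneous_elem_sf prel_elem_sf, of "n - 1"]
  have "lagr_q n Ks (const_sf ((- 1) ^ (n - 1)) * power_sf n)
      = (\<Sum>j<n. const_sf ((- 1) ^ (n - 1) * (1 - q_gen ^ n) * (- 1) ^ j * elem_val n (?\<nu> j)) * hk.W (n - j) j)"
    unfolding hk.power_sf_W[OF assms] lagr_q_scale lagr_q_sum sum_distrib_left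
    by (rule sum.cong[OF refl]) (simp only: lagr_q_W[OF Ks(2,1)] lessThan_iff const_sf_mult mult.assoc)
  \<comment> \<open>The sign from omega and the sign (-1)^j in the hook expansion of p_n combine to
    the sign of (-q)^(n-1-j) in that of e_n; the remaining factors agree by
    \<open>elem_val_hook\<close>.\<close>
  also have "\<dots> = (\<Sum>j<n. const_sf ((1 - q_gen) * (- q_gen) ^ (n - 1 - j) * elem_val (n - 1) (?\<nu> j)) * hk.W (n - j) j)"
  proof (rule sum.cong[OF refl])
    fix j assume j: "j \<in> {..<n}"
    then have "n - 1 = (n - 1 - j) + j" by simp
    then have "(- 1 :: rat poly fract) ^ (n - 1) * (- 1) ^ j = (- 1) ^ (n - 1 - j) * ((- 1) ^ j * (- 1) ^ j)"
      by (metis power_add mult.assoc)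
    then have s: "(- 1 :: rat poly fract) ^ (n - 1) * (- 1) ^ j = (- 1) ^ (n - 1 - j)"
      by (simp flip: power_mult_distrib)
    have "(- 1) ^ (n - 1) * (1 - q_gen ^ n) * (- 1) ^ j * elem_val n (?\<nu> j)
        = ((- 1) ^ (n - 1) * (- 1) ^ j) * ((1 - q_gen ^ n) * elem_val n (?\<nu> j))" by (simp only: mult_ac)
    also have "\<dots> = (- 1) ^ (n - 1 - j) * ((1 - q_gen) * q_gen ^ (n - 1 - j) * elem_val (n - 1) (?\<nu> j))"
      using j elem_val_hook[of j n] unfolding s by (simp only: lessThan_iff)
    also have "\<dots> = (1 - q_gen) * (- q_gen) ^ (n - 1 - j) * elem_val (n - 1) (?\<nu> j)"
      unfolding power_minus[of q_gen] by (simp only: mult_ac)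
    finally show "const_sf ((- 1) ^ (n - 1) * (1 - q_gen ^ n) * (- 1) ^ j * elem_val n (?\<nu> j)) * hk.W (n - j) j
        = const_sf ((1 - q_gen) * (- q_gen) ^ (n - 1 - j) * elem_val (n - 1) (?\<nu> j)) * hk.W (n - j) j" by (simp only:)
  qed
  also have "\<dots> = lagr_q (n - 1) Ks (elem_sf n)"
    unfolding hk.elem_sf_W[OF assms] lagr_q_scale lagr_q_sum sum_distrib_left
    by (rule sum.cong[OF refl]) (simp only: lagr_q_W[OF Ks(2,1)] lessThan_iff const_sf_mult mult.assoc)
  finally show ?thesis using 1 2 by simp
qed

end
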